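(* Let $t_0<\vartheta$ be real numbers, $n,r,s\in\mathbb{N}$, $\alpha\in(0,1)$, let $\mathbb{U}\subset\mathbb{R}^r$, $\mathbb{V}\subset\mathbb{R}^s$ be compact, $R_0>0$, and let $f:[t_0,\vartheta]\times\mathbb{R}^n\times\mathbb{U}\times\mathbb{V}\to\mathbb{R}^n$ and $\sigma:C([t_0,\vartheta],\mathbb{R}^n)\to\mathbb{R}$ satisfy: (i) $f$ is continuous; (ii) for any $R\ge 0$ there exists $\lambda>0$ such that $\|f(t,x,u,v)-f(t,x',u,v)\|\le\lambda\|x-x'\|$ for any $t\in[t_0,\vartheta]$, $x,x'\in B(R)$, $u\in\mathbb{U}$, $v\in\mathbb{V}$; (iii) there exists $c>0$ such that $\|f(t,x,u,v)\|\le(1+\|x\|)c$ for any $t\in[t_0,\vartheta]$, $x\in\mathbb{R}^n$, $u\in\mathbb{U}$, $v\in\mathbb{V}$; (iv) $\min_{u\in\mathbb{U}}\max_{v\in\mathbb{V}}\langle s,f(t,x,u,v)\rangle=\max_{v\in\mathbb{V}}\min_{u\in\mathbb{U}}\langle s,f(t,x,u,v)\rangle$ for any $t\in[t_0,\vartheta]$ and $x,s\in\mathbb{R}^n$; (v) $\sigma$ is continuous (with respect to the uniform norm). Let $G_\ast$ and the functions $\widehat\rho_h:G_\ast\to\mathbb{R}$, $h>0$, (values of the approximating games) be as defined in the context. Then for any initial position $(t_\ast,w_\ast(\cdot))\in G_\ast$ the limit $$\lim_{h\downarrow0}\widehat\rho_h(t_\ast,w_\ast(\cdot))=\widehat\rho\,(t_\ast,w_\ast(\cdot))$$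 exists. Moreover, the convergence is uniform in $(t_\ast,w_\ast(\cdot))\in G_\ast$.
   Context: Notation. $\|\cdot\|$, $\langle\cdot,\cdot\rangle$ are the Euclidean norm and scalar product; $B(R)=\{y\in\mathbb{R}^n:\|y\|\le R\}$; $\Gamma$ is the gamma function. For $x:[t_0,T]\to\mathbb{R}^n$ and $\beta\in(0,1)$: $(I^\beta x)(t)=\frac1{\Gamma(\beta)}\int_{t_0}^t\frac{x(\tau)}{(t-\tau)^{1-\beta}}d\tau$, $(D^\beta x)(t)=\frac{d}{dt}(I^{1-\beta}x)(t)$ (Riemann-Liouville), and $({}^CD^\beta x)(t)=\big(D^\beta(x(\cdot)-x(t_0))\big)(t)$ (Caputo). $I^\alpha(L^\infty([t_0,T],\mathbb{R}^n))$ is the set of functions $I^\alpha\varphi$ with $\varphi\in L^\infty([t_0,T],\mathbb{R}^n)$. $\operatorname{Lip}^0([t_0,T],\mathbb{R}^n)$ is the set of Lipschitz functions $y:[t_0,T]\to\mathbb{R}^n$ with $y(t_0)=0$. $C([t_0,T],\mathbb{R}^n)$ carries the uniform norm. Admissible positions. $G$ is the set of pairs $(t,w(\cdot))$ with $t\in[t_0,\vartheta]$, $w(\cdot)\in C([t_0,t],\mathbb{R}^n)$. $G_\ast$ is the set of $(t,w(\cdot))\in G$ such that $w(t_0)\in B(R_0)$, $w(\cdot)\in\{w(t_0)\}+I^\alpha(L^\infty([t_0,t],\mathbb{R}^n))$ and $\|({}^CD^\alpha w)(\tau)\|\le(1+\|w(\tau)\|)c$ for a.e. $\tau\in[t_0,t]$,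 where $c$ is the constant from the growth condition on $f$. There is a constant $M_1>0$ (fixed) with $\|({}^CD^\alpha w)(\tau)\|\le M_1$ for a.e. $\tau\in[t_0,t]$, for all $(t,w(\cdot))\in G_\ast$. Controls. For $t_\ast\le\vartheta$, $\mathcal{U}(t_\ast,\vartheta)$ and $\mathcal{V}(t_\ast,\vartheta)$ are the sets of measurable functions $[t_\ast,\vartheta)\to\mathbb{U}$ and $[t_\ast,\vartheta)\to\mathbb{V}$. Approximating game. For $h>0$ let $(\Delta_h^{1-\alpha}y)(t)=\sum_{i=0}^{[(t-t_0)/h]}(-1)^i\binom{1-\alpha}{i}y(t-ih)$, where $[\cdot]$ is the integer part. For $w_0\in B(R_0)$, $h>0$ the approximating system is $$\dot y(t)=f\big(t,\,w_0+h^{\alpha-1}(\Delta_h^{1-\alpha}y)(t),\,p(t),\,q(t)\big),\quad p(t)\in\mathbb{U},\ q(t)\in\mathbb{V},$$ with quality index $\gamma_{w_0,h}=\sigma\big(w_0+h^{\alpha-1}(\Delta_h^{1-\alpha}y)(\cdot)\big)$; the first player chooses $p$ and minimizes, the second chooses $q$ and maximizes. Let $G^0=\{(t,r(\cdot))\in G: r(t_0)=0\}$. For each $h>0$ fix $c_h>0$ such that $\|f(t,w_0+h^{\alpha-1}(\Delta_h^{1-\alpha}r)(t),p,q)\|\le(1+\max_{\tau\in[t_0,t]}\|r(\tau)\|)c_h$ for all $w_0\in B(R_0)$, $(t,r(\cdot))\in G^0$, $p\in\mathbb{U}$, $q\in\mathbb{V}$, and put $\widetilde c_h=\max\{M_1,c_h\}$.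 $G_h^0$ is the set of $(t,r(\cdot))\in G^0$ with $r(\cdot)\in\operatorname{Lip}^0([t_0,t],\mathbb{R}^n)$ and $\|\dot r(\tau)\|\le(1+\max_{\xi\in[t_0,\tau]}\|r(\xi)\|)\widetilde c_h$ for a.e. $\tau\in[t_0,t]$. From $(t_\ast,r_\ast(\cdot))\in G_h^0$, controls $p(\cdot)\in\mathcal{U}(t_\ast,\vartheta)$, $q(\cdot)\in\mathcal{V}(t_\ast,\vartheta)$ generate a unique motion $y(\cdot)\in\operatorname{Lip}^0([t_0,\vartheta],\mathbb{R}^n)$ with $y=r_\ast$ on $[t_0,t_\ast]$ satisfying the approximating system a.e. on $[t_\ast,\vartheta]$. A non-anticipative strategy of the first player is a map $\mathfrak{a}:\mathcal{V}(t_\ast,\vartheta)\to\mathcal{U}(t_\ast,\vartheta)$ such that for any $t^\ast\in[t_\ast,\vartheta]$ and $q,q'\in\mathcal{V}(t_\ast,\vartheta)$ with $q=q'$ a.e. on $[t_\ast,t^\ast]$ one has $\mathfrak{a}(q)=\mathfrak{a}(q')$ a.e. on $[t_\ast,t^\ast]$; non-anticipative strategies $\mathfrak{b}:\mathcal{U}(t_\ast,\vartheta)\to\mathcal{V}(t_\ast,\vartheta)$ of the second player are defined symmetrically. The lower value of the approximating game is $\inf_{\mathfrak{a}}\sup_{q(\cdot)\in\mathcal{V}(t_\ast,\vartheta)}\gamma_{w_0,h}$ (motion generated from $(t_\ast,r_\ast(\cdot))$ by $q(\cdot)$ and $p(\cdot)=\mathfrak{a}(q(\cdot))$), the upper value is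 $\sup_{\mathfrak{b}}\inf_{p(\cdot)\in\mathcal{U}(t_\ast,\vartheta)}\gamma_{w_0,h}$ (motion generated by $p(\cdot)$ and $q(\cdot)=\mathfrak{b}(p(\cdot))$). It is known that they coincide; the common value is denoted $\rho_{w_0,h}(t_\ast,r_\ast(\cdot))$, $(t_\ast,r_\ast(\cdot))\in G_h^0$. For $(t_\ast,w_\ast(\cdot))\in G_\ast$ the corresponding initial position of the approximating system is $(t_\ast,r_\ast(\cdot))\in G_h^0$ with $r_\ast(t)=\big(I^{1-\alpha}(w_\ast(\cdot)-w_\ast(t_0))\big)(t)$, $t\in[t_0,t_\ast]$. Put $\widehat\rho_h(t_\ast,w_\ast(\cdot))=\rho_{w_0,h}(t_\ast,r_\ast(\cdot))$ with $w_0=w_\ast(t_0)$ and this $r_\ast(\cdot)$. *)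

theory Defs
  imports "HOL-Analysis.Analysis"
begin

text \<open>
  A function on an interval is represented by a total function on \<^typ>\<open>real\<close> of which only the
  restriction to that interval is ever used; "almost everywhere" and measurability refer to
  Lebesgue measure on the interval.
\<close>

section \<open>Fractional integrals and derivatives\<close>

definition rl_integral :: "real \<Rightarrow> real \<Rightarrow> (real \<Rightarrow> real ^ 'n) \<Rightarrow> real \<Rightarrow> real ^ 'n" where
  "rl_integral t0 \<beta> x t =
     (1 / Gamma \<beta>) *\<^sub>R (LINT \<tau>:{t0..t}|lebesgue. x \<tau> /\<^sub>R ((t - \<tau>) powr (1 - \<beta>)))"

text \<open>
  The derivative is taken within the domain \<open>{t0..T}\<close>, so it does not depend on the values of the
  function outside. If \<open>x - x t0\<close> is a fractional integral of order \<open>\<beta>\<close> of an essentially bounded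
  function, then the function differentiated in \<open>caputo_deriv\<close> is Lipschitz, so its derivative
  exists almost everywhere.
\<close>

definition rl_deriv ::
    "real \<Rightarrow> real \<Rightarrow> real \<Rightarrow> (real \<Rightarrow> real ^ 'n) \<Rightarrow> real \<Rightarrow> real ^ 'n" where
  "rl_deriv t0 T \<beta> x t = vector_derivative (rl_integral t0 (1 - \<beta>) x) (at t within {t0..T})"

definition caputo_deriv ::
    "real \<Rightarrow> real \<Rightarrow> real \<Rightarrow> (real \<Rightarrow> real ^ 'n) \<Rightarrow> real \<Rightarrow> real ^ 'n" where
  "caputo_deriv t0 T \<beta> x = rl_deriv t0 T \<beta> (\<lambda>t. x t - x t0)"

definition Linf :: "real \<Rightarrow> real \<Rightarrow> (real \<Rightarrow> real ^ 'n) set" where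
  "Linf t0 T = {\<phi>. \<phi> \<in> borel_measurable (lebesgue_on {t0..T}) \<and>
                   (\<exists>K. AE t in lebesgue_on {t0..T}. norm (\<phi> t) \<le> K)}"

definition Lip0 :: "real \<Rightarrow> real \<Rightarrow> (real \<Rightarrow> real ^ 'n) set" where
  "Lip0 t0 T = {y. (\<exists>L. L-lipschitz_on {t0..T} y) \<and> y t0 = 0}"


section \<open>Continuous functionals\<close>

text \<open>
  Continuity in the uniform norm of a functional on the continuous functions on \<open>{t0..T}\<close>. It
  forces the value of the functional to depend only on the restriction of its argument to
  \<open>{t0..T}\<close>, since functions with equal restrictions are within every positive distance.
\<close>

definition continuous_functional ::
    "real \<Rightarrow> real \<Rightarrow> ((real \<Rightarrow> real ^ 'n) \<Rightarrow> real) \<Rightarrow> bool" where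
  "continuous_functional t0 T \<sigma> \<longleftrightarrow>
     (\<forall>x. continuous_on {t0..T} x \<longrightarrow>
       (\<forall>\<epsilon>>0. \<exists>\<delta>>0. \<forall>y. continuous_on {t0..T} y \<longrightarrow>
          (\<forall>t\<in>{t0..T}. norm (y t - x t) < \<delta>) \<longrightarrow> \<bar>\<sigma> y - \<sigma> x\<bar> < \<epsilon>))"


section \<open>Positions, controls and strategies\<close>

definition positions :: "real \<Rightarrow> real \<Rightarrow> (real \<times> (real \<Rightarrow> real ^ 'n)) set" where
  "positions t0 \<theta> = {(t, w). t \<in> {t0..\<theta>} \<and> continuous_on {t0..t} w}"

definition admissible_positions ::
    "real \<Rightarrow> real \<Rightarrow> real \<Rightarrow> real \<Rightarrow> real \<Rightarrow> (real \<times> (real \<Rightarrow> real ^ 'n)) set" where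
  "admissible_positions t0 \<theta> \<alpha> c R0 = {(t, w). (t, w) \<in> positions t0 \<theta> \<and>
     w t0 \<in> cball 0 R0 \<and>
     (\<exists>\<phi>\<in>Linf t0 t. \<forall>\<tau>\<in>{t0..t}. w \<tau> = w t0 + rl_integral t0 \<alpha> \<phi> \<tau>) \<and>
     (AE \<tau> in lebesgue_on {t0..t}. norm (caputo_deriv t0 t \<alpha> w \<tau>) \<le> (1 + norm (w \<tau>)) * c)}"

definition controls :: "real \<Rightarrow> real \<Rightarrow> (real ^ 'k) set \<Rightarrow> (real \<Rightarrow> real ^ 'k) set" where
  "controls t \<theta> W = {p. p \<in> borel_measurable (lebesgue_on {t..<\<theta>}) \<and> (\<forall>\<tau>\<in>{t..<\<theta>}. p \<tau> \<in> W)}"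

text \<open>
  Non-anticipative maps from the controls with values in \<open>W\<close> (the opponent's) to the controls with
  values in \<open>W'\<close>. Since \<open>t' = \<theta>\<close> is allowed, the response does not depend, up to a null set,
  on the values of the opponent's control outside \<open>{t..<\<theta>}\<close>.
\<close>

definition nonanticipative_strategies ::
    "real \<Rightarrow> real \<Rightarrow> (real ^ 'k) set \<Rightarrow> (real ^ 'm) set
      \<Rightarrow> ((real \<Rightarrow> real ^ 'k) \<Rightarrow> (real \<Rightarrow> real ^ 'm)) set" where
  "nonanticipative_strategies t \<theta> W W' = {\<a>.
     (\<forall>q\<in>controls t \<theta> W. \<a> q \<in> controls t \<theta> W') \<and>
     (\<forall>t'\<in>{t..\<theta>}. \<forall>q\<in>controls t \<theta> W. \<forall>q'\<in>controls t \<theta> W.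
        (AE \<tau> in lebesgue_on {t..t'}. q \<tau> = q' \<tau>) \<longrightarrow>
        (AE \<tau> in lebesgue_on {t..t'}. \<a> q \<tau> = \<a> q' \<tau>))}"


section \<open>The approximating game\<close>

definition frac_diff :: "real \<Rightarrow> real \<Rightarrow> real \<Rightarrow> (real \<Rightarrow> real ^ 'n) \<Rightarrow> real \<Rightarrow> real ^ 'n" where
  "frac_diff t0 h \<beta> y t =
     (\<Sum>i = 0..nat \<lfloor>(t - t0) / h\<rfloor>. ((- 1) ^ i * (\<beta> gchoose i)) *\<^sub>R y (t - real i * h))"

definition approx_state ::
    "real \<Rightarrow> real \<Rightarrow> real ^ 'n \<Rightarrow> real \<Rightarrow> (real \<Rightarrow> real ^ 'n) \<Rightarrow> real \<Rightarrow> real ^ 'n" where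
  "approx_state t0 \<alpha> w0 h y t = w0 + h powr (\<alpha> - 1) *\<^sub>R frac_diff t0 h (1 - \<alpha>) y t"

definition is_motion ::
    "real \<Rightarrow> real \<Rightarrow> real \<Rightarrow> (real \<Rightarrow> real ^ 'n \<Rightarrow> real ^ 'r \<Rightarrow> real ^ 's \<Rightarrow> real ^ 'n)
      \<Rightarrow> real ^ 'n \<Rightarrow> real \<Rightarrow> real \<Rightarrow> (real \<Rightarrow> real ^ 'n)
      \<Rightarrow> (real \<Rightarrow> real ^ 'r) \<Rightarrow> (real \<Rightarrow> real ^ 's) \<Rightarrow> (real \<Rightarrow> real ^ 'n) \<Rightarrow> bool" where
  "is_motion t0 \<theta> \<alpha> f w0 h ts rs p q y \<longleftrightarrow>
     y \<in> Lip0 t0 \<theta> \<and> (\<forall>t\<in>{t0..ts}. y t = rs t) \<and>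
     (AE t in lebesgue_on {ts..\<theta>}.
        (y has_vector_derivative f t (approx_state t0 \<alpha> w0 h y t) (p t) (q t))
          (at t within {t0..\<theta>}))"

text \<open>
  The motion exists and is unique on \<open>{t0..\<theta>}\<close>; the total functions representing it differ only
  outside this interval, where they do not affect the quality index, so any of them may be chosen.
\<close>

definition motion ::
    "real \<Rightarrow> real \<Rightarrow> real \<Rightarrow> (real \<Rightarrow> real ^ 'n \<Rightarrow> real ^ 'r \<Rightarrow> real ^ 's \<Rightarrow> real ^ 'n)
      \<Rightarrow> real ^ 'n \<Rightarrow> real \<Rightarrow> real \<Rightarrow> (real \<Rightarrow> real ^ 'n)
      \<Rightarrow> (real \<Rightarrow> real ^ 'r) \<Rightarrow> (real \<Rightarrow> real ^ 's) \<Rightarrow> real \<Rightarrow> real ^ 'n" where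
  "motion t0 \<theta> \<alpha> f w0 h ts rs p q = (SOME y. is_motion t0 \<theta> \<alpha> f w0 h ts rs p q y)"

definition quality ::
    "real \<Rightarrow> real \<Rightarrow> real \<Rightarrow> (real \<Rightarrow> real ^ 'n \<Rightarrow> real ^ 'r \<Rightarrow> real ^ 's \<Rightarrow> real ^ 'n)
      \<Rightarrow> ((real \<Rightarrow> real ^ 'n) \<Rightarrow> real) \<Rightarrow> real ^ 'n \<Rightarrow> real \<Rightarrow> real \<Rightarrow> (real \<Rightarrow> real ^ 'n)
      \<Rightarrow> (real \<Rightarrow> real ^ 'r) \<Rightarrow> (real \<Rightarrow> real ^ 's) \<Rightarrow> real" where
  "quality t0 \<theta> \<alpha> f \<sigma> w0 h ts rs p q =
     \<sigma> (approx_state t0 \<alpha> w0 h (motion t0 \<theta> \<alpha> f w0 h ts rs p q))"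

text \<open>
  In the games considered here the quality index is bounded over all pairs of controls, so the
  infima and suprema of reals below are taken over nonempty bounded sets.
\<close>

definition lower_value ::
    "real \<Rightarrow> real \<Rightarrow> real \<Rightarrow> (real ^ 'r) set \<Rightarrow> (real ^ 's) set
      \<Rightarrow> (real \<Rightarrow> real ^ 'n \<Rightarrow> real ^ 'r \<Rightarrow> real ^ 's \<Rightarrow> real ^ 'n)
      \<Rightarrow> ((real \<Rightarrow> real ^ 'n) \<Rightarrow> real) \<Rightarrow> real ^ 'n \<Rightarrow> real \<Rightarrow> real \<Rightarrow> (real \<Rightarrow> real ^ 'n) \<Rightarrow> real" where
  "lower_value t0 \<theta> \<alpha> U V f \<sigma> w0 h ts rs =
     (INF \<a>\<in>nonanticipative_strategies ts \<theta> V U.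
        SUP q\<in>controls ts \<theta> V. quality t0 \<theta> \<alpha> f \<sigma> w0 h ts rs (\<a> q) q)"

definition upper_value ::
    "real \<Rightarrow> real \<Rightarrow> real \<Rightarrow> (real ^ 'r) set \<Rightarrow> (real ^ 's) set
      \<Rightarrow> (real \<Rightarrow> real ^ 'n \<Rightarrow> real ^ 'r \<Rightarrow> real ^ 's \<Rightarrow> real ^ 'n)
      \<Rightarrow> ((real \<Rightarrow> real ^ 'n) \<Rightarrow> real) \<Rightarrow> real ^ 'n \<Rightarrow> real \<Rightarrow> real \<Rightarrow> (real \<Rightarrow> real ^ 'n) \<Rightarrow> real" where
  "upper_value t0 \<theta> \<alpha> U V f \<sigma> w0 h ts rs =
     (SUP \<b>\<in>nonanticipative_strategies ts \<theta> U V.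
        INF p\<in>controls ts \<theta> U. quality t0 \<theta> \<alpha> f \<sigma> w0 h ts rs p (\<b> p))"

definition game_value ::
    "real \<Rightarrow> real \<Rightarrow> real \<Rightarrow> (real ^ 'r) set \<Rightarrow> (real ^ 's) set
      \<Rightarrow> (real \<Rightarrow> real ^ 'n \<Rightarrow> real ^ 'r \<Rightarrow> real ^ 's \<Rightarrow> real ^ 'n)
      \<Rightarrow> ((real \<Rightarrow> real ^ 'n) \<Rightarrow> real) \<Rightarrow> real ^ 'n \<Rightarrow> real \<Rightarrow> real \<Rightarrow> (real \<Rightarrow> real ^ 'n) \<Rightarrow> real" where
  "game_value t0 \<theta> \<alpha> U V f \<sigma> w0 h ts rs =
     (THE \<rho>. lower_value t0 \<theta> \<alpha> U V f \<sigma> w0 h ts rs = \<rho> \<and>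
             upper_value t0 \<theta> \<alpha> U V f \<sigma> w0 h ts rs = \<rho>)"

definition approx_value ::
    "real \<Rightarrow> real \<Rightarrow> real \<Rightarrow> (real ^ 'r) set \<Rightarrow> (real ^ 's) set
      \<Rightarrow> (real \<Rightarrow> real ^ 'n \<Rightarrow> real ^ 'r \<Rightarrow> real ^ 's \<Rightarrow> real ^ 'n)
      \<Rightarrow> ((real \<Rightarrow> real ^ 'n) \<Rightarrow> real) \<Rightarrow> real \<Rightarrow> real \<times> (real \<Rightarrow> real ^ 'n) \<Rightarrow> real" where
  "approx_value t0 \<theta> \<alpha> U V f \<sigma> h = (\<lambda>(ts, ws).
     game_value t0 \<theta> \<alpha> U V f \<sigma> (ws t0) h ts (rl_integral t0 (1 - \<alpha>) (\<lambda>t. ws t - ws t0)))"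

end

theory Submission
  imports Defs "HOL-Complex_Analysis.Great_Picard"
begin

text \<open>
  Let \<open>y\<close> be a motion of the approximating system with step \<open>h\<close>, and call
  \<open>x = w0 + h powr (\<alpha> - 1) *\<^sub>R frac_diff t0 h (1 - \<alpha>) y\<close> its state. Since \<open>y\<close> is the integral of
  its velocity \<open>\<phi>\<close>, the state is a Volterra integral \<open>x(t) = w0 + \<integral> k(t - \<tau>) \<phi>(\<tau>) d\<tau>\<close> whose kernel
  is a step function of Grunwald-Letnikov weights (\<open>approx_state_eq_volterra\<close>). As \<open>h\<close> tends to
  \<open>0\<close>, this kernel converges in \<open>L\<^sup>1\<close> to the kernel of the Riemann-Liouville integral \<open>I\<^sup>\<alpha>\<close>
  (\<open>gl_kernel_L1_convergence\<close>), and it has a dominating function that does not depend on \<open>h\<close>.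
  Hence all states lie in one bounded equicontinuous class, on which the quality index is uniformly
  continuous by the theorem of Arzela and Ascoli.

  Both things to be shown, that each approximating game has a value and that these values have the
  Cauchy property as \<open>h\<close> tends to \<open>0\<close>, follow from one comparison of two games that start
  from the same position. Denote the velocities in the two games by \<open>\<phi>1\<close>, \<open>\<phi>2\<close>, the states by
  \<open>x1\<close>, \<open>x2\<close>, and put \<open>s = I\<^sup>\<beta>(\<phi>1 - \<phi>2)\<close>. On a fine time grid, the first player in the first
  game and the second player in the second game use constant controls that are extremal in the
  direction \<open>s\<close> at the last grid point. By the saddle point condition, whatever the opponents do,
  \<open>\<langle>s, \<phi>1 - \<phi>2\<rangle> \<le> L \<parallel>s\<parallel> \<parallel>x1 - x2\<parallel>\<close> up to a small error. The energy inequality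
  \<open>\<parallel>s\<parallel>\<^sup>2 \<le> 2 I\<^sup>\<beta> \<langle>s, \<phi>1 - \<phi>2\<rangle>\<close> (\<open>fractional_energy\<close>) and a Gronwall argument make \<open>s\<close> small,
  provided that the difference of the states is controlled by \<open>s\<close> (\<open>aiming_estimate\<close>). There
  are two situations of this kind. If both steps are small, take \<open>\<beta> = \<alpha>\<close>: then \<open>x1 - x2\<close> is \<open>s\<close> up to
  the \<open>L\<^sup>1\<close> error of the kernels. If the steps are equal, take \<open>\<beta> = 1\<close>: then \<open>s\<close> is the difference of
  the motions, and the states are finite differences of the motions.

  To pass from such an aiming procedure to values, fix a number \<open>C\<close> and play on the grid. The game in
  which the second player wants to reach a quality index of at least \<open>C\<close> in the second game has
  finitely many moves and so is determined: either the second player can enforce it, or the first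
  player can prevent it. In the latter case the first player keeps the quality index of the first game
  at or below \<open>C + \<epsilon>\<close>, by playing it together with an imagined second game in which the preventing strategy
  and the extremal controls meet (\<open>finite_game_alternative\<close>). The strategies obtained in this way are delayed by one step of the
  grid; therefore they have a consistent pair of controls with every non-anticipative strategy of the
  opponent (\<open>delayed_fixed_point\<close>), and they bound the lower and the upper values alike. So each of the
  two values of the first game is at most each of the two values of the second one plus \<open>\<epsilon>\<close>
  (\<open>game_values_compare\<close>). With equal steps this gives the existence of the value, with small steps
  the Cauchy property.

  The estimates are uniform in the initial position because the initial pieces
  \<open>I\<^sup>1\<^sup>-\<^sup>\<alpha>(w - w(t0))\<close> of admissible positions are integrals of functions with a common bound
  (\<open>admissible_position_normal_form\<close>). This rests on the a priori bound of admissible \<open>w\<close> and on the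
  identity \<open>I\<^sup>1\<^sup>-\<^sup>\<alpha> I\<^sup>\<alpha> = I\<^sup>1\<close> (\<open>rl_semigroup\<close>).
\<close>

section \<open>Lipschitz functions and indefinite integrals\<close>

text \<open>
  Lebesgue's differentiation theorem for averages over \<open>{x..x + h}\<close> gives the right derivative; the
  left derivative follows by applying it to the reflected function.
\<close>

lemma indefinite_integral_has_derivative_AE:
  fixes f :: "real \<Rightarrow> 'b::euclidean_space"
  assumes f: "f integrable_on {a..b}"
  obtains N where "negligible N"
    "\<And>t. t \<in> {a..b} - N \<Longrightarrow> ((\<lambda>s. integral {a..s} f) has_vector_derivative f t) (at t within {a..b})"
proof -
  define g where "g t = (if t \<in> {a..b} then f t else 0)" for t
  have gi: "g integrable_on cbox c d" for c d
  proof -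
    have "g integrable_on UNIV"
      unfolding g_def by (subst integrable_restrict_UNIV) (rule f)
    then show ?thesis using integrable_on_subcbox by blast
  qed
  have gi': "(\<lambda>t. g (- t)) integrable_on cbox c d" for c d
  proof -
    have "g integrable_on {-d..-c}" using gi[of "-d" "-c"] by (simp only: cbox_interval)
    from Henstock_Kurzweil_Integration.integrable_reflect_real[THEN iffD2, OF this]
    have "(\<lambda>t. g (- t)) integrable_on cbox c d" by (simp only: minus_minus cbox_interval)
    then show ?thesis by simp
  qed
  obtain N1 where N1: "negligible N1" and R: "\<And>x e. \<lbrakk>x \<notin> N1; 0 < e\<rbrakk> \<Longrightarrow>
      \<exists>d>0. \<forall>h. 0 < h \<and> h < d \<longrightarrow>
        norm (integral (cbox x (x + h *\<^sub>R One)) g /\<^sub>R h ^ DIM(real) - g x) < e"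
    using integrable_ccontinuous_explicit[OF gi] by blast
  obtain N2 where N2: "negligible N2" and Lf: "\<And>x e. \<lbrakk>x \<notin> N2; 0 < e\<rbrakk> \<Longrightarrow>
      \<exists>d>0. \<forall>h. 0 < h \<and> h < d \<longrightarrow>
        norm (integral (cbox x (x + h *\<^sub>R One)) (\<lambda>t. g (- t)) /\<^sub>R h ^ DIM(real) - g (- x)) < e"
    using integrable_ccontinuous_explicit[OF gi'] by blast
  have N2': "negligible (uminus ` N2)"
    by (rule negligible_differentiable_image_negligible[OF _ N2]) (auto intro!: derivative_intros)
  show ?thesis
  proof
    show "negligible (N1 \<union> uminus ` N2)" using N1 N2' by simp
    fix t assume t: "t \<in> {a..b} - (N1 \<union> uminus ` N2)"
    have t1: "t \<notin> N1" and t2: "- t \<notin> N2" and tab: "a \<le> t" "t \<le> b"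
      using t by (auto simp: image_iff)
    have ga: "integral {c..d} g = integral {c..d} f" if "a \<le> c" "d \<le> b" for c d
      by (rule integral_cong) (use that in \<open>auto simp: g_def\<close>)
    have fi: "f integrable_on {c..d}" if "a \<le> c" "d \<le> b" for c d
      using integrable_on_subinterval[OF f] that by (simp add: atLeastatMost_subset_iff)
    show "((\<lambda>s. integral {a..s} f) has_vector_derivative f t) (at t within {a..b})"
      unfolding has_vector_derivative_def has_derivative_within_alt
    proof (intro conjI allI impI)
      show "bounded_linear (\<lambda>x. x *\<^sub>R f t)" by (rule bounded_linear_scaleR_left)
      fix e :: real assume e: "0 < e"
      obtain d1 where d1: "d1 > 0" "\<And>h. 0 < h \<Longrightarrow> h < d1 \<Longrightarrow>
          norm (integral {t..t+h} g /\<^sub>R h - g t) < e"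
        using R[OF t1 e] by auto
      obtain d2 where d2: "d2 > 0" "\<And>h. 0 < h \<Longrightarrow> h < d2 \<Longrightarrow>
          norm (integral {-t..-t+h} (\<lambda>t. g (- t)) /\<^sub>R h - g t) < e"
        using Lf[OF t2 e] by auto
      have *: "norm (v - h *\<^sub>R w) \<le> e * h" if "norm (v /\<^sub>R h - w) < e" "0 < h" for v w :: 'b and h :: real
      proof -
        have "v - h *\<^sub>R w = h *\<^sub>R (v /\<^sub>R h - w)" using that(2) by (simp add: algebra_simps)
        then have "norm (v - h *\<^sub>R w) = h * norm (v /\<^sub>R h - w)" using that(2) by simp
        then show ?thesis using that by (simp add: mult.commute)
      qed
      show "\<exists>d>0. \<forall>y\<in>{a..b}. norm (y - t) < d \<longrightarrow>
          norm (integral {a..y} f - integral {a..t} f - (y - t) *\<^sub>R f t) \<le> e * norm (y - t)"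
      proof (intro exI[of _ "min d1 d2"] conjI ballI impI)
        fix y assume y: "y \<in> {a..b}" "norm (y - t) < min d1 d2"
        consider "y = t" | "t < y" | "y < t" by linarith
        then show "norm (integral {a..y} f - integral {a..t} f - (y - t) *\<^sub>R f t) \<le> e * norm (y - t)"
        proof cases
          case 2
          have "integral {a..t} f + integral {t..y} f = integral {a..y} f"
            by (rule Henstock_Kurzweil_Integration.integral_combine) (use 2 tab y fi in auto)
          then have eq: "integral {a..y} f - integral {a..t} f = integral {t..y} f"
            by (simp add: algebra_simps)
          have "norm (integral {t..t+(y-t)} g /\<^sub>R (y-t) - g t) < e"
            by (rule d1(2)) (use 2 y in auto)
          then have "norm (integral {t..y} f /\<^sub>R (y-t) - f t) < e"
            using ga[of t y] tab y by (simp add: g_def)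
          then show ?thesis unfolding eq using *[where v="integral {t..y} f"] 2 by simp
        next
          case 3
          have "integral {a..y} f + integral {y..t} f = integral {a..t} f"
            by (rule Henstock_Kurzweil_Integration.integral_combine) (use 3 tab y fi in auto)
          then have eq: "integral {a..t} f - integral {a..y} f = integral {y..t} f"
            by (simp add: algebra_simps)
          have "norm (integral {-t..-t+(t-y)} (\<lambda>t. g (- t)) /\<^sub>R (t-y) - g t) < e"
            by (rule d2(2)) (use 3 y in auto)
          then have "norm (integral {y..t} f /\<^sub>R (t-y) - f t) < e"
            using ga[of y t] tab y Henstock_Kurzweil_Integration.integral_reflect_real[where f=g and a=y and b=t] by (simp add: g_def)
          then have "norm (integral {a..t} f - integral {a..y} f - (t - y) *\<^sub>R f t) \<le> e * (t - y)"
            unfolding eq using *[where v="integral {y..t} f"] 3 by simp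
          moreover have "integral {a..y} f - integral {a..t} f - (y - t) *\<^sub>R f t
              = - (integral {a..t} f - integral {a..y} f - (t - y) *\<^sub>R f t)"
            by (simp add: algebra_simps)
          ultimately have "norm (integral {a..y} f - integral {a..t} f - (y - t) *\<^sub>R f t) \<le> e * (t - y)"
            by (simp only: norm_minus_cancel)
          then show ?thesis using 3 by simp
        qed simp
      qed (use d1 d2 in auto)
    qed
  qed
qed

text \<open>
  The difference quotients of a Lipschitz function are bounded by the Lipschitz constant, so their
  integrals converge to the integral of the derivative. The same integrals are differences of averages
  of the function near the end points, which converge to its values there.
\<close>

lemma lipschitz_has_integral_derivative:
  fixes F :: "real \<Rightarrow> 'b::euclidean_space"
  assumes ab: "a \<le> b" and lip: "L-lipschitz_on {a..b} F" and N: "negligible N"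
    and der: "\<And>t. t \<in> {a..b} - N \<Longrightarrow> (F has_vector_derivative f t) (at t within {a..b})"
  shows "(f has_integral F b - F a) {a..b}"
proof (cases "a = b")
  case True
  then show ?thesis using has_integral_refl(2)[of f a] by simp
next
  case False
  with ab have ab: "a < b" by simp
  \<comment> \<open>The constant extension of \<open>F\<close> has difference quotients at all points of \<open>{a..b}\<close>.\<close>
  define E where "E t = F (max a (min t b))" for t
  have L: "0 \<le> L" using lip lipschitz_on_nonneg by blast
  have E_lip: "norm (E t - E s) \<le> L * \<bar>t - s\<bar>" for t s
  proof -
    have "dist (E t) (E s) \<le> L * dist (max a (min t b)) (max a (min s b))"
      unfolding E_def by (rule lipschitz_onD[OF lip]) (use ab in auto)
    also have "\<dots> \<le> L * \<bar>t - s\<bar>" by (rule mult_left_mono[OF _ L]) (auto simp: dist_real_def)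
    finally show ?thesis by (simp add: dist_norm)
  qed
  have E_cont: "continuous_on S E" for S
  proof (rule lipschitz_on_continuous_on[of L])
    show "L-lipschitz_on S E" by (rule lipschitz_onI) (use E_lip L in \<open>auto simp: dist_norm\<close>)
  qed
  have Ei: "E integrable_on {c..d}" for c d by (rule integrable_continuous_real[OF E_cont])
  have Ea: "E a = F a" and Eb: "E b = F b" using ab by (auto simp: E_def)
  define \<Phi> where "\<Phi> t = integral {a..t} E" for t
  define h where "h n = inverse (real (Suc n))" for n
  have h: "0 < h n" "h n \<le> 1" for n by (auto simp: h_def field_simps)
  have h0: "h \<longlonglongrightarrow> 0" unfolding h_def by (rule LIMSEQ_inverse_real_of_nat)
  have norm_h: "norm (u /\<^sub>R h n) \<le> e" if "norm u \<le> e * h n" for u :: 'b and e n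
    using that h(1)[of n] by (simp add: field_simps)
  define q where "q n t = (E (t + h n) - E t) /\<^sub>R h n" for n t
  have q_int: "integral {a..b} (q n) = (\<Phi> (b + h n) - \<Phi> b) /\<^sub>R h n - (\<Phi> (a + h n) - \<Phi> a) /\<^sub>R h n" for n
  proof -
    have 1: "integral {a..b} (\<lambda>t. E (t + h n)) = integral {a + h n..b + h n} E"
      using integral_shift[of a "h n" b E] by (simp add: E_cont o_def)
    have 2: "integral {a..a + h n} E + integral {a + h n..b + h n} E = integral {a..b + h n} E"
      by (rule Henstock_Kurzweil_Integration.integral_combine) (use h[of n] ab Ei in auto)
    have 3: "\<Phi> a = 0" by (simp add: \<Phi>_def)
    have "integral {a..b} (q n) = (integral {a..b} (\<lambda>t. E (t + h n)) - integral {a..b} E) /\<^sub>R h n"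
      unfolding q_def
      by (subst integral_cmul, subst Henstock_Kurzweil_Integration.integral_diff)
         (auto intro!: integrable_continuous_real continuous_on_compose2[OF E_cont[of UNIV]] continuous_intros E_cont)
    also have "\<dots> = (\<Phi> (b + h n) - \<Phi> (a + h n) - \<Phi> b) /\<^sub>R h n"
      using 1 2[symmetric] by (simp add: \<Phi>_def)
    finally show ?thesis using 3 by (simp add: algebra_simps)
  qed
  have quot: "(\<lambda>n. (\<Phi> (c + h n) - \<Phi> c) /\<^sub>R h n) \<longlonglongrightarrow> v"
    if \<Phi>: "(\<Phi> has_vector_derivative v) (at c within S)" and S: "\<And>n. c + h n \<in> S" for \<Phi> :: "real \<Rightarrow> 'b" and c S v
    unfolding LIMSEQ_iff
  proof (intro allI impI)
    fix e :: real assume e: "0 < e"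
    obtain d where d: "0 < d" and D: "\<And>y. y \<in> S \<Longrightarrow> norm (y - c) < d \<Longrightarrow>
        norm (\<Phi> y - \<Phi> c - (y - c) *\<^sub>R v) \<le> (e/2) * norm (y - c)"
      using \<Phi> e unfolding has_vector_derivative_def has_derivative_within_alt by (meson half_gt_zero)
    obtain n0 where n0: "\<And>n. n \<ge> n0 \<Longrightarrow> h n < d"
      using order_tendstoD(2)[OF h0 d] unfolding eventually_sequentially by blast
    have "norm ((\<Phi> (c + h n) - \<Phi> c) /\<^sub>R h n - v) < e" if "n \<ge> n0" for n
    proof -
      have "(\<Phi> (c + h n) - \<Phi> c) /\<^sub>R h n - v = (\<Phi> (c + h n) - \<Phi> c - h n *\<^sub>R v) /\<^sub>R h n"
        using h(1)[of n] by (simp add: algebra_simps)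
      also have "norm \<dots> \<le> e/2"
        using D[OF S, of n] n0[OF that] h(1)[of n] by (intro norm_h) simp
      finally show ?thesis using e by simp
    qed
    then show "\<exists>n0. \<forall>n\<ge>n0. norm ((\<Phi> (c + h n) - \<Phi> c) /\<^sub>R h n - v) < e" by blast
  qed
  have \<Phi>': "(\<Phi> has_vector_derivative E c) (at c within {a..b+1})" if "a \<le> c" "c \<le> b" for c
    unfolding \<Phi>_def by (rule integral_has_vector_derivative[OF E_cont]) (use that in auto)
  have lim: "(\<lambda>n. integral {a..b} (q n)) \<longlonglongrightarrow> F b - F a"
    unfolding q_int Ea[symmetric] Eb[symmetric]
    by (intro tendsto_diff quot[of \<Phi> _ _ "{a..b+1}"] \<Phi>') (use h ab in \<open>auto intro: add_mono add_increasing2 order_trans[OF less_imp_le] less_imp_le\<close>)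
  \<comment> \<open>At the right end point the one-sided quotients of the extension need not converge to \<open>f b\<close>.\<close>
  define N' where "N' = N \<union> {b}"
  define g where "g t = (if t \<in> N' then 0 else f t)" for t
  define q' where "q' n t = (if t \<in> N' then 0 else q n t)" for n t
  have N': "negligible N'" using N by (simp add: N'_def)
  have q'int: "q' n integrable_on {a..b}" and q'eq: "integral {a..b} (q' n) = integral {a..b} (q n)" for n
  proof -
    have "q n integrable_on {a..b}"
      unfolding q_def by (intro integrable_continuous_real continuous_intros continuous_on_compose2[OF E_cont[of UNIV]]) auto
    then show "q' n integrable_on {a..b}"
      by (rule integrable_spike[OF _ N']) (auto simp: q'_def)
    show "integral {a..b} (q' n) = integral {a..b} (q n)"
      by (rule integral_spike[OF N']) (auto simp: q'_def)
  qed
  have dom: "norm (q' n t) \<le> L" for n t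
  proof -
    have "norm (E (t + h n) - E t) \<le> L * h n" using E_lip[of "t + h n" t] h(1)[of n] by simp
    then have "norm (q n t) \<le> L" unfolding q_def by (rule norm_h)
    then show ?thesis using L by (simp add: q'_def)
  qed
  have conv: "(\<lambda>n. q' n t) \<longlonglongrightarrow> g t" if t: "t \<in> {a..b}" for t
  proof (cases "t \<in> N'")
    case False
    then have tb: "t < b" and at: "a \<le> t" and tN: "t \<notin> N" using t by (auto simp: N'_def)
    have "(F has_vector_derivative f t) (at t within {a..b})" using der tN t by blast
    then have "(E has_vector_derivative f t) (at t within {a..b})"
      by (rule has_vector_derivative_transform[OF t, rotated]) (auto simp: E_def)
    then have "(E has_vector_derivative f t) (at t within {t..b})"
      by (rule has_vector_derivative_within_subset) (use at in auto)
    moreover have "at t within {t..b} = at t within {t..}"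
      by (rule at_within_nhd[of _ "{..<b}"]) (use tb in auto)
    ultimately have "(E has_vector_derivative f t) (at t within {t..})" by simp
    then have "(\<lambda>n. (E (t + h n) - E t) /\<^sub>R h n) \<longlonglongrightarrow> f t"
      by (rule quot) (use h in \<open>auto simp: less_imp_le\<close>)
    then show ?thesis using False by (simp add: q'_def g_def q_def)
  qed (simp add: q'_def g_def)
  have gi: "g integrable_on {a..b}" and "(\<lambda>n. integral {a..b} (q' n)) \<longlonglongrightarrow> integral {a..b} g"
    by (rule dominated_convergence[of q' _ "\<lambda>_. L"]; use q'int dom conv in auto)+
  then have "integral {a..b} g = F b - F a"
    using lim LIMSEQ_unique by (auto simp: q'eq)
  then have "(g has_integral F b - F a) {a..b}" using gi by (metis integrable_integral)
  then show ?thesis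
    by (rule has_integral_spike[OF N', rotated]) (auto simp: g_def)
qed

section \<open>Games with finitely many moves\<close>

definition ae_eq :: "real \<Rightarrow> real \<Rightarrow> (real \<Rightarrow> 'a) \<Rightarrow> (real \<Rightarrow> 'a) \<Rightarrow> bool" where
  "ae_eq a b q q' \<longleftrightarrow> (AE \<tau> in lebesgue_on {a..b}. q \<tau> = q' \<tau>)"

definition switch :: "real \<Rightarrow> (real \<Rightarrow> 'a) \<Rightarrow> (real \<Rightarrow> 'a) \<Rightarrow> real \<Rightarrow> 'a" where
  "switch \<tau> p p' = (\<lambda>t. if t < \<tau> then p t else p' t)"

definition grid :: "real \<Rightarrow> real \<Rightarrow> nat \<Rightarrow> nat \<Rightarrow> real" where
  "grid ts \<theta> N j = ts + real j * ((\<theta> - ts) / real N)"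

lemma AE_lebesgue_on_interval_iff:
  "(AE t in lebesgue_on {a..b}. P t) \<longleftrightarrow> (\<exists>N. negligible N \<and> (\<forall>t\<in>{a..b::real} - N. P t))"
proof -
  have "(AE t in lebesgue_on {a..b}. P t) \<longleftrightarrow> (AE t in lebesgue. t \<in> {a..b} \<longrightarrow> P t)"
    by (rule AE_restrict_space_iff) auto
  also have "\<dots> \<longleftrightarrow> (\<exists>N. negligible N \<and> (\<forall>t\<in>{a..b} - N. P t))"
    unfolding eventually_ae_filter_negligible by blast
  finally show ?thesis .
qed

lemma ae_eq_refl [simp]: "ae_eq a b q q"
  by (simp add: ae_eq_def)

lemma ae_eq_sym: "ae_eq a b q q' \<Longrightarrow> ae_eq a b q' q"
  by (simp add: ae_eq_def eq_commute)

lemma ae_eq_subinterval: "ae_eq a b q q' \<Longrightarrow> b' \<le> b \<Longrightarrow> ae_eq a b' q q'"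
  unfolding ae_eq_def AE_lebesgue_on_interval_iff by fastforce

lemma ae_eqI: "(\<And>t. a \<le> t \<Longrightarrow> t < b \<Longrightarrow> q t = q' t) \<Longrightarrow> ae_eq a b q q'"
  unfolding ae_eq_def AE_lebesgue_on_interval_iff
  by (rule exI[of _ "{b}"]) auto

lemma ae_eq_degenerate: "ae_eq a a q q'"
  by (rule ae_eqI) simp

lemma ae_eq_switch:
  assumes "ae_eq a \<tau> p r"
  shows "ae_eq a b (switch \<tau> p p') (switch \<tau> r p')"
  using assms unfolding ae_eq_def AE_lebesgue_on_interval_iff switch_def by fastforce

lemma switch_same [simp]: "switch \<tau> p p = p"
  by (simp add: switch_def fun_eq_iff)

lemma switch_controls:
  assumes "p \<in> controls ts \<theta> W" "p' \<in> controls ts \<theta> W"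
  shows "switch \<tau> p p' \<in> controls ts \<theta> W"
proof -
  have "switch \<tau> p p' \<in> borel_measurable (lebesgue_on {ts..<\<theta>})"
    unfolding switch_def
  proof (rule measurable_If)
    have "{t. t < \<tau>} \<inter> space (lebesgue_on {ts..<\<theta>}) = {..<\<tau>} \<inter> {ts..<\<theta>}" by auto
    also have "\<dots> \<in> sets (lebesgue_on {ts..<\<theta>})" by (auto simp: sets_restrict_space_iff)
    finally show "{t \<in> space (lebesgue_on {ts..<\<theta>}). t < \<tau>} \<in> sets (lebesgue_on {ts..<\<theta>})"
      by (simp add: Int_def conj_commute)
  qed (use assms in \<open>auto simp: controls_def\<close>)
  then show ?thesis using assms by (auto simp: controls_def switch_def)
qed

lemma const_controls: "u \<in> W \<Longrightarrow> (\<lambda>_. u) \<in> controls ts \<theta> W"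
  by (simp add: controls_def)

lemma grid_0 [simp]: "grid ts \<theta> N 0 = ts"
  by (simp add: grid_def)

lemma grid_last [simp]: "N > 0 \<Longrightarrow> grid ts \<theta> N N = \<theta>"
  by (simp add: grid_def)

lemma grid_mono: "ts \<le> \<theta> \<Longrightarrow> i \<le> j \<Longrightarrow> grid ts \<theta> N i \<le> grid ts \<theta> N j"
  unfolding grid_def by (intro add_left_mono mult_right_mono) auto

lemma grid_step: "grid ts \<theta> N (Suc j) - grid ts \<theta> N j = (\<theta> - ts) / real N"
  by (simp add: grid_def algebra_simps add_divide_distrib diff_divide_distrib)

lemma grid_find:
  assumes "N > 0" "ts \<le> t" "t \<le> \<theta>"
  obtains j where "j < N" "grid ts \<theta> N j \<le> t" "t \<le> grid ts \<theta> N (Suc j)"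
proof -
  have "\<exists>j<n. grid ts \<theta> N j \<le> t \<and> t \<le> grid ts \<theta> N (Suc j)" if "n > 0" "t \<le> grid ts \<theta> N n" for n
    using that
  proof (induction n)
    case (Suc n)
    show ?case
    proof (cases "n > 0 \<and> t \<le> grid ts \<theta> N n")
      case True
      then show ?thesis using Suc.IH less_SucI by blast
    next
      case False
      then have "grid ts \<theta> N n \<le> t" using assms(2) by (cases "n = 0") auto
      then show ?thesis using Suc.prems by blast
    qed
  qed simp
  from this[of N] show thesis using assms that by auto
qed

lemma grid_find_strict:
  assumes "N > 0" "ts \<le> t" "t < \<theta>"
  obtains j where "j < N" "grid ts \<theta> N j \<le> t" "t < grid ts \<theta> N (Suc j)"
proof -
  have "\<exists>j<n. grid ts \<theta> N j \<le> t \<and> t < grid ts \<theta> N (Suc j)" if "n > 0" "t < grid ts \<theta> N n" for n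
    using that
  proof (induction n)
    case (Suc n)
    show ?case
    proof (cases "n > 0 \<and> t < grid ts \<theta> N n")
      case True
      then show ?thesis using Suc.IH less_SucI by blast
    next
      case False
      then have "grid ts \<theta> N n \<le> t" using assms(2) by (cases "n = 0") auto
      then show ?thesis using Suc.prems by blast
    qed
  qed simp
  from this[of N] show thesis using assms that by auto
qed

text \<open>
  On the \<open>j\<close>-th step of the grid, the response uses the control of the opponent only up to the
  beginning of this step. In particular the response on the first step is fixed in advance, as any
  two controls agree almost everywhere on the degenerate interval.
\<close>

definition delayed :: "real \<Rightarrow> real \<Rightarrow> nat \<Rightarrow> (real ^ 'k) set \<Rightarrow> (real ^ 'm) set
      \<Rightarrow> ((real \<Rightarrow> real ^ 'k) \<Rightarrow> (real \<Rightarrow> real ^ 'm)) \<Rightarrow> bool" where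
  "delayed ts \<theta> N W W' a \<longleftrightarrow> (\<forall>q\<in>controls ts \<theta> W. a q \<in> controls ts \<theta> W') \<and>
     (\<forall>j<N. \<forall>q\<in>controls ts \<theta> W. \<forall>q'\<in>controls ts \<theta> W.
        ae_eq ts (grid ts \<theta> N j) q q' \<longrightarrow> ae_eq ts (grid ts \<theta> N (Suc j)) (a q) (a q'))"

lemma delayed_nonanticipative:
  assumes N: "N > 0" and d: "delayed ts \<theta> N W W' a"
  shows "a \<in> nonanticipative_strategies ts \<theta> W W'"
proof -
  have "ae_eq ts t' (a q) (a q')"
    if t': "t' \<in> {ts..\<theta>}" and q: "q \<in> controls ts \<theta> W" "q' \<in> controls ts \<theta> W" and eq: "ae_eq ts t' q q'" for t' q q'
  proof -
    obtain j where j: "j < N" "grid ts \<theta> N j \<le> t'" "t' \<le> grid ts \<theta> N (Suc j)"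
      using grid_find[OF N, of ts t' \<theta>] t' by auto
    have "ae_eq ts (grid ts \<theta> N (Suc j)) (a q) (a q')"
      using d j(1) q ae_eq_subinterval[OF eq j(2)] unfolding delayed_def by blast
    then show ?thesis using ae_eq_subinterval j(3) by blast
  qed
  then show ?thesis
    using d unfolding nonanticipative_strategies_def delayed_def ae_eq_def by blast
qed

text \<open>
  Because of the delay, the pair can be found step by step: if \<open>p\<close> agrees with the response to \<open>b p\<close>
  up to one grid point, then this response, taken in place of \<open>p\<close>, agrees with the response to itself
  up to the next grid point.
\<close>

lemma delayed_fixed_point:
  assumes N: "N > 0" and a: "delayed ts \<theta> N V U a"
    and b: "b \<in> nonanticipative_strategies ts \<theta> U V" and ts: "ts \<le> \<theta>" and u: "u \<in> U"
  obtains p where "p \<in> controls ts \<theta> U" "ae_eq ts \<theta> (a (b p)) p"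
proof -
  have aC: "a q \<in> controls ts \<theta> U" if "q \<in> controls ts \<theta> V" for q
    using a that by (auto simp: delayed_def)
  have bC: "b p \<in> controls ts \<theta> V" if "p \<in> controls ts \<theta> U" for p
    using b that by (auto simp: nonanticipative_strategies_def)
  have bNA: "ae_eq ts t (b p) (b p')" if "t \<in> {ts..\<theta>}" "p \<in> controls ts \<theta> U" "p' \<in> controls ts \<theta> U" "ae_eq ts t p p'" for t p p'
    using b that unfolding nonanticipative_strategies_def ae_eq_def by blast
  have "\<exists>p\<in>controls ts \<theta> U. ae_eq ts (grid ts \<theta> N j) (a (b p)) p" if "j \<le> N" for j
    using that
  proof (induction j)
    case 0
    show ?case using const_controls[OF u] by (auto intro: ae_eq_degenerate)
  next
    case (Suc j)
    then obtain p where p: "p \<in> controls ts \<theta> U" "ae_eq ts (grid ts \<theta> N j) (a (b p)) p" by auto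
    have p': "a (b p) \<in> controls ts \<theta> U" using aC bC p by blast
    have gj: "grid ts \<theta> N j \<in> {ts..\<theta>}"
      using grid_mono[OF ts, of 0 j N] grid_mono[OF ts, of j N N] Suc.prems N by simp
    have "ae_eq ts (grid ts \<theta> N j) (b (a (b p))) (b p)" by (rule bNA[OF gj p' p(1) p(2)])
    then have "ae_eq ts (grid ts \<theta> N (Suc j)) (a (b (a (b p)))) (a (b p))"
      using a Suc.prems bC p p' unfolding delayed_def by (meson Suc_le_lessD)
    then show ?case using p' by blast
  qed
  from this[of N] show thesis using that N by auto
qed

text \<open>
  Consider the game in which, on each step of the grid, the second player moves first and wants to
  have \<open>C \<le> J2\<close> in the end. It is determined. If the second player wins, a winning strategy is the
  first alternative. Otherwise the first player can keep every position of this game lost for the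
  second one, and plays the first game together with an imagined copy of the second game: the controls
  \<open>p1\<close> and \<open>q2\<close> are constant on each step, as prescribed by \<open>aim\<close>, while \<open>p2\<close> is the response to \<open>q2\<close>
  that prevents \<open>C \<le> J2\<close>. As the aiming makes \<open>J1 \<le> J2 + \<epsilon>\<close>, the first player has obtained
  \<open>J1 \<le> C + \<epsilon>\<close>.
\<close>

theorem finite_game_alternative:
  fixes U :: "(real ^ 'k) set" and V :: "(real ^ 'm) set"
    and J1 J2 :: "(real \<Rightarrow> real ^ 'k) \<Rightarrow> (real \<Rightarrow> real ^ 'm) \<Rightarrow> real"
    and aim :: "nat \<Rightarrow> (real \<Rightarrow> real ^ 'k) \<Rightarrow> (real \<Rightarrow> real ^ 'm) \<Rightarrow> (real \<Rightarrow> real ^ 'k) \<Rightarrow> (real \<Rightarrow> real ^ 'm)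
      \<Rightarrow> (real ^ 'k) \<times> (real ^ 'm)"
    and C \<epsilon> ts \<theta> :: real and N :: nat
  defines "P \<equiv> controls ts \<theta> U" and "Q \<equiv> controls ts \<theta> V"
  assumes N: "N > 0" and ts: "ts \<le> \<theta>" and U: "U \<noteq> {}" and V: "V \<noteq> {}"
    and J2_ae: "\<And>p p' q q'. p \<in> P \<Longrightarrow> p' \<in> P \<Longrightarrow> q \<in> Q \<Longrightarrow> q' \<in> Q \<Longrightarrow>
      ae_eq ts \<theta> p p' \<Longrightarrow> ae_eq ts \<theta> q q' \<Longrightarrow> J2 p q = J2 p' q'"
    and aim_in: "\<And>j p1 q1 p2 q2. j < N \<Longrightarrow> p1 \<in> P \<Longrightarrow> q1 \<in> Q \<Longrightarrow> p2 \<in> P \<Longrightarrow> q2 \<in> Q \<Longrightarrow>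
      aim j p1 q1 p2 q2 \<in> U \<times> V"
    and aim_causal: "\<And>j p1 q1 p2 q2 p1' q1' p2' q2'. j < N \<Longrightarrow>
      p1 \<in> P \<Longrightarrow> q1 \<in> Q \<Longrightarrow> p2 \<in> P \<Longrightarrow> q2 \<in> Q \<Longrightarrow> p1' \<in> P \<Longrightarrow> q1' \<in> Q \<Longrightarrow> p2' \<in> P \<Longrightarrow> q2' \<in> Q \<Longrightarrow>
      ae_eq ts (grid ts \<theta> N j) p1 p1' \<Longrightarrow> ae_eq ts (grid ts \<theta> N j) q1 q1' \<Longrightarrow>
      ae_eq ts (grid ts \<theta> N j) p2 p2' \<Longrightarrow> ae_eq ts (grid ts \<theta> N j) q2 q2' \<Longrightarrow>
      aim j p1 q1 p2 q2 = aim j p1' q1' p2' q2'"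
    and aim_good: "\<And>p1 q1 p2 q2. p1 \<in> P \<Longrightarrow> q1 \<in> Q \<Longrightarrow> p2 \<in> P \<Longrightarrow> q2 \<in> Q \<Longrightarrow>
      (\<And>j t. j < N \<Longrightarrow> grid ts \<theta> N j \<le> t \<Longrightarrow> t < grid ts \<theta> N (Suc j) \<Longrightarrow>
         p1 t = fst (aim j p1 q1 p2 q2) \<and> q2 t = snd (aim j p1 q1 p2 q2)) \<Longrightarrow>
      J1 p1 q1 \<le> J2 p2 q2 + \<epsilon>"
  obtains b where "delayed ts \<theta> N U V b" "\<And>p. p \<in> P \<Longrightarrow> C \<le> J2 p (b p)"
    | a where "delayed ts \<theta> N V U a" "\<And>q. q \<in> Q \<Longrightarrow> J1 (a q) q \<le> C + \<epsilon>"
proof -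
  define \<tau> where "\<tau> = grid ts \<theta> N"
  have \<tau>N: "\<tau> N = \<theta>" and \<tau>0: "\<tau> 0 = ts" using N by (auto simp: \<tau>_def)
  have \<tau>mono: "i \<le> j \<Longrightarrow> \<tau> i \<le> \<tau> j" for i j using grid_mono[OF ts] by (auto simp: \<tau>_def)
  obtain u0 v0 where u0: "u0 \<in> U" and v0: "v0 \<in> V" using U V by auto
  define p0 where "p0 = (\<lambda>_::real. u0)"
  define q0 where "q0 = (\<lambda>_::real. v0)"
  have p0: "p0 \<in> P" and q0: "q0 \<in> Q" using const_controls u0 v0 by (auto simp: P_def Q_def p0_def q0_def)
  have swP: "switch t p p' \<in> P" if "p \<in> P" "p' \<in> P" for t p p'
    using that switch_controls by (auto simp: P_def)
  have swQ: "switch t p p' \<in> Q" if "p \<in> Q" "p' \<in> Q" for t p p'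
    using that switch_controls by (auto simp: Q_def)
  \<comment> \<open>\<open>Win m p q\<close>: with \<open>m\<close> moves to go, and with \<open>p\<close> and \<open>q\<close> played until the grid point \<open>\<tau> (N - m)\<close>,
    the second player can enforce \<open>C \<le> J2\<close>. Later values of \<open>p\<close> and \<open>q\<close> do not matter (\<open>Win_ae\<close>).\<close>
  define Win where "Win = rec_nat (\<lambda>p q. C \<le> J2 p q)
    (\<lambda>m W p q. \<exists>q'\<in>Q. \<forall>p'\<in>P. W (switch (\<tau> (N - Suc m)) p p') (switch (\<tau> (N - Suc m)) q q'))"
  have Win_0: "Win 0 p q \<longleftrightarrow> C \<le> J2 p q" for p q by (simp add: Win_def)
  have Win_Suc: "Win (Suc m) p q \<longleftrightarrow>
      (\<exists>q'\<in>Q. \<forall>p'\<in>P. Win m (switch (\<tau> (N - Suc m)) p p') (switch (\<tau> (N - Suc m)) q q'))" for m p q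
    by (simp add: Win_def)
  have Win_step: "Win (N - j) p q \<longleftrightarrow>
      (\<exists>q'\<in>Q. \<forall>p'\<in>P. Win (N - Suc j) (switch (\<tau> j) p p') (switch (\<tau> j) q q'))" if "j < N" for j p q
  proof -
    have "N - j = Suc (N - Suc j)" "N - Suc (N - Suc j) = j" using that by auto
    then show ?thesis using Win_Suc[of "N - Suc j" p q] by simp
  qed
  have Win_ae: "Win m p q = Win m p' q'"
    if "m \<le> N" "p \<in> P" "p' \<in> P" "q \<in> Q" "q' \<in> Q" "ae_eq ts (\<tau> (N - m)) p p'" "ae_eq ts (\<tau> (N - m)) q q'" for m p p' q q'
    using that
  proof (induction m arbitrary: p p' q q')
    case 0
    then show ?case using J2_ae[of p p' q q'] by (simp add: Win_0 \<tau>N)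
  next
    case (Suc m)
    have "Win m (switch (\<tau> (N - Suc m)) p r) (switch (\<tau> (N - Suc m)) q s)
        = Win m (switch (\<tau> (N - Suc m)) p' r) (switch (\<tau> (N - Suc m)) q' s)" if "r \<in> P" "s \<in> Q" for r s
      by (rule Suc.IH) (use Suc.prems that in \<open>auto intro: swP swQ ae_eq_switch\<close>)
    then show ?case unfolding Win_Suc by blast
  qed
  show thesis
  proof (cases "Win N p0 q0")
    case True
    \<comment> \<open>\<open>R p j\<close> is the control of the second player after \<open>j\<close> moves in response to \<open>p\<close>; a move made at \<open>\<tau> j\<close>
      consists of a control for all later times, of which only the part before \<open>\<tau> (Suc j)\<close> is kept.\<close>
    define pick where "pick j p q = (SOME q'. q' \<in> Q \<and> (\<forall>p'\<in>P. Win (N - Suc j) (switch (\<tau> j) p p') (switch (\<tau> j) q q')))" for j p q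
    define R where "R p = rec_nat q0 (\<lambda>j q. switch (\<tau> j) q (pick j p q))" for p
    have R0: "R p 0 = q0" and RS: "R p (Suc j) = switch (\<tau> j) (R p j) (pick j p (R p j))" for p j
      by (auto simp: R_def)
    have inv: "R p j \<in> Q \<and> Win (N - j) p (R p j)" if p: "p \<in> P" and "j \<le> N" for p j
      using that(2)
    proof (induction j)
      case 0
      have "Win N p q0 = Win N p0 q0"
        by (rule Win_ae) (use p p0 q0 in \<open>auto simp: \<tau>0 intro: ae_eq_degenerate\<close>)
      then show ?case using True q0 by (simp add: R0)
    next
      case (Suc j)
      then have IH: "R p j \<in> Q" "Win (N - j) p (R p j)" and j: "j < N" by auto
      have "\<exists>q'. q' \<in> Q \<and> (\<forall>p'\<in>P. Win (N - Suc j) (switch (\<tau> j) p p') (switch (\<tau> j) (R p j) q'))"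
        using IH(2) Win_step[OF j] by blast
      from someI_ex[OF this] have "pick j p (R p j) \<in> Q"
        "\<forall>p'\<in>P. Win (N - Suc j) (switch (\<tau> j) p p') (switch (\<tau> j) (R p j) (pick j p (R p j)))"
        by (auto simp: pick_def)
      then show ?case using p IH(1) swQ by (metis RS switch_same)
    qed
    have R_keep: "R p (j + k) t = R p j t" if "t < \<tau> j" for p j k t
    proof (induction k)
      case (Suc k)
      have "t < \<tau> (j + k)" using that \<tau>mono[of j "j+k"] by simp
      then show ?case using Suc by (simp add: RS switch_def)
    qed simp
    have R_causal: "R p i = R p' i" if p: "p \<in> P" "p' \<in> P" and j: "j < N" and eq: "ae_eq ts (\<tau> j) p p'" and i: "i \<le> Suc j" for p p' i j
      using i
    proof (induction i)
      case (Suc i)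
      then have IH: "R p i = R p' i" and ij: "i \<le> j" by auto
      have RQ: "R p' i \<in> Q" using inv[OF p(2), of i] ij j by auto
      have "Win (N - Suc i) (switch (\<tau> i) p r) (switch (\<tau> i) (R p' i) s)
        = Win (N - Suc i) (switch (\<tau> i) p' r) (switch (\<tau> i) (R p' i) s)" if "r \<in> P" "s \<in> Q" for r s
        by (rule Win_ae) (use that p RQ \<tau>mono[OF ij] eq in \<open>auto intro: swP swQ ae_eq_switch ae_eq_subinterval\<close>)
      then have "(\<lambda>q'. q' \<in> Q \<and> (\<forall>r\<in>P. Win (N - Suc i) (switch (\<tau> i) p r) (switch (\<tau> i) (R p' i) q')))
        = (\<lambda>q'. q' \<in> Q \<and> (\<forall>r\<in>P. Win (N - Suc i) (switch (\<tau> i) p' r) (switch (\<tau> i) (R p' i) q')))"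
        by blast
      then show ?case by (simp add: RS IH pick_def)
    qed (simp add: R0)
    show thesis
    proof (rule that(1)[of "\<lambda>p. R p N"])
      show "delayed ts \<theta> N U V (\<lambda>p. R p N)"
        unfolding delayed_def
      proof (intro conjI ballI allI impI)
        fix p assume "p \<in> controls ts \<theta> U"
        then show "R p N \<in> controls ts \<theta> V" using inv[of p N] by (simp add: P_def Q_def)
      next
        fix j p p' assume j: "j < N" and p: "p \<in> controls ts \<theta> U" "p' \<in> controls ts \<theta> U"
          and eq: "ae_eq ts (grid ts \<theta> N j) p p'"
        have eq': "R p (Suc j) = R p' (Suc j)"
          by (rule R_causal[of _ _ j]) (use p j eq in \<open>auto simp: P_def \<tau>_def\<close>)
        have "R p N t = R p' N t" if "t < \<tau> (Suc j)" for t
          using R_keep[OF that, of p "N - Suc j"] R_keep[OF that, of p' "N - Suc j"] eq' j by simp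
        then show "ae_eq ts (grid ts \<theta> N (Suc j)) (R p N) (R p' N)"
          by (intro ae_eqI) (auto simp: \<tau>_def)
      qed
      show "C \<le> J2 p (R p N)" if "p \<in> P" for p
        using inv[OF that, of N] by (simp add: Win_0)
    qed
  next
    case False
    define resp where "resp j p q q' = (SOME p'. p' \<in> P \<and> \<not> Win (N - Suc j) (switch (\<tau> j) p p') (switch (\<tau> j) q q'))" for j p q q'
    \<comment> \<open>The state of the simultaneous play against \<open>q1\<close>: the control \<open>p1\<close> of the actual game and the
      controls \<open>p2\<close>, \<open>q2\<close> of the imagined one.\<close>
    define nxt where "nxt q1 j = (\<lambda>(p1, p2, q2). case aim j p1 q1 p2 q2 of (u, v) \<Rightarrow>
       (switch (\<tau> j) p1 (\<lambda>_. u), switch (\<tau> j) p2 (resp j p2 q2 (\<lambda>_. v)), switch (\<tau> j) q2 (\<lambda>_. v)))" for q1 j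
    define S where "S q1 = rec_nat (p0, p0, q0) (\<lambda>j s. nxt q1 j s)" for q1
    define p1 where "p1 q1 j = fst (S q1 j)" for q1 j
    define p2 where "p2 q1 j = fst (snd (S q1 j))" for q1 j
    define q2 where "q2 q1 j = snd (snd (S q1 j))" for q1 j
    define A where "A q1 j = aim j (p1 q1 j) q1 (p2 q1 j) (q2 q1 j)" for q1 j
    have S0: "p1 q1 0 = p0" "p2 q1 0 = p0" "q2 q1 0 = q0" for q1
      by (auto simp: p1_def p2_def q2_def S_def)
    have SS: "p1 q1 (Suc j) = switch (\<tau> j) (p1 q1 j) (\<lambda>_. fst (A q1 j))"
      "p2 q1 (Suc j) = switch (\<tau> j) (p2 q1 j) (resp j (p2 q1 j) (q2 q1 j) (\<lambda>_. snd (A q1 j)))"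
      "q2 q1 (Suc j) = switch (\<tau> j) (q2 q1 j) (\<lambda>_. snd (A q1 j))" for q1 j
      by (auto simp: p1_def p2_def q2_def S_def nxt_def A_def split: prod.splits)
    have inv: "p1 q1 j \<in> P \<and> p2 q1 j \<in> P \<and> q2 q1 j \<in> Q \<and> \<not> Win (N - j) (p2 q1 j) (q2 q1 j)"
      if q1: "q1 \<in> Q" and "j \<le> N" for q1 j
      using that(2)
    proof (induction j)
      case 0
      then show ?case using False p0 q0 by (simp add: S0)
    next
      case (Suc j)
      then have IH: "p1 q1 j \<in> P" "p2 q1 j \<in> P" "q2 q1 j \<in> Q" "\<not> Win (N - j) (p2 q1 j) (q2 q1 j)" and j: "j < N"
        by auto
      have A: "A q1 j \<in> U \<times> V" unfolding A_def by (rule aim_in[OF j IH(1) q1 IH(2,3)])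
      have cu: "(\<lambda>_. fst (A q1 j)) \<in> P" and cv: "(\<lambda>_. snd (A q1 j)) \<in> Q"
        using A const_controls by (auto simp: P_def Q_def mem_Times_iff)
      have "\<exists>p'. p' \<in> P \<and> \<not> Win (N - Suc j) (switch (\<tau> j) (p2 q1 j) p') (switch (\<tau> j) (q2 q1 j) (\<lambda>_. snd (A q1 j)))"
        using IH(4) Win_step[OF j] cv by blast
      from someI_ex[OF this] have r: "resp j (p2 q1 j) (q2 q1 j) (\<lambda>_. snd (A q1 j)) \<in> P"
        "\<not> Win (N - Suc j) (p2 q1 (Suc j)) (q2 q1 (Suc j))"
        by (auto simp: resp_def SS)
      then show ?case using IH cu cv by (auto simp: SS intro: swP swQ)
    qed
    have keep: "p1 q1 (j + k) t = p1 q1 j t \<and> p2 q1 (j + k) t = p2 q1 j t \<and> q2 q1 (j + k) t = q2 q1 j t"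
      if "t < \<tau> j" for q1 j k t
    proof (induction k)
      case (Suc k)
      have "t < \<tau> (j + k)" using that \<tau>mono[of j "j+k"] by simp
      then show ?case using Suc by (simp add: SS switch_def)
    qed simp
    have causal: "p1 q1 i = p1 q1' i \<and> p2 q1 i = p2 q1' i \<and> q2 q1 i = q2 q1' i"
      if q: "q1 \<in> Q" "q1' \<in> Q" and j: "j < N" and eq: "ae_eq ts (\<tau> j) q1 q1'" and i: "i \<le> Suc j" for q1 q1' i j
      using i
    proof (induction i)
      case (Suc i)
      then have IH: "p1 q1 i = p1 q1' i" "p2 q1 i = p2 q1' i" "q2 q1 i = q2 q1' i" and ij: "i \<le> j" by auto
      have "A q1 i = A q1' i"
        unfolding A_def IH
        by (rule aim_causal) (use q inv[OF q(2), of i] ij j ae_eq_subinterval[OF eq \<tau>mono[OF ij]] in \<open>auto simp: \<tau>_def\<close>)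
      then show ?case by (simp add: SS IH)
    qed (simp add: S0)
    show thesis
    proof (rule that(2)[of "\<lambda>q. p1 q N"])
      show "delayed ts \<theta> N V U (\<lambda>q. p1 q N)"
        unfolding delayed_def
      proof (intro conjI ballI allI impI)
        fix q assume "q \<in> controls ts \<theta> V"
        then show "p1 q N \<in> controls ts \<theta> U" using inv[of q N] by (simp add: P_def Q_def)
      next
        fix j q q' assume j: "j < N" and q: "q \<in> controls ts \<theta> V" "q' \<in> controls ts \<theta> V"
          and eq: "ae_eq ts (grid ts \<theta> N j) q q'"
        have eq': "p1 q (Suc j) = p1 q' (Suc j)"
          using causal[of q q' j "Suc j"] q j eq by (auto simp: Q_def \<tau>_def)
        have "p1 q N t = p1 q' N t" if "t < \<tau> (Suc j)" for t
          using keep[OF that, of q "N - Suc j"] keep[OF that, of q' "N - Suc j"] eq' j by simp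
        then show "ae_eq ts (grid ts \<theta> N (Suc j)) (p1 q N) (p1 q' N)"
          by (intro ae_eqI) (auto simp: \<tau>_def)
      qed
      fix q assume q: "q \<in> Q"
      have I: "p1 q N \<in> P" "p2 q N \<in> P" "q2 q N \<in> Q" "\<not> Win 0 (p2 q N) (q2 q N)" using inv[OF q, of N] by auto
      have "J1 (p1 q N) q \<le> J2 (p2 q N) (q2 q N) + \<epsilon>"
      proof (rule aim_good[OF I(1) q I(2,3)])
        fix j t assume j: "j < N" and t: "grid ts \<theta> N j \<le> t" "t < grid ts \<theta> N (Suc j)"
        have K: "p1 q N t = p1 q j t \<and> p2 q N t = p2 q j t \<and> q2 q N t = q2 q j t" if "t < \<tau> j" "j \<le> N" for t j
          using keep[OF that(1), of q "N - j"] that by simp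
        have "aim j (p1 q N) q (p2 q N) (q2 q N) = A q j"
          unfolding A_def
          by (rule aim_causal[OF j I(1) q I(2,3)])
             (use inv[OF q, of j] q j K[of _ j] in \<open>auto simp: \<tau>_def intro!: ae_eqI\<close>)
        moreover have "p1 q N t = fst (A q j)" "q2 q N t = snd (A q j)"
          using K[of t "Suc j"] j t by (auto simp: \<tau>_def SS switch_def)
        ultimately show "p1 q N t = fst (aim j (p1 q N) q (p2 q N) (q2 q N)) \<and> q2 q N t = snd (aim j (p1 q N) q (p2 q N) (q2 q N))"
          by simp
      qed
      then show "J1 (p1 q N) q \<le> C + \<epsilon>" using I(4) by (simp add: Win_0)
    qed
  qed
qed

lemma const_nonanticipative:
  "u \<in> U \<Longrightarrow> (\<lambda>_ _. u) \<in> nonanticipative_strategies ts \<theta> V U"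
  by (auto simp: nonanticipative_strategies_def const_controls)

text \<open>
  If the inequality failed, there would be a number \<open>C\<close> above \<open>Y\<close> with \<open>C + \<epsilon>\<close> below \<open>X\<close>. A delayed
  strategy that guarantees \<open>C\<close> in the second game contradicts the choice of \<open>C\<close> directly if \<open>Y\<close> is the
  upper value, and through a consistent pair with an arbitrary strategy of the first player if \<open>Y\<close> is
  the lower value. The other alternative is symmetric.
\<close>

theorem game_values_compare:
  fixes U :: "(real ^ 'k) set" and V :: "(real ^ 'm) set"
    and J1 J2 :: "(real \<Rightarrow> real ^ 'k) \<Rightarrow> (real \<Rightarrow> real ^ 'm) \<Rightarrow> real" and ts \<theta> \<epsilon> B :: real
  defines "P \<equiv> controls ts \<theta> U" and "Q \<equiv> controls ts \<theta> V"
  assumes ts: "ts \<le> \<theta>" and U: "U \<noteq> {}" and V: "V \<noteq> {}"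
    and ae: "\<And>J p p' q q'. J \<in> {J1, J2} \<Longrightarrow> p \<in> P \<Longrightarrow> p' \<in> P \<Longrightarrow> q \<in> Q \<Longrightarrow> q' \<in> Q \<Longrightarrow>
      ae_eq ts \<theta> p p' \<Longrightarrow> ae_eq ts \<theta> q q' \<Longrightarrow> J p q = J p' q'"
    and B: "\<And>J p q. J \<in> {J1, J2} \<Longrightarrow> p \<in> P \<Longrightarrow> q \<in> Q \<Longrightarrow> \<bar>J p q\<bar> \<le> B"
    and alt: "\<And>C. (\<exists>N>0. \<exists>b. delayed ts \<theta> N U V b \<and> (\<forall>p\<in>P. C \<le> J2 p (b p))) \<or>
      (\<exists>N>0. \<exists>a. delayed ts \<theta> N V U a \<and> (\<forall>q\<in>Q. J1 (a q) q \<le> C + \<epsilon>))"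
    and X: "X = (INF a\<in>nonanticipative_strategies ts \<theta> V U. SUP q\<in>Q. J1 (a q) q) \<or>
      X = (SUP b\<in>nonanticipative_strategies ts \<theta> U V. INF p\<in>P. J1 p (b p))"
    and Y: "Y = (INF a\<in>nonanticipative_strategies ts \<theta> V U. SUP q\<in>Q. J2 (a q) q) \<or>
      Y = (SUP b\<in>nonanticipative_strategies ts \<theta> U V. INF p\<in>P. J2 p (b p))"
  shows "X \<le> Y + \<epsilon>"
proof (rule ccontr)
  obtain u v where u: "u \<in> U" and v: "v \<in> V" using U V by auto
  have p0: "(\<lambda>_. u) \<in> P" and q0: "(\<lambda>_. v) \<in> Q" using const_controls u v by (auto simp: P_def Q_def)
  have aP: "a q \<in> P" if "a \<in> nonanticipative_strategies ts \<theta> V U" "q \<in> Q" for a q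
    using that by (auto simp: nonanticipative_strategies_def P_def Q_def)
  have bQ: "b p \<in> Q" if "b \<in> nonanticipative_strategies ts \<theta> U V" "p \<in> P" for b p
    using that by (auto simp: nonanticipative_strategies_def P_def Q_def)
  have bounds: "J p q \<le> B" "- B \<le> J p q" if "J \<in> {J1, J2}" "p \<in> P" "q \<in> Q" for J p q
    using B[OF that] by auto
  have bddA: "bdd_above ((\<lambda>q. J (a q) q) ` Q)" if "J \<in> {J1, J2}" "a \<in> nonanticipative_strategies ts \<theta> V U" for J a
    using bounds(1)[OF that(1)] aP[OF that(2)] by (auto intro!: bdd_aboveI2)
  have bddB: "bdd_below ((\<lambda>p. J p (b p)) ` P)" if "J \<in> {J1, J2}" "b \<in> nonanticipative_strategies ts \<theta> U V" for J b
    using bounds(2)[OF that(1)] bQ[OF that(2)] by (auto intro!: bdd_belowI2)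
  assume "\<not> X \<le> Y + \<epsilon>"
  then obtain C where C: "Y < C" "C + \<epsilon> < X" using dense[of Y "X - \<epsilon>"] by (auto simp: algebra_simps)
  from alt[of C] show False
  proof (elim disjE exE conjE)
    fix N b assume N: "N > 0" and d: "delayed ts \<theta> N U V b" and ge: "\<forall>p\<in>P. C \<le> J2 p (b p)"
    have b: "b \<in> nonanticipative_strategies ts \<theta> U V" by (rule delayed_nonanticipative[OF N d])
    from Y have "C \<le> Y"
    proof
      assume Y: "Y = (INF a\<in>nonanticipative_strategies ts \<theta> V U. SUP q\<in>Q. J2 (a q) q)"
      show "C \<le> Y" unfolding Y
      proof (rule cINF_greatest)
        show "nonanticipative_strategies ts \<theta> V U \<noteq> {}" using const_nonanticipative[OF u] by blast
        fix a assume a: "a \<in> nonanticipative_strategies ts \<theta> V U"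
        obtain q where q: "q \<in> Q" "ae_eq ts \<theta> (b (a q)) q"
          using delayed_fixed_point[OF N d a ts v] by (auto simp: Q_def)
        have "C \<le> J2 (a q) (b (a q))" using ge aP[OF a q(1)] by blast
        also have "\<dots> = J2 (a q) q" by (rule ae) (use q aP[OF a q(1)] bQ[OF b] in auto)
        finally show "C \<le> (SUP q\<in>Q. J2 (a q) q)" using cSUP_upper2[OF bddA[of J2, OF _ a] q(1)] by auto
      qed
    next
      assume Y: "Y = (SUP b\<in>nonanticipative_strategies ts \<theta> U V. INF p\<in>P. J2 p (b p))"
      have "C \<le> (INF p\<in>P. J2 p (b p))" using ge p0 by (intro cINF_greatest) auto
      also have "\<dots> \<le> Y" unfolding Y
      proof (rule cSUP_upper[OF b])
        have "(INF p\<in>P. J2 p (b p)) \<le> B" if "b \<in> nonanticipative_strategies ts \<theta> U V" for b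
          by (rule cINF_lower2[OF bddB p0]) (use that p0 bounds(1) bQ in auto)
        then show "bdd_above ((\<lambda>b. INF p\<in>P. J2 p (b p)) ` nonanticipative_strategies ts \<theta> U V)"
          by (rule bdd_aboveI2)
      qed
      finally show ?thesis .
    qed
    then show False using C by simp
  next
    fix N a assume N: "N > 0" and d: "delayed ts \<theta> N V U a" and le: "\<forall>q\<in>Q. J1 (a q) q \<le> C + \<epsilon>"
    have a: "a \<in> nonanticipative_strategies ts \<theta> V U" by (rule delayed_nonanticipative[OF N d])
    from X have "X \<le> C + \<epsilon>"
    proof
      assume X: "X = (SUP b\<in>nonanticipative_strategies ts \<theta> U V. INF p\<in>P. J1 p (b p))"
      show ?thesis unfolding X
      proof (rule cSUP_least)
        show "nonanticipative_strategies ts \<theta> U V \<noteq> {}" using const_nonanticipative[OF v] by blast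
        fix b assume b: "b \<in> nonanticipative_strategies ts \<theta> U V"
        obtain p where p: "p \<in> P" "ae_eq ts \<theta> (a (b p)) p"
          using delayed_fixed_point[OF N d b ts u] by (auto simp: P_def)
        have "J1 p (b p) = J1 (a (b p)) (b p)" by (rule ae) (use p bQ[OF b p(1)] aP[OF a] in \<open>auto intro: ae_eq_sym\<close>)
        also have "\<dots> \<le> C + \<epsilon>" using le bQ[OF b p(1)] by blast
        finally show "(INF p\<in>P. J1 p (b p)) \<le> C + \<epsilon>" using cINF_lower2[OF bddB[of J1, OF _ b] p(1)] by auto
      qed
    next
      assume X: "X = (INF a\<in>nonanticipative_strategies ts \<theta> V U. SUP q\<in>Q. J1 (a q) q)"
      have "X \<le> (SUP q\<in>Q. J1 (a q) q)" unfolding X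
      proof (rule cINF_lower[OF _ a])
        have "- B \<le> (SUP q\<in>Q. J1 (a q) q)" if "a \<in> nonanticipative_strategies ts \<theta> V U" for a
          by (rule cSUP_upper2[OF bddA q0]) (use that q0 bounds(2) aP in auto)
        then show "bdd_below ((\<lambda>a. SUP q\<in>Q. J1 (a q) q) ` nonanticipative_strategies ts \<theta> V U)"
          by (rule bdd_belowI2)
      qed
      also have "\<dots> \<le> C + \<epsilon>" using le q0 by (intro cSUP_least) auto
      finally show ?thesis .
    qed
    then show False using C by simp
  qed
qed

section \<open>Volterra integrals\<close>

text \<open>
  The kernel vanishes at nonpositive arguments so that the convolution below is causal.
\<close>

definition vkernel :: "(real \<Rightarrow> real) \<Rightarrow> bool" where
  "vkernel K \<longleftrightarrow> (\<forall>\<tau>\<le>0. K \<tau> = 0) \<and> (\<forall>\<tau>. 0 \<le> K \<tau>) \<and> (\<forall>b. K integrable_on {0..b})"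

definition mass :: "(real \<Rightarrow> real) \<Rightarrow> real \<Rightarrow> real" where
  "mass K u = integral {0..u} K"

text \<open>
  The bound holds at every point. A function that is only essentially bounded is first changed on a
  null set, and estimates can then be made without exceptional sets.
\<close>

definition bmeas :: "real \<Rightarrow> real \<Rightarrow> real \<Rightarrow> (real \<Rightarrow> 'b::euclidean_space) \<Rightarrow> bool" where
  "bmeas a b M \<phi> \<longleftrightarrow> \<phi> \<in> borel_measurable (lebesgue_on {a..b}) \<and> (\<forall>t\<in>{a..b}. norm (\<phi> t) \<le> M)"

text \<open>
  The convolution \<open>\<integral> K(t - \<tau>) \<phi>(\<tau>) d\<tau>\<close> over \<open>{a..t}\<close>. It is written as an integral over the fixed interval
  \<open>{a..b}\<close>, which is the same since \<open>K\<close> vanishes at nonpositive arguments.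
\<close>

definition volterra :: "real \<Rightarrow> real \<Rightarrow> (real \<Rightarrow> real) \<Rightarrow> (real \<Rightarrow> 'b::euclidean_space) \<Rightarrow> real \<Rightarrow> 'b" where
  "volterra a b K \<phi> t = integral {a..b} (\<lambda>\<tau>. K (t - \<tau>) *\<^sub>R \<phi> \<tau>)"

lemma kernel_nonneg: "vkernel K \<Longrightarrow> 0 \<le> K \<tau>" and kernel_zero: "vkernel K \<Longrightarrow> \<tau> \<le> 0 \<Longrightarrow> K \<tau> = 0"
  by (auto simp: vkernel_def)

lemma kernel_integrable:
  assumes K: "vkernel K"
  shows "K integrable_on {c..d}"
proof -
  have "K integrable_on {min c 0..0}"
    by (rule integrable_eq[of "\<lambda>_. 0"]) (use K in \<open>auto simp: vkernel_def\<close>)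
  moreover have "K integrable_on {0..max d 0}" using K by (simp add: vkernel_def)
  ultimately have "K integrable_on {min c 0..max d 0}"
    by (intro Henstock_Kurzweil_Integration.integrable_combine[of "min c 0" 0 "max d 0"]) auto
  then show ?thesis by (rule integrable_on_subinterval) auto
qed

lemma integral_extend_zero:
  fixes f :: "'a::euclidean_space \<Rightarrow> 'b::banach"
  assumes "S \<subseteq> T" shows "integral T (\<lambda>x. if x \<in> S then f x else 0) = integral S f"
  using Henstock_Kurzweil_Integration.integral_restrict_Int[of T S f] assms by (simp only: Int_absorb2)

lemma has_integral_reflect_shift:
  fixes f :: "real \<Rightarrow> 'b::banach"
  assumes "(f has_integral I) {t - b..t - a}"
  shows "((\<lambda>\<tau>. f (t - \<tau>)) has_integral I) {a..b}"
proof -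
  have "((f \<circ> ((+) t)) has_integral I) {- b..- a}"
    using assms by (subst has_integral_shift_Icc_real) (simp add: algebra_simps)
  then have "((\<lambda>\<tau>. (f \<circ> ((+) t)) (- \<tau>)) has_integral I) {- (- a)..- (- b)}"
    by (rule has_integral_reflect_lemma_real)
  then show ?thesis by (simp add: o_def)
qed

lemma kernel_reflect:
  assumes K: "vkernel K"
  shows "(\<lambda>\<tau>. K (t - \<tau>)) integrable_on {a..b}"
    and "t \<le> b \<Longrightarrow> integral {a..b} (\<lambda>\<tau>. K (t - \<tau>)) = mass K (t - a)"
proof -
  have 1: "((\<lambda>\<tau>. K (t - \<tau>)) has_integral integral {t - b..t - a} K) {a..b}"
    by (intro has_integral_reflect_shift integrable_integral kernel_integrable K)
  then show "(\<lambda>\<tau>. K (t - \<tau>)) integrable_on {a..b}" by (auto simp: integrable_on_def)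
  have 2: "integral {t - b..t - a} K = mass K (t - a)" if "t \<le> b"
  proof (cases "a \<le> t")
    case True
    have "integral {t - b..0} K + integral {0..t - a} K = integral {t - b..t - a} K"
      by (rule Henstock_Kurzweil_Integration.integral_combine) (use that True kernel_integrable[OF K] in auto)
    moreover have "integral {t - b..0} K = integral {t - b..0} (\<lambda>_. 0)"
      by (rule integral_cong) (use kernel_zero[OF K] in auto)
    ultimately show ?thesis by (simp add: mass_def)
  next
    case False
    have "integral {t - b..t - a} K = integral {t - b..t - a} (\<lambda>_. 0)"
      by (rule integral_cong) (use kernel_zero[OF K] False in auto)
    then show ?thesis using False by (simp add: mass_def)
  qed
  show "integral {a..b} (\<lambda>\<tau>. K (t - \<tau>)) = mass K (t - a)" if "t \<le> b"
    using integral_unique[OF 1] 2[OF that] by simp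
qed

lemma mass_nonneg: "vkernel K \<Longrightarrow> 0 \<le> mass K u"
  unfolding mass_def by (intro integral_nonneg kernel_integrable) (auto simp: kernel_nonneg)

lemma mass_mono: "vkernel K \<Longrightarrow> u \<le> v \<Longrightarrow> mass K u \<le> mass K v"
  unfolding mass_def by (intro integral_subset_le kernel_integrable) (auto simp: kernel_nonneg)

lemma abs_integrable_bmeas:
  fixes \<phi> :: "real \<Rightarrow> 'b::euclidean_space" and k :: "real \<Rightarrow> real"
  assumes k: "k absolutely_integrable_on {a..b}" and \<phi>: "bmeas a b M \<phi>"
  shows "(\<lambda>\<tau>. k \<tau> *\<^sub>R \<phi> \<tau>) absolutely_integrable_on {a..b}"
proof -
  have "bilinear (\<lambda>(x::'b) (r::real). r *\<^sub>R x)"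
    by (auto simp: bilinear_def algebra_simps intro!: linearI)
  then show ?thesis
    by (rule absolutely_integrable_bounded_measurable_product)
       (use \<phi> k in \<open>auto simp: bmeas_def bounded_iff\<close>)
qed

lemma bmeas_integrable:
  fixes \<phi> :: "real \<Rightarrow> 'b::euclidean_space"
  assumes "bmeas a b M \<phi>" shows "\<phi> absolutely_integrable_on {a..b}"
  using abs_integrable_bmeas[where k="\<lambda>_. 1", OF _ assms] by simp

lemma kernel_abs_integrable:
  assumes K: "vkernel K" shows "(\<lambda>\<tau>. K (t - \<tau>)) absolutely_integrable_on {a..b}"
  by (rule nonnegative_absolutely_integrable_1[OF kernel_reflect(1)[OF K]]) (simp add: kernel_nonneg[OF K])

lemma volterra_integrable:
  fixes \<phi> :: "real \<Rightarrow> 'b::euclidean_space"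
  assumes K: "vkernel K" and \<phi>: "bmeas a b M \<phi>"
  shows "(\<lambda>\<tau>. K (t - \<tau>) *\<^sub>R \<phi> \<tau>) absolutely_integrable_on {a..b}"
  by (rule abs_integrable_bmeas[OF kernel_abs_integrable[OF K] \<phi>])

lemma volterra_integrable_on:
  fixes \<phi> :: "real \<Rightarrow> 'b::euclidean_space"
  assumes K: "vkernel K" and \<phi>: "bmeas a b M \<phi>"
  shows "(\<lambda>\<tau>. K (t - \<tau>) *\<^sub>R \<phi> \<tau>) integrable_on {a..b}"
  using volterra_integrable[OF assms] set_lebesgue_integral_eq_integral(1) by blast

lemma bmeas_diff: "bmeas a b M \<phi> \<Longrightarrow> bmeas a b M' \<psi> \<Longrightarrow> bmeas a b (M + M') (\<lambda>t. \<phi> t - \<psi> t)"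
  unfolding bmeas_def by (auto intro!: borel_measurable_diff order_trans[OF norm_triangle_ineq4] add_mono)

lemma bmeas_continuous:
  assumes "continuous_on {a..b} \<phi>"
  obtains M where "0 \<le> M" "bmeas a b M \<phi>"
proof -
  have "compact (\<phi> ` {a..b})" using assms compact_continuous_image by blast
  then obtain M where "\<forall>x\<in>\<phi> ` {a..b}. norm x \<le> M" using compact_imp_bounded bounded_iff by blast
  then have "bmeas a b (max M 0) \<phi>"
    unfolding bmeas_def using assms by (auto intro: continuous_imp_measurable_on_sets_lebesgue max.coboundedI1)
  then show thesis using that[of "max M 0"] by simp
qed

lemma bmeas_const: "norm c \<le> M \<Longrightarrow> bmeas a b M (\<lambda>_. c)"
  by (simp add: bmeas_def)

lemma volterra_norm_le:
  fixes \<phi> :: "real \<Rightarrow> 'b::euclidean_space" and g :: "real \<Rightarrow> real"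
  assumes K: "vkernel K" and \<phi>: "bmeas a b M \<phi>" and g: "bmeas a b M' g"
    and le: "\<And>\<tau>. \<tau> \<in> {a..b} \<Longrightarrow> \<tau> < t \<Longrightarrow> norm (\<phi> \<tau>) \<le> g \<tau>"
  shows "norm (volterra a b K \<phi> t) \<le> volterra a b K g t"
  unfolding volterra_def
proof (rule integral_norm_bound_integral)
  fix \<tau> assume "\<tau> \<in> {a..b}"
  then show "norm (K (t - \<tau>) *\<^sub>R \<phi> \<tau>) \<le> K (t - \<tau>) *\<^sub>R g \<tau>"
    using le[of \<tau>] kernel_nonneg[OF K, of "t - \<tau>"] kernel_zero[OF K, of "t - \<tau>"]
    by (cases "\<tau> < t") (auto intro: mult_left_mono)
qed (use volterra_integrable_on[OF K \<phi>, of t] volterra_integrable_on[OF K g, of t] in simp_all)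

lemma volterra_mono:
  fixes f g :: "real \<Rightarrow> real"
  assumes K: "vkernel K" and f: "bmeas a b M f" and g: "bmeas a b M' g"
    and le: "\<And>\<tau>. \<tau> \<in> {a..b} \<Longrightarrow> \<tau> < t \<Longrightarrow> f \<tau> \<le> g \<tau>"
  shows "volterra a b K f t \<le> volterra a b K g t"
  unfolding volterra_def
proof (rule integral_le)
  fix \<tau> assume "\<tau> \<in> {a..b}"
  then show "K (t - \<tau>) *\<^sub>R f \<tau> \<le> K (t - \<tau>) *\<^sub>R g \<tau>"
    using le[of \<tau>] kernel_nonneg[OF K, of "t - \<tau>"] kernel_zero[OF K, of "t - \<tau>"]
    by (cases "\<tau> < t") (auto intro: mult_left_mono)
qed (use volterra_integrable_on[OF K f, of t] volterra_integrable_on[OF K g, of t] in simp_all)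

lemma volterra_kernel_mono:
  fixes g :: "real \<Rightarrow> real"
  assumes K: "vkernel K" and K': "vkernel K'" and g: "bmeas a b M g"
    and g0: "\<And>\<tau>. \<tau> \<in> {a..b} \<Longrightarrow> 0 \<le> g \<tau>" and le: "\<And>\<tau>. K \<tau> \<le> K' \<tau>"
  shows "volterra a b K g t \<le> volterra a b K' g t"
  unfolding volterra_def
  by (rule integral_le) (use volterra_integrable_on[OF K g] volterra_integrable_on[OF K' g] le g0 in \<open>auto intro: mult_right_mono\<close>)

lemma volterra_const: "vkernel K \<Longrightarrow> t \<le> b \<Longrightarrow> volterra a b K (\<lambda>_. c::real) t = mass K (t - a) * c"
  unfolding volterra_def using kernel_reflect(2)[of K t b a] by (simp flip: kernel_reflect(2))

lemma volterra_add:
  assumes "vkernel K" "bmeas a b M \<phi>" "bmeas a b M' \<psi>"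
  shows "volterra a b K (\<lambda>\<tau>. \<phi> \<tau> + \<psi> \<tau>) t = volterra a b K \<phi> t + volterra a b K \<psi> t"
  unfolding volterra_def using assms
  by (simp add: scaleR_add_right volterra_integrable_on Henstock_Kurzweil_Integration.integral_add)

lemma volterra_diff:
  assumes "vkernel K" "bmeas a b M \<phi>" "bmeas a b M' \<psi>"
  shows "volterra a b K (\<lambda>\<tau>. \<phi> \<tau> - \<psi> \<tau>) t = volterra a b K \<phi> t - volterra a b K \<psi> t"
  unfolding volterra_def using assms
  by (simp add: scaleR_diff_right volterra_integrable_on Henstock_Kurzweil_Integration.integral_diff)

lemma volterra_cmul: "volterra a b K (\<lambda>\<tau>. c * \<phi> \<tau>) t = c * volterra a b K \<phi> (t::real)" for \<phi> :: "real \<Rightarrow> real"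
  unfolding volterra_def by (simp add: mult.left_commute[of _ c])

lemma volterra_norm_mass:
  fixes \<phi> :: "real \<Rightarrow> 'b::euclidean_space"
  assumes K: "vkernel K" and \<phi>: "bmeas a b M \<phi>" and t: "t \<in> {a..b}"
  shows "norm (volterra a b K \<phi> t) \<le> mass K (t - a) * M"
proof -
  have "norm (volterra a b K \<phi> t) \<le> volterra a b K (\<lambda>_. M) t"
    by (rule volterra_norm_le[OF K \<phi> bmeas_const[OF order_refl]]) (use \<phi> in \<open>auto simp: bmeas_def\<close>)
  then show ?thesis using volterra_const[OF K, of t b a M] t by simp
qed

lemma volterra_kernel_diff:
  fixes \<phi> :: "real \<Rightarrow> 'b::euclidean_space"
  assumes K: "vkernel K" and K': "vkernel K'" and \<phi>: "bmeas a b M \<phi>" and t: "t \<in> {a..b}" and M: "0 \<le> M"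
  shows "norm (volterra a b K \<phi> t - volterra a b K' \<phi> t) \<le> M * integral {0..b - a} (\<lambda>u. \<bar>K u - K' u\<bar>)"
proof -
  define D where "D u = \<bar>K u - K' u\<bar>" for u
  have Dk: "vkernel D"
    unfolding vkernel_def
  proof (intro conjI allI impI)
    fix c
    have "(\<lambda>u. K u - K' u) absolutely_integrable_on {0..c}"
      using nonnegative_absolutely_integrable_1[OF kernel_integrable[OF K, of 0 c]]
        nonnegative_absolutely_integrable_1[OF kernel_integrable[OF K', of 0 c]] kernel_nonneg[OF K] kernel_nonneg[OF K']
      by (intro set_integral_diff) auto
    then show "D integrable_on {0..c}"
      unfolding D_def absolutely_integrable_on_def by simp
  qed (use kernel_zero[OF K] kernel_zero[OF K'] in \<open>auto simp: D_def\<close>)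
  have "volterra a b K \<phi> t - volterra a b K' \<phi> t = integral {a..b} (\<lambda>\<tau>. (K (t - \<tau>) - K' (t - \<tau>)) *\<^sub>R \<phi> \<tau>)"
    unfolding volterra_def
    by (subst Henstock_Kurzweil_Integration.integral_diff[symmetric])
       (use volterra_integrable_on[OF K \<phi>] volterra_integrable_on[OF K' \<phi>] in \<open>auto simp: scaleR_diff_left\<close>)
  also have "norm \<dots> \<le> integral {a..b} (\<lambda>\<tau>. D (t - \<tau>) * M)"
  proof (rule integral_norm_bound_integral)
    show "(\<lambda>\<tau>. (K (t - \<tau>) - K' (t - \<tau>)) *\<^sub>R \<phi> \<tau>) integrable_on {a..b}"
      unfolding scaleR_diff_left
      by (intro integrable_diff volterra_integrable_on[OF K \<phi>] volterra_integrable_on[OF K' \<phi>])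
    show "(\<lambda>\<tau>. D (t - \<tau>) * M) integrable_on {a..b}"
      by (rule integrable_on_mult_left[OF kernel_reflect(1)[OF Dk]])
  qed (use \<phi> in \<open>auto simp: D_def bmeas_def intro: mult_left_mono\<close>)
  also have "\<dots> = mass D (t - a) * M"
    using kernel_reflect(2)[OF Dk, of t b a] t by simp
  also have "\<dots> \<le> mass D (b - a) * M"
    by (intro mult_right_mono mass_mono Dk M) (use t in auto)
  finally show ?thesis by (simp add: mass_def D_def[abs_def] mult.commute)
qed

text \<open>
  A modulus of continuity that depends on \<open>\<phi>\<close> only through its bound. For \<open>s \<le> t\<close> the kernel loses mass
  on \<open>{a..s}\<close> when it is shifted, because it decreases, and this loss is at most the mass that it gains
  on \<open>{s..t}\<close>, which is \<open>mass K (t - s)\<close>.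
\<close>

lemma volterra_modulus:
  fixes \<phi> :: "real \<Rightarrow> 'b::euclidean_space"
  assumes K: "vkernel K" and anti: "\<And>u v. 0 < u \<Longrightarrow> u \<le> v \<Longrightarrow> K v \<le> K u"
    and \<phi>: "bmeas a b M \<phi>" and s: "s \<in> {a..b}" and t: "t \<in> {a..b}" and M: "0 \<le> M"
  shows "norm (volterra a b K \<phi> t - volterra a b K \<phi> s) \<le> 2 * M * mass K \<bar>t - s\<bar>"
proof -
  have main: "norm (volterra a b K \<phi> t - volterra a b K \<phi> s) \<le> 2 * M * mass K (t - s)"
    if st: "s \<le> t" "s \<in> {a..b}" "t \<in> {a..b}" for s t
  proof -
    \<comment> \<open>An integrable majorant of the absolute difference of the shifted kernels.\<close>
    define D where "D \<tau> = K (s - \<tau>) - K (t - \<tau>) + 2 * (if \<tau> \<in> {s..b} then K (t - \<tau>) else 0)" for \<tau>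
    have 1: "((\<lambda>\<tau>. K (s - \<tau>)) has_integral mass K (s - a)) {a..b}"
      and 2: "((\<lambda>\<tau>. K (t - \<tau>)) has_integral mass K (t - a)) {a..b}"
      and 3: "((\<lambda>\<tau>. K (t - \<tau>)) has_integral mass K (t - s)) {s..b}"
      using kernel_reflect[OF K] st by (metis atLeastAtMost_iff has_integral_integral)+
    have 4: "((\<lambda>\<tau>. if \<tau> \<in> {s..b} then K (t - \<tau>) else 0) has_integral mass K (t - s)) {a..b}"
      using 3 by (subst has_integral_restrict) (use st in auto)
    have D: "(D has_integral mass K (s - a) - mass K (t - a) + 2 * mass K (t - s)) {a..b}"
      unfolding D_def by (intro has_integral_add has_integral_diff has_integral_mult_right 1 2 4)
    have le: "\<bar>K (t - \<tau>) - K (s - \<tau>)\<bar> \<le> D \<tau>" if "\<tau> \<in> {a..b}" for \<tau>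
    proof (cases "\<tau> < s")
      case True
      then show ?thesis using anti[of "s - \<tau>" "t - \<tau>"] st by (simp add: D_def)
    next
      case False
      then show ?thesis using kernel_zero[OF K, of "s - \<tau>"] kernel_nonneg[OF K, of "t - \<tau>"] that by (simp add: D_def)
    qed
    have "volterra a b K \<phi> t - volterra a b K \<phi> s = integral {a..b} (\<lambda>\<tau>. (K (t - \<tau>) - K (s - \<tau>)) *\<^sub>R \<phi> \<tau>)"
      unfolding volterra_def
      by (subst Henstock_Kurzweil_Integration.integral_diff[symmetric])
         (use volterra_integrable_on[OF K \<phi>] in \<open>auto simp: scaleR_diff_left\<close>)
    also have "norm \<dots> \<le> integral {a..b} (\<lambda>\<tau>. D \<tau> * M)"
    proof (rule integral_norm_bound_integral)
      show "(\<lambda>\<tau>. (K (t - \<tau>) - K (s - \<tau>)) *\<^sub>R \<phi> \<tau>) integrable_on {a..b}"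
        unfolding scaleR_diff_left by (intro integrable_diff volterra_integrable_on[OF K \<phi>])
      show "(\<lambda>\<tau>. D \<tau> * M) integrable_on {a..b}"
        using has_integral_mult_left[OF D, of M] by blast
      show "norm ((K (t - \<tau>) - K (s - \<tau>)) *\<^sub>R \<phi> \<tau>) \<le> D \<tau> * M" if "\<tau> \<in> {a..b}" for \<tau>
        using le[OF that] that \<phi> by (auto simp: bmeas_def intro!: mult_mono)
    qed
    also have "\<dots> = (mass K (s - a) - mass K (t - a) + 2 * mass K (t - s)) * M"
      by (rule integral_unique[OF has_integral_mult_left[OF D]])
    also have "\<dots> \<le> (2 * mass K (t - s)) * M"
      by (rule mult_right_mono[OF _ M]) (use mass_mono[OF K, of "s - a" "t - a"] st in simp)
    finally show ?thesis by (simp add: mult_ac)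
  qed
  show ?thesis
  proof (cases "s \<le> t")
    case False
    then show ?thesis using main[of t s] s t by (simp add: norm_minus_commute abs_minus_commute)
  qed (use main[of s t] s t in simp)
qed

lemma exp_damped_mass_small:
  assumes K: "vkernel K" and e: "0 < e"
  obtains \<kappa> where "0 < \<kappa>" "vkernel (\<lambda>u. K u * exp (- \<kappa> * u))" "mass (\<lambda>u. K u * exp (- \<kappa> * u)) T \<le> e"
proof -
  have dk: "vkernel (\<lambda>u. K u * exp (- \<kappa> * u))" if "0 < \<kappa>" for \<kappa>
    unfolding vkernel_def
  proof (intro conjI allI impI)
    fix c
    have "(\<lambda>u. K u *\<^sub>R exp (- \<kappa> * u)) absolutely_integrable_on {0..c}"
    proof (rule abs_integrable_bmeas[where M=1])
      show "K absolutely_integrable_on {0..c}"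
        by (rule nonnegative_absolutely_integrable_1[OF kernel_integrable[OF K]]) (simp add: kernel_nonneg[OF K])
      show "bmeas 0 c 1 (\<lambda>u. exp (- \<kappa> * u))"
        unfolding bmeas_def using that
        by (auto intro!: continuous_imp_measurable_on_sets_lebesgue continuous_intros)
    qed
    then show "(\<lambda>u. K u * exp (- \<kappa> * u)) integrable_on {0..c}"
      using set_lebesgue_integral_eq_integral(1) by auto
  qed (use kernel_zero[OF K] kernel_nonneg[OF K] in auto)
  have "(\<lambda>n. integral {0..T} (\<lambda>u. K u * exp (- real (Suc n) * u))) \<longlonglongrightarrow> integral {0..T} (\<lambda>_. 0)"
  proof (rule dominated_convergence(2)[where h=K])
    show "(\<lambda>n. K u * exp (- real (Suc n) * u)) \<longlonglongrightarrow> 0" if "u \<in> {0..T}" for u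
    proof (cases "u = 0")
      case True
      then show ?thesis using kernel_zero[OF K, of 0] by simp
    next
      case False
      then have u: "0 < u" using that by auto
      have "filterlim (\<lambda>n. real (Suc n) * u) at_top sequentially"
        by (rule filterlim_at_top_mult_tendsto_pos[OF tendsto_const u])
           (rule filterlim_compose[OF filterlim_real_sequentially filterlim_Suc])
      then have "(\<lambda>n. exp (- (real (Suc n) * u))) \<longlonglongrightarrow> 0"
        by (intro filterlim_compose[OF exp_at_bot] filterlim_uminus_at_bot[THEN iffD2]) simp
      from tendsto_mult_right_zero[OF this, of "K u"] show ?thesis by (simp only: mult_minus_left)
    qed
    show "(\<lambda>u. K u * exp (- real (Suc n) * u)) integrable_on {0..T}" for n
      using dk[of "real (Suc n)"] by (simp add: vkernel_def)
    show "norm (K u * exp (- real (Suc n) * u)) \<le> K u" if "u \<in> {0..T}" for n u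
    proof -
      have "exp (- real (Suc n) * u) \<le> 1" using that by (auto simp: mult_nonpos_nonneg)
      then show ?thesis using kernel_nonneg[OF K, of u] by (simp add: abs_mult mult_left_le)
    qed
  qed (use K in \<open>auto simp: vkernel_def\<close>)
  then have "(\<lambda>n. integral {0..T} (\<lambda>u. K u * exp (- real (Suc n) * u))) \<longlonglongrightarrow> 0" by simp
  from order_tendstoD(2)[OF this e] obtain n where "integral {0..T} (\<lambda>u. K u * exp (- real (Suc n) * u)) < e"
    by (auto simp: eventually_sequentially)
  then show thesis using that[of "real (Suc n)"] dk[of "real (Suc n)"] by (simp add: mass_def)
qed

text \<open>
  In a norm with a strong exponential weight the Volterra operator has an arbitrarily small norm, since
  the kernel damped by \<open>exp (- \<kappa> * u)\<close> loses its mass as \<open>\<kappa>\<close> grows. The weight is the same for all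
  intervals of length at most \<open>T\<close>.
\<close>

lemma volterra_exp_weight:
  assumes K: "vkernel K" and e: "0 < e"
  obtains \<kappa> where "0 < \<kappa>" "\<And>a b t. b - a \<le> T \<Longrightarrow> t \<in> {a..b} \<Longrightarrow>
    volterra a b K (\<lambda>\<tau>. exp (\<kappa> * (\<tau> - a))) t \<le> e * exp (\<kappa> * (t - a))"
proof -
  obtain \<kappa> where \<kappa>: "0 < \<kappa>" and dk: "vkernel (\<lambda>u. K u * exp (- \<kappa> * u))" (is "vkernel ?K")
    and small: "mass (\<lambda>u. K u * exp (- \<kappa> * u)) T \<le> e"
    by (rule exp_damped_mass_small[OF K e])
  have "volterra a b K (\<lambda>\<tau>. exp (\<kappa> * (\<tau> - a))) t \<le> e * exp (\<kappa> * (t - a))" if "b - a \<le> T" "t \<in> {a..b}" for a b t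
  proof -
    have "volterra a b K (\<lambda>\<tau>. exp (\<kappa> * (\<tau> - a))) t = integral {a..b} (\<lambda>\<tau>. exp (\<kappa> * (t - a)) * ?K (t - \<tau>))"
      unfolding volterra_def
    proof (rule integral_cong)
      fix \<tau>
      have "exp (\<kappa> * (\<tau> - a)) = exp (\<kappa> * (t - a)) * exp (- \<kappa> * (t - \<tau>))"
        by (simp add: mult_exp_exp algebra_simps)
      then show "K (t - \<tau>) *\<^sub>R exp (\<kappa> * (\<tau> - a)) = exp (\<kappa> * (t - a)) * ?K (t - \<tau>)" by simp
    qed
    also have "\<dots> = exp (\<kappa> * (t - a)) * mass ?K (t - a)"
      using kernel_reflect(2)[OF dk, of t b a] that by simp
    also have "\<dots> \<le> exp (\<kappa> * (t - a)) * e"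
      using mass_mono[OF dk, of "t - a" T] small that by (intro mult_left_mono) auto
    finally show ?thesis by (simp add: mult.commute)
  qed
  then show thesis using that \<kappa> by blast
qed

text \<open>
  A weak form of the inequality \<open>e \<le> A + volterra a b K e\<close>, tested with exponential majorants of \<open>e\<close>
  only. Since these majorants increase, it also covers inequalities in which the integrand depends on
  the supremum of \<open>e\<close> over the past, as happens for systems with delay.
\<close>

definition exp_subsolution :: "real \<Rightarrow> real \<Rightarrow> (real \<Rightarrow> real) \<Rightarrow> real \<Rightarrow> (real \<Rightarrow> real) \<Rightarrow> bool" where
  "exp_subsolution a b K A e \<longleftrightarrow> (\<forall>m \<kappa>. 0 < \<kappa> \<longrightarrow> 0 \<le> m \<longrightarrow> (\<forall>\<tau>\<in>{a..b}. e \<tau> \<le> m * exp (\<kappa> * (\<tau> - a))) \<longrightarrow>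
     (\<forall>t\<in>{a..b}. e t \<le> A + m * volterra a b K (\<lambda>\<tau>. exp (\<kappa> * (\<tau> - a))) t))"

text \<open>
  A single factor for all intervals of length at most \<open>T\<close>, all functions and all constants \<open>A\<close>.
\<close>

definition gronwall_factor :: "(real \<Rightarrow> real) \<Rightarrow> real \<Rightarrow> real \<Rightarrow> bool" where
  "gronwall_factor K T G \<longleftrightarrow> 0 < G \<and> (\<forall>a b e A. a \<le> b \<longrightarrow> b - a \<le> T \<longrightarrow> continuous_on {a..b} e \<longrightarrow> 0 \<le> A \<longrightarrow>
    (\<forall>t\<in>{a..b}. 0 \<le> e t) \<longrightarrow> exp_subsolution a b K A e \<longrightarrow> (\<forall>t\<in>{a..b}. e t \<le> G * A))"

lemma gronwall_factorD:
  assumes "gronwall_factor K T G" "exp_subsolution a b K A e" "a \<le> b" "b - a \<le> T" "continuous_on {a..b} e" "0 \<le> A"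
    "\<And>t. t \<in> {a..b} \<Longrightarrow> 0 \<le> e t" "t \<in> {a..b}"
  shows "e t \<le> G * A"
  using assms unfolding gronwall_factor_def by blast

text \<open>
  Choose the exponential weight so that the Volterra operator has norm at most \<open>1/2\<close>. The best
  majorant \<open>m * exp (\<kappa> * (t - a))\<close> of \<open>e\<close> then satisfies \<open>m \<le> A + m / 2\<close>, that is, \<open>m \<le> 2 * A\<close>.
\<close>

lemma volterra_gronwall:
  assumes K: "vkernel K"
  obtains G where "0 < G" "gronwall_factor K T G"
proof -
  obtain \<kappa> where \<kappa>: "0 < \<kappa>" and w: "\<And>a b t. b - a \<le> T \<Longrightarrow> t \<in> {a..b} \<Longrightarrow>
    volterra a b K (\<lambda>\<tau>. exp (\<kappa> * (\<tau> - a))) t \<le> (1/2) * exp (\<kappa> * (t - a))"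
    by (rule volterra_exp_weight[OF K, of "1/2" T]) auto
  have "gronwall_factor K T (2 * exp (\<kappa> * \<bar>T\<bar>))"
    unfolding gronwall_factor_def
  proof (intro conjI allI impI ballI)
    fix a b A :: real and e :: "real \<Rightarrow> real" and t
    assume ab: "a \<le> b" "b - a \<le> T" and e: "continuous_on {a..b} e" and A: "0 \<le> A"
      and e0: "\<forall>t\<in>{a..b}. 0 \<le> e t" and t: "t \<in> {a..b}"
      and sub: "exp_subsolution a b K A e"
    \<comment> \<open>The best majorant touches \<open>e\<close> at a point \<open>s\<close>, where the weighted function is maximal.\<close>
    have "\<exists>s\<in>{a..b}. \<forall>\<tau>\<in>{a..b}. e \<tau> * exp (- \<kappa> * (\<tau> - a)) \<le> e s * exp (- \<kappa> * (s - a))"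
      by (rule continuous_attains_sup) (use ab e in \<open>auto intro!: continuous_intros\<close>)
    then obtain s where s: "s \<in> {a..b}" and smax: "\<And>\<tau>. \<tau> \<in> {a..b} \<Longrightarrow> e \<tau> * exp (- \<kappa> * (\<tau> - a)) \<le> e s * exp (- \<kappa> * (s - a))"
      by blast
    define m where "m = e s * exp (- \<kappa> * (s - a))"
    have m0: "0 \<le> m" using e0 s by (simp add: m_def)
    have dom: "e \<tau> \<le> m * exp (\<kappa> * (\<tau> - a))" if "\<tau> \<in> {a..b}" for \<tau>
    proof -
      have "e \<tau> = (e \<tau> * exp (- \<kappa> * (\<tau> - a))) * exp (\<kappa> * (\<tau> - a))" by (simp add: mult.assoc mult_exp_exp)
      also have "\<dots> \<le> m * exp (\<kappa> * (\<tau> - a))" using smax[OF that] by (simp add: m_def)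
      finally show ?thesis .
    qed
    have "e s \<le> A + m * volterra a b K (\<lambda>\<tau>. exp (\<kappa> * (\<tau> - a))) s" using sub \<kappa> m0 s dom unfolding exp_subsolution_def by blast
    also have "\<dots> \<le> A + m * ((1/2) * exp (\<kappa> * (s - a)))"
      using w[OF ab(2) s] m0 by (intro add_left_mono mult_left_mono)
    finally have "m \<le> (A + m * ((1/2) * exp (\<kappa> * (s - a)))) * exp (- \<kappa> * (s - a))"
      unfolding m_def by simp
    also have "\<dots> = A * exp (- \<kappa> * (s - a)) + m / 2" by (simp add: algebra_simps mult_exp_exp)
    also have "\<dots> \<le> A + m / 2" using A \<kappa> s by (intro add_right_mono mult_left_le) auto
    finally have "m \<le> 2 * A" by simp
    then have "e t \<le> (2 * A) * exp (\<kappa> * (t - a))"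
      using dom[OF t] by (meson exp_ge_zero mult_right_mono order_trans)
    also have "\<dots> \<le> (2 * A) * exp (\<kappa> * \<bar>T\<bar>)"
      using A \<kappa> t ab by (intro mult_left_mono) auto
    finally show "e t \<le> 2 * exp (\<kappa> * \<bar>T\<bar>) * A" by (simp add: mult_ac)
  qed simp
  then show thesis by (rule that[rotated]) simp
qed

lemma volterra_exp_subsolution:
  assumes K: "vkernel K" and e: "continuous_on {a..b} e"
    and ineq: "\<And>t. t \<in> {a..b} \<Longrightarrow> e t \<le> A + volterra a b K e t"
  shows "exp_subsolution a b K A e"
  unfolding exp_subsolution_def
proof (intro allI impI ballI)
  fix m \<kappa> t :: real assume "0 < \<kappa>" "0 \<le> m" and t: "t \<in> {a..b}" and dom: "\<forall>\<tau>\<in>{a..b}. e \<tau> \<le> m * exp (\<kappa> * (\<tau> - a))"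
  obtain M1 where M1: "bmeas a b M1 e" using bmeas_continuous[OF e] by blast
  obtain M2 where M2: "bmeas a b M2 (\<lambda>\<tau>. m * exp (\<kappa> * (\<tau> - a)))"
    by (rule bmeas_continuous[of a b "\<lambda>\<tau>. m * exp (\<kappa> * (\<tau> - a))"]) (auto intro!: continuous_intros)
  have "volterra a b K e t \<le> volterra a b K (\<lambda>\<tau>. m * exp (\<kappa> * (\<tau> - a))) t"
    by (rule volterra_mono[OF K M1 M2]) (use dom in blast)
  then show "e t \<le> A + m * volterra a b K (\<lambda>\<tau>. exp (\<kappa> * (\<tau> - a))) t"
    using ineq[OF t] by (simp add: volterra_cmul)
qed

lemma bmeas_nonneg: "bmeas a b M \<phi> \<Longrightarrow> a \<le> b \<Longrightarrow> 0 \<le> M"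
  unfolding bmeas_def by (meson atLeastAtMost_iff norm_ge_zero order_refl order_trans)

lemma bmeas_subinterval: "bmeas a b M \<phi> \<Longrightarrow> {a'..b'} \<subseteq> {a..b} \<Longrightarrow> bmeas a' b' M \<phi>"
  unfolding bmeas_def using measurable_restrict_mono by blast

lemma bmeas_integrable_on: "bmeas a b M \<phi> \<Longrightarrow> \<phi> integrable_on {a..b}"
  using bmeas_integrable set_lebesgue_integral_eq_integral(1) by blast

lemma integral_lipschitz:
  fixes \<phi> :: "real \<Rightarrow> 'b::euclidean_space"
  assumes \<phi>: "bmeas a b M \<phi>" and s: "s \<in> {a..b}" and t: "t \<in> {a..b}"
  shows "norm (integral {a..t} \<phi> - integral {a..s} \<phi>) \<le> M * \<bar>t - s\<bar>"
proof -
  have main: "norm (integral {a..t} \<phi> - integral {a..s} \<phi>) \<le> M * (t - s)"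
    if st: "s \<le> t" "a \<le> s" "t \<le> b" for s t
  proof -
    have "integral {a..s} \<phi> + integral {s..t} \<phi> = integral {a..t} \<phi>"
      by (rule Henstock_Kurzweil_Integration.integral_combine)
         (use st bmeas_integrable_on[OF bmeas_subinterval[OF \<phi>]] in auto)
    then have "integral {a..t} \<phi> - integral {a..s} \<phi> = integral {s..t} \<phi>" by (simp add: algebra_simps)
    also have "norm \<dots> \<le> integral {s..t} (\<lambda>_. M)"
      by (rule integral_norm_bound_integral)
         (use st \<phi> bmeas_integrable_on[OF bmeas_subinterval[OF \<phi>]] in \<open>auto simp: bmeas_def\<close>)
    finally show ?thesis using st by (simp add: mult.commute)
  qed
  show ?thesis
  proof (cases "s \<le> t")
    case True
    then show ?thesis using main[of s t] s t by simp
  next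
    case False
    then show ?thesis using main[of t s] s t by (simp add: norm_minus_commute)
  qed
qed

lemma bmeas_indicator:
  assumes \<phi>: "bmeas a b M \<phi>" and S: "S \<in> sets borel"
  shows "bmeas a b M (\<lambda>\<tau>. indicator S \<tau> *\<^sub>R \<phi> \<tau>)"
proof -
  have "S \<in> sets lebesgue" using S by (simp add: sets_completionI_sets)
  then have "(indicator S :: real \<Rightarrow> real) \<in> borel_measurable (lebesgue_on {a..b})"
    by (intro measurable_restrict_space1 borel_measurable_indicator)
  moreover have "norm (indicator S t *\<^sub>R \<phi> t) \<le> M" if "t \<in> {a..b}" for t
    using \<phi> that bmeas_nonneg[OF \<phi>] by (auto simp: indicator_def bmeas_def)
  ultimately show ?thesis using \<phi> by (auto simp: bmeas_def)
qed

lemma bmeas_inner: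
  assumes \<phi>: "bmeas a b M \<phi>" and \<psi>: "bmeas a b M' \<psi>"
  shows "bmeas a b (M * M') (\<lambda>\<tau>. \<phi> \<tau> \<bullet> \<psi> \<tau>)"
proof -
  have "\<bar>\<phi> t \<bullet> \<psi> t\<bar> \<le> M * M'" if "t \<in> {a..b}" for t
  proof -
    have "\<bar>\<phi> t \<bullet> \<psi> t\<bar> \<le> norm (\<phi> t) * norm (\<psi> t)" by (rule Cauchy_Schwarz_ineq2)
    also have "\<dots> \<le> M * M'" using \<phi> \<psi> that by (intro mult_mono) (auto simp: bmeas_def intro: order_trans[OF norm_ge_zero])
    finally show ?thesis .
  qed
  then show ?thesis using \<phi> \<psi> by (auto simp: bmeas_def intro!: borel_measurable_inner)
qed

lemma mass_small:
  assumes K: "vkernel K" and e: "0 < e"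
  obtains d where "0 < d" "\<And>u. 0 \<le> u \<Longrightarrow> u < d \<Longrightarrow> mass K u < e"
proof -
  have "continuous_on {0..1} (mass K)"
    unfolding mass_def by (rule indefinite_integral_continuous_1[OF kernel_integrable[OF K]])
  then obtain d where "0 < d" "\<And>u. u \<in> {0..1} \<Longrightarrow> dist u 0 < d \<Longrightarrow> dist (mass K u) (mass K 0) < e"
    unfolding continuous_on_iff using e by (metis atLeastAtMost_iff order_refl zero_le_one)
  then show thesis
    by (intro that[of "min d 1"]) (auto simp: dist_real_def mass_def abs_less_iff)
qed

lemma volterra_continuous:
  fixes \<phi> :: "real \<Rightarrow> 'b::euclidean_space"
  assumes K: "vkernel K" and anti: "\<And>u v. 0 < u \<Longrightarrow> u \<le> v \<Longrightarrow> K v \<le> K u" and \<phi>: "bmeas a b M \<phi>"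
  shows "continuous_on {a..b} (volterra a b K \<phi>)"
proof (cases "a \<le> b")
  case True
  then have M: "0 \<le> M" using bmeas_nonneg[OF \<phi>] by simp
  show ?thesis
    unfolding continuous_on_iff
  proof (intro ballI allI impI)
    fix t e assume t: "t \<in> {a..b}" and e: "0 < (e::real)"
    obtain d where d: "0 < d" "\<And>u. 0 \<le> u \<Longrightarrow> u < d \<Longrightarrow> mass K u < e / (2 * M + 1)"
      using mass_small[OF K, of "e / (2 * M + 1)"] e M by auto
    have "dist (volterra a b K \<phi> s) (volterra a b K \<phi> t) < e" if s: "s \<in> {a..b}" "dist s t < d" for s
    proof -
      have "dist (volterra a b K \<phi> s) (volterra a b K \<phi> t) \<le> 2 * M * mass K \<bar>s - t\<bar>"
        unfolding dist_norm by (rule volterra_modulus[OF K anti \<phi> t s(1) M])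
      also have "\<dots> \<le> (2 * M + 1) * mass K \<bar>s - t\<bar>"
        by (intro mult_right_mono mass_nonneg[OF K]) simp
      also have "\<dots> < e"
        using d(2)[of "\<bar>s - t\<bar>"] s(2) M by (simp add: dist_real_def field_simps)
      finally show ?thesis .
    qed
    then show "\<exists>d>0. \<forall>s\<in>{a..b}. dist s t < d \<longrightarrow> dist (volterra a b K \<phi> s) (volterra a b K \<phi> t) < e"
      using d(1) by blast
  qed
qed simp

lemma volterra_bmeas:
  fixes \<phi> :: "real \<Rightarrow> 'b::euclidean_space"
  assumes K: "vkernel K" and anti: "\<And>u v. 0 < u \<Longrightarrow> u \<le> v \<Longrightarrow> K v \<le> K u" and \<phi>: "bmeas a b M \<phi>"
  shows "bmeas a b (mass K (b - a) * M) (volterra a b K \<phi>)"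
  unfolding bmeas_def
proof (intro conjI ballI)
  show "volterra a b K \<phi> \<in> borel_measurable (lebesgue_on {a..b})"
    by (intro continuous_imp_measurable_on_sets_lebesgue volterra_continuous[OF assms]) auto
  fix t assume t: "t \<in> {a..b}"
  have "norm (volterra a b K \<phi> t) \<le> mass K (t - a) * M" by (rule volterra_norm_mass[OF K \<phi> t])
  also have "\<dots> \<le> mass K (b - a) * M"
    using t bmeas_nonneg[OF \<phi>] by (intro mult_right_mono mass_mono[OF K]) auto
  finally show "norm (volterra a b K \<phi> t) \<le> mass K (b - a) * M" .
qed

lemma volterra_at_start: "vkernel K \<Longrightarrow> volterra a b K \<phi> a = 0"
  unfolding volterra_def by (rule trans[OF integral_cong[of _ _ "\<lambda>_. 0"]]) (auto simp: kernel_zero)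

lemma bmeas_spike:
  fixes \<phi> :: "real \<Rightarrow> 'b::euclidean_space"
  assumes \<phi>: "\<phi> \<in> borel_measurable (lebesgue_on {a..b})" and N: "negligible N"
    and le: "\<And>t. t \<in> {a..b} - N \<Longrightarrow> norm (\<phi> t) \<le> M" and M: "0 \<le> M"
  shows "bmeas a b M (\<lambda>t. if t \<in> N then 0 else \<phi> t)"
proof -
  have "N \<in> sets lebesgue" using N by (rule negligible_imp_sets)
  then have "(\<lambda>t. if t \<in> N then 0 else \<phi> t) \<in> borel_measurable (lebesgue_on {a..b})"
    using \<phi> by (intro measurable_If_set) (auto simp: sets_restrict_space_iff)
  then show ?thesis using le M by (auto simp: bmeas_def)
qed

lemma volterra_spike:
  assumes "negligible N" "\<And>\<tau>. \<tau> \<in> {a..b} - N \<Longrightarrow> \<phi> \<tau> = \<psi> \<tau>"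
  shows "volterra a b K \<phi> t = volterra a b K \<psi> t"
  unfolding volterra_def by (rule integral_spike[OF assms(1)]) (use assms(2) in auto)

section \<open>Grunwald-Letnikov and Riemann-Liouville kernels\<close>

text \<open>
  The coefficients of the power series of \<open>(1 - z) powr (- \<beta>)\<close>.
\<close>

definition gl_weight :: "real \<Rightarrow> nat \<Rightarrow> real" where
  "gl_weight \<beta> k = (- 1) ^ k * ((- \<beta>) gchoose k)"

definition power_kernel :: "real \<Rightarrow> real \<Rightarrow> real" where
  "power_kernel \<beta> \<tau> = (if \<tau> \<le> 0 then 0 else \<tau> powr (\<beta> - 1))"

definition rl_kernel :: "real \<Rightarrow> real \<Rightarrow> real" where
  "rl_kernel \<beta> \<tau> = power_kernel \<beta> \<tau> / Gamma \<beta>"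

text \<open>
  The step function that takes the place of \<open>rl_kernel \<beta>\<close> when integrals of order \<open>\<beta>\<close> are replaced by
  differences with step \<open>h\<close>, see \<open>approx_state_eq_volterra\<close>.
\<close>

definition gl_kernel :: "real \<Rightarrow> real \<Rightarrow> real \<Rightarrow> real" where
  "gl_kernel \<beta> h \<tau> = (if \<tau> \<le> 0 then 0 else h powr (\<beta> - 1) * gl_weight \<beta> (nat \<lfloor>\<tau> / h\<rfloor>))"

lemma gl_weight_0 [simp]: "gl_weight \<beta> 0 = 1"
  by (simp add: gl_weight_def)

lemma gl_weight_Suc: "gl_weight \<beta> (Suc k) = gl_weight \<beta> k * ((real k + \<beta>) / (real k + 1))"
proof -
  have "((- \<beta>) gchoose Suc k) = ((- \<beta>) gchoose k) * ((- \<beta> - real k) / (real k + 1))"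
    by (simp add: gbinomial_prod_rev field_simps)
  then have "gl_weight \<beta> (Suc k) = (- 1) ^ k * ((- \<beta>) gchoose k) * (- ((- \<beta> - real k) / (real k + 1)))"
    by (simp add: gl_weight_def)
  also have "- ((- \<beta> - real k) / (real k + 1)) = (real k + \<beta>) / (real k + 1)"
    by (simp add: field_simps)
  finally show ?thesis by (simp add: gl_weight_def)
qed

lemma gl_weight_pos: "0 < \<beta> \<Longrightarrow> 0 < gl_weight \<beta> k"
  by (induction k) (auto simp: gl_weight_Suc)

lemma gl_weight_nonneg: "0 \<le> \<beta> \<Longrightarrow> 0 \<le> gl_weight \<beta> k"
  by (induction k) (auto simp: gl_weight_Suc)

lemma gl_weight_decreasing:
  assumes "0 < \<beta>" "\<beta> \<le> 1" "i \<le> j" shows "gl_weight \<beta> j \<le> gl_weight \<beta> i"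
  using \<open>i \<le> j\<close>
proof (induction j rule: dec_induct)
  case (step n)
  have "gl_weight \<beta> (Suc n) \<le> gl_weight \<beta> n"
    unfolding gl_weight_Suc using assms gl_weight_pos[of \<beta> n] by (intro mult_left_le) (auto simp: field_simps)
  then show ?case using step by simp
qed simp

lemma gl_weight_le_1: "0 < \<beta> \<Longrightarrow> \<beta> \<le> 1 \<Longrightarrow> gl_weight \<beta> k \<le> 1"
  using gl_weight_decreasing[of \<beta> 0 k] by simp

text \<open>
  Multiplying \<open>(1 - z) powr \<beta>\<close> by \<open>1 / (1 - z)\<close> sums its coefficients.
\<close>

lemma gl_weight_sum:
  "(\<Sum>i\<le>n. (- 1) ^ i * (\<beta> gchoose i)) = gl_weight (1 - \<beta>) n"
  using gbinomial_sum_lower_neg[of \<beta> n] by (simp add: gl_weight_def mult.commute)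

text \<open>
  The coefficients of \<open>(1 - z) powr \<beta>\<close>, which are inverse to \<open>gl_weight \<beta>\<close> under convolution. All but the
  first are nonpositive because their partial sums \<open>gl_weight (1 - \<beta>)\<close> decrease; these signs are what
  makes the energy inequality work.
\<close>

lemma gl_inverse_weights:
  assumes "0 < \<beta>" "\<beta> \<le> 1"
  shows "0 < k \<Longrightarrow> (- 1) ^ k * (\<beta> gchoose k) \<le> 0"
    and "(\<Sum>i\<le>n. ((- 1) ^ i * (\<beta> gchoose i)) * gl_weight \<beta> (n - i)) = (if n = 0 then 1 else 0)"
proof -
  show "(- 1) ^ k * (\<beta> gchoose k) \<le> 0" if "0 < k"
  proof -
    obtain m where m: "k = Suc m" using \<open>0 < k\<close> gr0_conv_Suc by blast
    have "(- 1) ^ k * (\<beta> gchoose k) = gl_weight (1 - \<beta>) (Suc m) - gl_weight (1 - \<beta>) m"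
      using gl_weight_sum[where \<beta>=\<beta> and n="Suc m"] gl_weight_sum[where \<beta>=\<beta> and n=m] m by simp
    also have "\<dots> \<le> 0"
    proof -
      have "(real m + (1 - \<beta>)) / (real m + 1) \<le> 1" using assms by (simp add: field_simps)
      then show ?thesis unfolding gl_weight_Suc using mult_left_le[of "(real m + (1 - \<beta>)) / (real m + 1)" "gl_weight (1 - \<beta>) m"]
          gl_weight_nonneg[of "1 - \<beta>" m] assms by simp
    qed
    finally show ?thesis .
  qed
  have "(\<Sum>i\<le>n. ((- 1) ^ i * (\<beta> gchoose i)) * gl_weight \<beta> (n - i)) = (- 1) ^ n * (\<Sum>i\<le>n. (\<beta> gchoose i) * ((- \<beta>) gchoose (n - i)))"
    unfolding sum_distrib_left
  proof (rule sum.cong)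
    fix i assume "i \<in> {..n}"
    then have "(- 1::real) ^ n = (- 1) ^ i * (- 1) ^ (n - i)" by (simp flip: power_add)
    then show "((- 1) ^ i * (\<beta> gchoose i)) * gl_weight \<beta> (n - i) = (- 1) ^ n * ((\<beta> gchoose i) * ((- \<beta>) gchoose (n - i)))"
      by (simp add: gl_weight_def)
  qed simp
  also have "(\<Sum>i\<le>n. (\<beta> gchoose i) * ((- \<beta>) gchoose (n - i))) = (\<beta> + (- \<beta>)) gchoose n"
    using gbinomial_Vandermonde[of \<beta> "- \<beta>" n] by (simp add: atMost_atLeast0)
  also have "(- 1) ^ n * ((\<beta> + (- \<beta>)) gchoose n) = (if n = 0 then 1 else 0)"
    by (cases n) auto
  finally show "(\<Sum>i\<le>n. ((- 1) ^ i * (\<beta> gchoose i)) * gl_weight \<beta> (n - i)) = (if n = 0 then 1 else 0)" .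
qed

lemma gl_weight_asymptotic: "(\<lambda>n. gl_weight \<beta> n * real n powr (1 - \<beta>)) \<longlonglongrightarrow> 1 / Gamma \<beta>"
proof -
  have "(\<lambda>n. ((- \<beta>) gchoose n) / ((-1)^n / exp ((- \<beta>+1) * of_real (ln (real n))))) \<longlonglongrightarrow> inverse (Gamma (- (- \<beta>)))"
    by (rule gbinomial_asymptotic)
  moreover have "eventually (\<lambda>n. ((- \<beta>) gchoose n) / ((-1)^n / exp ((- \<beta>+1) * of_real (ln (real n)))) = gl_weight \<beta> n * real n powr (1 - \<beta>)) sequentially"
    using eventually_gt_at_top[of 0]
  proof eventually_elim
    case (elim n)
    have "x / ((-1)^n / y) = (-1)^n * x * y" if "y \<noteq> 0" for x y :: real
      using that by (cases "even n") auto
    then show ?case using elim by (simp add: gl_weight_def powr_def)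
  qed
  ultimately show ?thesis by (simp add: inverse_eq_divide tendsto_cong)
qed

lemma gl_weight_bound:
  assumes \<beta>: "0 < \<beta>" "\<beta> \<le> 1"
  obtains C where "1 \<le> C" "\<And>n. gl_weight \<beta> n \<le> C * (real n + 1) powr (\<beta> - 1)"
proof -
  obtain B where B: "\<And>n. norm (gl_weight \<beta> n * real n powr (1 - \<beta>)) \<le> B" "0 < B"
    using convergent_imp_Bseq[OF convergentI[OF gl_weight_asymptotic]] by (auto simp: Bseq_def)
  show thesis
  proof (rule that[of "max 1 (2 * B)"])
    fix n
    show "gl_weight \<beta> n \<le> max 1 (2 * B) * (real n + 1) powr (\<beta> - 1)"
    proof (cases "n = 0")
      case False
      have "(real n + 1) powr (1 - \<beta>) \<le> (2 * real n) powr (1 - \<beta>)"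
        by (rule powr_mono2) (use \<beta> False in auto)
      also have "\<dots> = 2 powr (1 - \<beta>) * real n powr (1 - \<beta>)" by (simp add: powr_mult)
      also have "\<dots> \<le> 2 * real n powr (1 - \<beta>)"
        using powr_mono[of "1 - \<beta>" 1 "2::real"] \<beta> by (intro mult_right_mono) auto
      finally have "gl_weight \<beta> n * (real n + 1) powr (1 - \<beta>) \<le> gl_weight \<beta> n * (2 * real n powr (1 - \<beta>))"
        using gl_weight_pos[of \<beta> n] \<beta> by (intro mult_left_mono) auto
      also have "\<dots> \<le> max 1 (2 * B)" using B(1)[of n] by (simp add: max_def abs_le_iff)
      finally have *: "gl_weight \<beta> n * (real n + 1) powr (1 - \<beta>) \<le> max 1 (2 * B)" .
      have "gl_weight \<beta> n = (gl_weight \<beta> n * (real n + 1) powr (1 - \<beta>)) * (real n + 1) powr (\<beta> - 1)"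
        by (simp add: mult.assoc powr_add[symmetric])
      also have "\<dots> \<le> max 1 (2 * B) * (real n + 1) powr (\<beta> - 1)"
        by (rule mult_right_mono[OF *]) simp
      finally show ?thesis .
    qed simp
  qed simp
qed

lemma gl_kernel_nonneg: "0 < \<beta> \<Longrightarrow> 0 \<le> gl_kernel \<beta> h \<tau>"
  unfolding gl_kernel_def using less_imp_le[OF gl_weight_pos[of \<beta>]] by auto

lemma gl_kernel_antimono:
  assumes "0 < \<beta>" "\<beta> \<le> 1" "0 < h" "0 < u" "u \<le> v"
  shows "gl_kernel \<beta> h v \<le> gl_kernel \<beta> h u"
proof -
  have "nat \<lfloor>u / h\<rfloor> \<le> nat \<lfloor>v / h\<rfloor>"
    using assms by (intro nat_mono floor_mono divide_right_mono) auto
  then show ?thesis unfolding gl_kernel_def using assms by (auto intro!: mult_left_mono gl_weight_decreasing)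
qed

text \<open>
  The bound does not depend on the step: the weights decay like \<open>(n + 1) powr (\<beta> - 1)\<close>, and
  \<open>h * (n + 1)\<close> is at least \<open>\<tau>\<close> on the cell with number \<open>n\<close>, so the powers of \<open>h\<close> cancel.
\<close>

lemma gl_kernel_le_power_kernel:
  assumes \<beta>: "0 < \<beta>" "\<beta> \<le> 1"
  obtains C where "1 \<le> C" "\<And>h \<tau>. 0 < h \<Longrightarrow> gl_kernel \<beta> h \<tau> \<le> C * power_kernel \<beta> \<tau>"
proof -
  obtain C where C: "1 \<le> C" "\<And>n. gl_weight \<beta> n \<le> C * (real n + 1) powr (\<beta> - 1)"
    using gl_weight_bound[OF \<beta>] by blast
  show thesis
  proof (rule that[OF C(1)])
    fix h \<tau> :: real assume h: "0 < h"
    show "gl_kernel \<beta> h \<tau> \<le> C * power_kernel \<beta> \<tau>"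
    proof (cases "\<tau> \<le> 0")
      case False
      define n where "n = nat \<lfloor>\<tau> / h\<rfloor>"
      have n: "\<tau> \<le> h * (real n + 1)"
      proof -
        have "0 \<le> \<tau> / h" using False h by simp
        then have "\<tau> / h < real n + 1" unfolding n_def by linarith
        then show ?thesis using h by (simp add: field_simps)
      qed
      have "gl_kernel \<beta> h \<tau> = h powr (\<beta> - 1) * gl_weight \<beta> n" using False by (simp add: gl_kernel_def n_def)
      also have "\<dots> \<le> h powr (\<beta> - 1) * (C * (real n + 1) powr (\<beta> - 1))"
        by (intro mult_left_mono C(2)) simp
      also have "\<dots> = C * (h * (real n + 1)) powr (\<beta> - 1)" using h by (simp add: powr_mult)
      also have "\<dots> \<le> C * \<tau> powr (\<beta> - 1)"
        using C(1) False n \<beta> by (intro mult_left_mono powr_mono2') auto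
      finally show ?thesis using False by (simp add: power_kernel_def)
    qed (simp add: gl_kernel_def power_kernel_def)
  qed
qed

lemma power_kernel_has_integral:
  assumes "0 < \<beta>" "0 \<le> b" shows "(power_kernel \<beta> has_integral b powr \<beta> / \<beta>) {0..b}"
proof -
  have "((\<lambda>x. x powr (\<beta> - 1)) has_integral b powr (\<beta> - 1 + 1) / (\<beta> - 1 + 1)) {0..b}"
    by (rule has_integral_powr_from_0) (use assms in auto)
  moreover have "\<And>x. x \<in> {0..b} \<Longrightarrow> x powr (\<beta> - 1) = power_kernel \<beta> x" by (auto simp: power_kernel_def)
  ultimately have "(power_kernel \<beta> has_integral b powr (\<beta> - 1 + 1) / (\<beta> - 1 + 1)) {0..b}"
    by (rule has_integral_eq[rotated])
  then show ?thesis by simp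
qed

lemma vkernel_power: "0 < \<beta> \<Longrightarrow> vkernel (power_kernel \<beta>)"
  unfolding vkernel_def
proof (intro conjI allI impI)
  fix b :: real assume "0 < \<beta>"
  then show "power_kernel \<beta> integrable_on {0..b}"
    using power_kernel_has_integral[of \<beta> b] by (cases "0 \<le> b") auto
qed (auto simp: power_kernel_def)

lemma vkernel_cmul: "vkernel K \<Longrightarrow> 0 \<le> c \<Longrightarrow> vkernel (\<lambda>\<tau>. c * K \<tau>)"
  unfolding vkernel_def by (auto intro: integrable_on_mult_right)

lemma vkernel_rl: "0 < \<beta> \<Longrightarrow> vkernel (rl_kernel \<beta>)"
  using vkernel_cmul[OF vkernel_power, of \<beta> "1 / Gamma \<beta>"] by (simp add: rl_kernel_def[abs_def] Gamma_real_nonneg)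

lemma vkernel_gl:
  assumes \<beta>: "0 < \<beta>" "\<beta> \<le> 1" and h: "0 < h" shows "vkernel (gl_kernel \<beta> h)"
  unfolding vkernel_def
proof (intro conjI allI impI)
  fix b
  \<comment> \<open>Closing the jump at \<open>0\<close> makes the negative of the kernel monotone, hence integrable.\<close>
  define g where "g \<tau> = (if \<tau> \<le> 0 then - (h powr (\<beta> - 1)) else - gl_kernel \<beta> h \<tau>)" for \<tau>
  have "mono_on {0..b} g"
  proof (rule mono_onI)
    fix r s assume rs: "r \<in> {0..b}" "s \<in> {0..b}" "r \<le> s"
    have "gl_kernel \<beta> h s \<le> h powr (\<beta> - 1)"
      using gl_weight_le_1[OF \<beta>] by (auto simp: gl_kernel_def intro: mult_left_le)
    then show "g r \<le> g s" using rs gl_kernel_antimono[OF \<beta> h, of r s] by (auto simp: g_def)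
  qed
  then have "(\<lambda>\<tau>. - g \<tau>) integrable_on {0..b}" by (intro integrable_neg integrable_on_mono_on)
  then show "gl_kernel \<beta> h integrable_on {0..b}"
    by (rule integrable_spike[of _ _ "{0}"]) (auto simp: g_def)
qed (use gl_kernel_nonneg[OF \<beta>(1)] in \<open>auto simp: gl_kernel_def\<close>)

lemma rl_kernel_le_power_kernel:
  assumes "0 < \<beta>" obtains C where "1 \<le> C" "\<And>\<tau>. rl_kernel \<beta> \<tau> \<le> C * power_kernel \<beta> \<tau>"
proof (rule that[of "max 1 (1 / Gamma \<beta>)"])
  show "rl_kernel \<beta> \<tau> \<le> max 1 (1 / Gamma \<beta>) * power_kernel \<beta> \<tau>" for \<tau>
    using mult_right_mono[of "1 / Gamma \<beta>" "max 1 (1 / Gamma \<beta>)" "power_kernel \<beta> \<tau>"]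
    by (simp add: rl_kernel_def power_kernel_def)
qed simp

lemma rl_kernel_antimono: "0 < \<beta> \<Longrightarrow> \<beta> \<le> 1 \<Longrightarrow> 0 < u \<Longrightarrow> u \<le> v \<Longrightarrow> rl_kernel \<beta> v \<le> rl_kernel \<beta> u"
  unfolding rl_kernel_def power_kernel_def by (auto intro!: divide_right_mono powr_mono2' simp: Gamma_real_nonneg)

lemma rl_kernel_1: "rl_kernel 1 \<tau> = (if \<tau> \<le> 0 then 0 else 1)"
  by (simp add: rl_kernel_def power_kernel_def)

lemma gl_kernel_tendsto_rl_kernel:
  assumes \<beta>: "0 < \<beta>" "\<beta> \<le> 1" and h: "\<And>n. 0 < h n" "h \<longlonglongrightarrow> 0"
  shows "(\<lambda>n. gl_kernel \<beta> (h n) \<tau>) \<longlonglongrightarrow> rl_kernel \<beta> \<tau>"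
proof (cases "\<tau> \<le> 0")
  case False
  then have \<tau>: "0 < \<tau>" by simp
  define k where "k n = nat \<lfloor>\<tau> / h n\<rfloor>" for n
  have k: "real (k n) \<le> \<tau> / h n" "\<tau> / h n < real (k n) + 1" for n
  proof -
    have "0 \<le> \<tau> / h n" using \<tau> h(1)[of n] by simp
    then show "real (k n) \<le> \<tau> / h n" "\<tau> / h n < real (k n) + 1" unfolding k_def by (auto simp: of_nat_nat)
  qed
  have k_inf: "filterlim k sequentially sequentially"
  proof -
    have "filterlim (\<lambda>n. \<tau> / h n) at_top sequentially"
      by (rule LIM_at_top_divide[OF tendsto_const \<tau> h(2)]) (use h in auto)
    then show ?thesis unfolding k_def
      by (rule filterlim_compose[OF filterlim_nat_sequentially filterlim_compose[OF filterlim_floor_sequentially]])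
  qed
  have hk: "(\<lambda>n. h n * real (k n)) \<longlonglongrightarrow> \<tau>"
  proof (rule tendsto_sandwich)
    show "(\<lambda>n. \<tau> - h n) \<longlonglongrightarrow> \<tau>" using tendsto_diff[OF tendsto_const h(2)] by simp
    show "\<forall>\<^sub>F n in sequentially. \<tau> - h n \<le> h n * real (k n)"
    proof (intro always_eventually allI)
      fix n
      have "\<tau> < (real (k n) + 1) * h n" using k(2)[of n] h(1)[of n] by (simp only: pos_divide_less_eq)
      then show "\<tau> - h n \<le> h n * real (k n)" by (simp add: algebra_simps)
    qed
    show "\<forall>\<^sub>F n in sequentially. h n * real (k n) \<le> \<tau>"
      using k(1) h(1) by (intro always_eventually allI) (simp add: field_simps)
  qed simp
  have "(\<lambda>n. (h n * real (k n)) powr (\<beta> - 1) * (gl_weight \<beta> (k n) * real (k n) powr (1 - \<beta>))) \<longlonglongrightarrow> \<tau> powr (\<beta> - 1) * (1 / Gamma \<beta>)"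
    by (intro tendsto_mult tendsto_powr hk tendsto_const filterlim_compose[OF gl_weight_asymptotic k_inf]) (use \<tau> in auto)
  moreover have "\<forall>\<^sub>F n in sequentially. (h n * real (k n)) powr (\<beta> - 1) * (gl_weight \<beta> (k n) * real (k n) powr (1 - \<beta>)) = gl_kernel \<beta> (h n) \<tau>"
    using filterlim_at_top[THEN iffD1, OF k_inf, rule_format, of 1]
  proof eventually_elim
    case (elim n)
    have "real (k n) powr (\<beta> - 1) * real (k n) powr (1 - \<beta>) = 1"
      using elim by (simp add: powr_add[symmetric])
    then show ?case using h(1)[of n] \<tau> elim by (simp add: gl_kernel_def powr_mult k_def[symmetric])
  qed
  ultimately have "(\<lambda>n. gl_kernel \<beta> (h n) \<tau>) \<longlonglongrightarrow> \<tau> powr (\<beta> - 1) * (1 / Gamma \<beta>)"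
    by (rule Lim_transform_eventually)
  then show ?thesis using False by (simp add: rl_kernel_def power_kernel_def)
qed (simp add: gl_kernel_def rl_kernel_def power_kernel_def)

text \<open>
  Dominated convergence: pointwise convergence comes from the asymptotics of the weights, and the
  majorant from the bound that is uniform in the step.
\<close>

lemma gl_kernel_L1_convergence_seq:
  assumes \<beta>: "0 < \<beta>" "\<beta> \<le> 1" and h: "\<And>n. 0 < h n" "h \<longlonglongrightarrow> 0"
  shows "(\<lambda>n. integral {0..T} (\<lambda>u. \<bar>gl_kernel \<beta> (h n) u - rl_kernel \<beta> u\<bar>)) \<longlonglongrightarrow> 0"
proof -
  obtain C where C: "1 \<le> C" "\<And>h \<tau>. 0 < h \<Longrightarrow> gl_kernel \<beta> h \<tau> \<le> C * power_kernel \<beta> \<tau>" using gl_kernel_le_power_kernel[OF \<beta>] by blast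
  obtain C' where C': "1 \<le> C'" "\<And>\<tau>. rl_kernel \<beta> \<tau> \<le> C' * power_kernel \<beta> \<tau>" using rl_kernel_le_power_kernel[OF \<beta>(1)] by blast
  have ai: "(\<lambda>u. gl_kernel \<beta> (h n) u - rl_kernel \<beta> u) absolutely_integrable_on {0..T}" for n
    by (intro set_integral_diff nonnegative_absolutely_integrable_1 kernel_integrable vkernel_gl vkernel_rl kernel_nonneg)
       (use \<beta> h in auto)
  have "(\<lambda>n. integral {0..T} (\<lambda>u. \<bar>gl_kernel \<beta> (h n) u - rl_kernel \<beta> u\<bar>)) \<longlonglongrightarrow> integral {0..T} (\<lambda>_. 0)"
  proof (rule dominated_convergence(2)[where h="\<lambda>u. (C + C') * power_kernel \<beta> u"])
    show "(\<lambda>u. \<bar>gl_kernel \<beta> (h n) u - rl_kernel \<beta> u\<bar>) integrable_on {0..T}" for n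
      using ai[of n] unfolding absolutely_integrable_on_def by simp
    show "(\<lambda>u. (C + C') * power_kernel \<beta> u) integrable_on {0..T}"
      by (intro integrable_on_mult_right kernel_integrable vkernel_power \<beta>)
    show "norm \<bar>gl_kernel \<beta> (h n) u - rl_kernel \<beta> u\<bar> \<le> (C + C') * power_kernel \<beta> u" for n u
      using C(2)[OF h(1), of n u] C'(2)[of u] kernel_nonneg[OF vkernel_gl[OF \<beta> h(1)], of n u]
        kernel_nonneg[OF vkernel_rl[OF \<beta>(1)], of u] by (simp add: distrib_right abs_le_iff)
    show "(\<lambda>n. \<bar>gl_kernel \<beta> (h n) u - rl_kernel \<beta> u\<bar>) \<longlonglongrightarrow> 0" for u
      using tendsto_rabs[OF LIM_zero[OF gl_kernel_tendsto_rl_kernel[OF \<beta> h, of u]]] by simp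
  qed
  then show ?thesis by simp
qed

lemma gl_kernel_L1_convergence:
  assumes \<beta>: "0 < \<beta>" "\<beta> \<le> 1" and e: "0 < e"
  obtains h0 where "0 < h0" "\<And>h. 0 < h \<Longrightarrow> h < h0 \<Longrightarrow> integral {0..T} (\<lambda>u. \<bar>gl_kernel \<beta> h u - rl_kernel \<beta> u\<bar>) < e"
proof (rule ccontr)
  assume "\<not> thesis"
  then have "\<forall>n. \<exists>h. 0 < h \<and> h < inverse (real (Suc n)) \<and> \<not> integral {0..T} (\<lambda>u. \<bar>gl_kernel \<beta> h u - rl_kernel \<beta> u\<bar>) < e"
    using that by (metis inverse_positive_iff_positive of_nat_0_less_iff zero_less_Suc)
  then obtain h where h: "\<And>n. 0 < h n" "\<And>n. h n < inverse (real (Suc n))"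
    "\<And>n. \<not> integral {0..T} (\<lambda>u. \<bar>gl_kernel \<beta> (h n) u - rl_kernel \<beta> u\<bar>) < e" by metis
  have "h \<longlonglongrightarrow> 0"
    by (rule tendsto_sandwich[OF _ _ tendsto_const LIMSEQ_inverse_real_of_nat])
       (use h in \<open>auto intro!: always_eventually less_imp_le\<close>)
  from order_tendstoD(2)[OF gl_kernel_L1_convergence_seq[OF \<beta> h(1) this, of T] e] h(3)
  show False by (auto simp: eventually_sequentially)
qed

section \<open>The energy inequality\<close>

text \<open>
  With the inverse weights \<open>c\<close>, where \<open>c 0 = 1\<close> and all others are nonpositive, \<open>a m\<close> is the convolution of
  \<open>c\<close> and \<open>S\<close>. The inequality \<open>2 * (u \<bullet> v) \<le> \<parallel>u\<parallel>\<^sup>2 + \<parallel>v\<parallel>\<^sup>2\<close>, multiplied by these nonpositive coefficients,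
  and the nonnegativity of the partial sums of \<open>c\<close> show that the convolution of \<open>c\<close> with \<open>\<parallel>S\<parallel>\<^sup>2\<close> is at
  most \<open>2 * (S m \<bullet> a m)\<close>. Convolving with the nonnegative weights inverts \<open>c\<close> and gives the claim.
\<close>

lemma discrete_energy:
  fixes a :: "nat \<Rightarrow> 'b::real_inner"
  assumes \<beta>: "0 < \<beta>" "\<beta> \<le> 1"
  defines "S n \<equiv> (\<Sum>i\<le>n. gl_weight \<beta> (n - i) *\<^sub>R a i)"
  shows "(norm (S n))\<^sup>2 \<le> 2 * (\<Sum>i\<le>n. gl_weight \<beta> (n - i) * (S i \<bullet> a i))"
proof -
  define c where "c k = (- 1) ^ k * (\<beta> gchoose k)" for k
  define W C where "W = Abs_fps (gl_weight \<beta>)" and "C = Abs_fps c"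
  have CW: "C * W = 1"
    by (rule fps_ext) (use gl_inverse_weights(2)[OF \<beta>] in \<open>simp add: fps_mult_nth C_def W_def c_def atLeast0AtMost\<close>)
  have c0: "c 0 = 1" by (simp add: c_def)
  have cneg: "c k \<le> 0" if "0 < k" for k using gl_inverse_weights(1)[OF \<beta> that] by (simp add: c_def)
  have csum: "0 \<le> (\<Sum>i\<le>n. c i)" for n unfolding c_def gl_weight_sum using \<beta> by (intro gl_weight_nonneg) simp
  have deconv: "a m \<bullet> e = (\<Sum>i\<le>m. c i * (S (m - i) \<bullet> e))" for m e
  proof -
    define A where "A = Abs_fps (\<lambda>n. a n \<bullet> e)"
    have "W * A = Abs_fps (\<lambda>n. S n \<bullet> e)"
    proof (rule fps_ext)
      fix k
      have "fps_nth (W * A) k = (\<Sum>i\<le>k. gl_weight \<beta> i * (a (k - i) \<bullet> e))"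
        by (simp add: fps_mult_nth W_def A_def atLeast0AtMost)
      also have "\<dots> = (\<Sum>i\<le>k. gl_weight \<beta> (k - i) * (a i \<bullet> e))"
        by (rule sum.reindex_bij_witness[of _ "\<lambda>i. k - i" "\<lambda>i. k - i"]) auto
      finally show "fps_nth (W * A) k = fps_nth (Abs_fps (\<lambda>n. S n \<bullet> e)) k"
        by (simp add: S_def inner_sum_left)
    qed
    then have "C * Abs_fps (\<lambda>n. S n \<bullet> e) = (C * W) * A" by (simp only: mult.assoc)
    then have "C * Abs_fps (\<lambda>n. S n \<bullet> e) = A" using CW by simp
    then have "fps_nth (C * Abs_fps (\<lambda>n. S n \<bullet> e)) m = fps_nth A m" by simp
    then show ?thesis by (simp add: fps_mult_nth C_def A_def atLeast0AtMost)
  qed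
  define E where "E m = (\<Sum>i\<le>m. c i * (norm (S (m - i)))\<^sup>2)" for m
  have step: "E m \<le> 2 * (S m \<bullet> a m)" for m
  proof -
    have split: "(\<Sum>i\<le>m. f i) = f 0 + (\<Sum>i\<in>{1..m}. f i)" for f :: "nat \<Rightarrow> real"
      using sum.atLeast_Suc_atMost[of 0 m f] by (simp add: atLeast0AtMost)
    have "2 * (S m \<bullet> a m) = 2 * (norm (S m))\<^sup>2 + (\<Sum>i\<in>{1..m}. 2 * (c i * (S (m - i) \<bullet> S m)))"
      using deconv[of m "S m"] by (simp add: split c0 sum_distrib_left power2_norm_eq_inner inner_commute)
    also have "\<dots> \<ge> 2 * (norm (S m))\<^sup>2 + (\<Sum>i\<in>{1..m}. c i * ((norm (S m))\<^sup>2 + (norm (S (m - i)))\<^sup>2))"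
    proof (intro add_left_mono sum_mono)
      fix i assume i: "i \<in> {1..m}"
      have "0 \<le> (norm (S (m - i) - S m))\<^sup>2" by simp
      then have "2 * (S (m - i) \<bullet> S m) \<le> (norm (S m))\<^sup>2 + (norm (S (m - i)))\<^sup>2"
        by (simp add: power2_norm_eq_inner inner_diff_left inner_diff_right inner_commute)
      then have "c i * (2 * (S (m - i) \<bullet> S m)) \<ge> c i * ((norm (S m))\<^sup>2 + (norm (S (m - i)))\<^sup>2)"
        using cneg[of i] i by (intro mult_left_mono_neg) auto
      then show "c i * ((norm (S m))\<^sup>2 + (norm (S (m - i)))\<^sup>2) \<le> 2 * (c i * (S (m - i) \<bullet> S m))" by simp
    qed
    also have "2 * (norm (S m))\<^sup>2 + (\<Sum>i\<in>{1..m}. c i * ((norm (S m))\<^sup>2 + (norm (S (m - i)))\<^sup>2))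
       = E m + (\<Sum>i\<le>m. c i) * (norm (S m))\<^sup>2"
      by (simp add: E_def split c0 distrib_left sum.distrib distrib_right sum_distrib_right)
    finally show ?thesis using csum[of m] by (smt (verit) mult_nonneg_nonneg zero_le_power2)
  qed
  have "W * Abs_fps E = Abs_fps (\<lambda>m. (norm (S m))\<^sup>2)"
  proof -
    have "Abs_fps E = C * Abs_fps (\<lambda>m. (norm (S m))\<^sup>2)"
      by (rule fps_ext) (simp add: fps_mult_nth C_def E_def atLeast0AtMost)
    then have "W * Abs_fps E = (C * W) * Abs_fps (\<lambda>m. (norm (S m))\<^sup>2)" by (simp add: mult_ac)
    then show ?thesis using CW by simp
  qed
  then have "fps_nth (W * Abs_fps E) n = (norm (S n))\<^sup>2" by simp
  then have "(norm (S n))\<^sup>2 = (\<Sum>i\<le>n. gl_weight \<beta> i * E (n - i))" by (simp add: fps_mult_nth W_def atLeast0AtMost)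
  also have "\<dots> = (\<Sum>i\<le>n. gl_weight \<beta> (n - i) * E i)"
    by (rule sum.reindex_bij_witness[of _ "\<lambda>i. n - i" "\<lambda>i. n - i"]) auto
  also have "\<dots> \<le> (\<Sum>i\<le>n. gl_weight \<beta> (n - i) * (2 * (S i \<bullet> a i)))"
    using gl_weight_nonneg[of \<beta>] \<beta> by (intro sum_mono mult_left_mono step) auto
  finally show ?thesis by (simp add: sum_distrib_left mult_ac)
qed

text \<open>
  Divide \<open>{a..t}\<close> from \<open>t\<close> backwards into cells of length \<open>d\<close>. At the points \<open>t - m * d\<close> the convolution with
  the step kernel is a finite convolution of the weights with the integrals of \<open>\<phi>\<close> over the cells, so
  the discrete inequality applies. On its right-hand side the convolution appears at the grid point
  next to \<open>\<tau>\<close> instead of \<open>\<tau>\<close> itself; \<open>g\<close> absorbs this difference.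
\<close>

lemma gl_energy:
  fixes \<phi> :: "real \<Rightarrow> 'b::euclidean_space"
  assumes \<beta>: "0 < \<beta>" "\<beta> \<le> 1" and \<phi>: "bmeas a b M \<phi>" and t: "t \<in> {a..b}" and d: "0 < d"
    and g: "bmeas a b M' g"
    and near: "\<And>\<tau> j. \<tau> \<in> {a..b} \<Longrightarrow> \<tau> < t \<Longrightarrow> j = nat \<lfloor>(t - \<tau>) / d\<rfloor> \<Longrightarrow>
       volterra a b (gl_kernel \<beta> d) \<phi> (t - real j * d) \<bullet> \<phi> \<tau> \<le> g \<tau>"
  shows "(norm (volterra a b (gl_kernel \<beta> d) \<phi> t))\<^sup>2 \<le> 2 * volterra a b (gl_kernel \<beta> d) g t"
proof -
  \<comment> \<open>\<open>J \<tau>\<close> is the number of the cell of \<open>\<tau>\<close>, counted backwards from \<open>t\<close>, and \<open>n\<close> is that of \<open>a\<close>.\<close>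
  define n where "n = nat \<lfloor>(t - a) / d\<rfloor>"
  define J where "J \<tau> = nat \<lfloor>(t - \<tau>) / d\<rfloor>" for \<tau>
  define I where "I j = {\<tau>. \<tau> < t \<and> J \<tau> = j}" for j
  define G where "G j = integral {a..b} (\<lambda>\<tau>. indicator (I j) \<tau> *\<^sub>R \<phi> \<tau>)" for j
  define H where "H = d powr (\<beta> - 1)"
  have H: "0 < H" using d by (simp add: H_def)
  have I_borel: "I j \<in> sets borel" for j
    unfolding I_def J_def by measurable
  have bI: "bmeas a b M (\<lambda>\<tau>. indicator (I j) \<tau> *\<^sub>R \<phi> \<tau>)" for j by (rule bmeas_indicator[OF \<phi> I_borel])
  have iI: "(\<lambda>\<tau>. indicator (I j) \<tau> *\<^sub>R \<phi> \<tau>) integrable_on {a..b}" for j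
    using bmeas_integrable[OF bI[of j]] set_lebesgue_integral_eq_integral(1) by blast
  have J_le: "J \<tau> \<le> n" if "a \<le> \<tau>" for \<tau>
    unfolding J_def n_def using that d by (intro nat_mono floor_mono divide_right_mono) auto
  have J_iff: "m \<le> J \<tau> \<longleftrightarrow> \<tau> \<le> t - real m * d" if "\<tau> < t" for m \<tau>
  proof -
    have "m \<le> J \<tau> \<longleftrightarrow> real m \<le> (t - \<tau>) / d"
      unfolding J_def using that d by (simp add: le_nat_iff le_floor_iff)
    also have "\<dots> \<longleftrightarrow> \<tau> \<le> t - real m * d" using d by (simp add: field_simps)
    finally show ?thesis .
  qed
  have rep: "volterra a b (gl_kernel \<beta> d) \<phi> (t - real m * d) = H *\<^sub>R (\<Sum>j\<in>{m..n}. gl_weight \<beta> (j - m) *\<^sub>R G j)" for m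
  proof -
    have "volterra a b (gl_kernel \<beta> d) \<phi> (t - real m * d)
        = integral {a..b} (\<lambda>\<tau>. \<Sum>j\<in>{m..n}. (H * gl_weight \<beta> (j - m)) *\<^sub>R (indicator (I j) \<tau> *\<^sub>R \<phi> \<tau>))"
      unfolding volterra_def
    proof (rule integral_spike[of "{t - real m * d}"])
      fix \<tau> assume "\<tau> \<in> {a..b} - {t - real m * d}"
      then have \<tau>: "a \<le> \<tau>" "\<tau> \<noteq> t - real m * d" by auto
      show "(\<Sum>j\<in>{m..n}. (H * gl_weight \<beta> (j - m)) *\<^sub>R (indicator (I j) \<tau> *\<^sub>R \<phi> \<tau>)) = gl_kernel \<beta> d (t - real m * d - \<tau>) *\<^sub>R \<phi> \<tau>"
      proof (cases "\<tau> < t - real m * d")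
        case True
        then have \<tau>t: "\<tau> < t" using d by (smt (verit) mult_nonneg_nonneg of_nat_0_le_iff)
        have mJ: "m \<le> J \<tau>" using J_iff[OF \<tau>t, of m] True by simp
        have "(t - real m * d - \<tau>) / d = (t - \<tau>) / d - real m" using d by (simp add: field_simps)
        then have "nat \<lfloor>(t - real m * d - \<tau>) / d\<rfloor> = J \<tau> - m"
          using floor_diff_of_int[of "(t - \<tau>) / d" "int m"] by (simp add: J_def nat_diff_distrib')
        then have "gl_kernel \<beta> d (t - real m * d - \<tau>) = H * gl_weight \<beta> (J \<tau> - m)"
          using True by (simp add: gl_kernel_def H_def)
        moreover have "(\<Sum>j\<in>{m..n}. (H * gl_weight \<beta> (j - m)) *\<^sub>R (indicator (I j) \<tau> *\<^sub>R \<phi> \<tau>))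
            = (\<Sum>j\<in>{J \<tau>}. (H * gl_weight \<beta> (j - m)) *\<^sub>R (indicator (I j) \<tau> *\<^sub>R \<phi> \<tau>))"
          by (rule sum.mono_neutral_right) (use mJ J_le[OF \<tau>(1)] in \<open>auto simp: I_def\<close>)
        ultimately show ?thesis using \<tau>t by (simp add: I_def)
      next
        case False
        then have "\<tau> \<notin> I j" if "m \<le> j" for j
          using J_iff[of \<tau> m] \<tau>(2) that by (auto simp: I_def)
        then have "(\<Sum>j\<in>{m..n}. (H * gl_weight \<beta> (j - m)) *\<^sub>R (indicator (I j) \<tau> *\<^sub>R \<phi> \<tau>)) = 0"
          by (intro sum.neutral) auto
        then show ?thesis using False by (simp add: gl_kernel_def)
      qed
    qed simp
    also have "\<dots> = (\<Sum>j\<in>{m..n}. integral {a..b} (\<lambda>\<tau>. (H * gl_weight \<beta> (j - m)) *\<^sub>R (indicator (I j) \<tau> *\<^sub>R \<phi> \<tau>)))"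
      by (rule Henstock_Kurzweil_Integration.integral_sum) (auto intro!: integrable_cmul iI simp del: scaleR_scaleR)
    also have "\<dots> = (\<Sum>j\<in>{m..n}. (H * gl_weight \<beta> (j - m)) *\<^sub>R G j)"
      by (simp only: integral_cmul G_def)
    finally show ?thesis by (simp add: scaleR_sum_right)
  qed
  \<comment> \<open>The discrete inequality runs forward in time, hence the reversed numbering.\<close>
  define a' where "a' i = G (n - i)" for i
  define S where "S m = (\<Sum>i\<le>m. gl_weight \<beta> (m - i) *\<^sub>R a' i)" for m
  have S: "H *\<^sub>R S m = volterra a b (gl_kernel \<beta> d) \<phi> (t - real (n - m) * d)" if "m \<le> n" for m
  proof -
    have "S m = (\<Sum>j\<in>{n - m..n}. gl_weight \<beta> (j - (n - m)) *\<^sub>R G j)"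
      unfolding S_def a'_def
      by (rule sum.reindex_bij_witness[of _ "\<lambda>j. n - j" "\<lambda>i. n - i"]) (use that in auto)
    then show ?thesis by (simp add: rep)
  qed
  have "(norm (S n))\<^sup>2 \<le> 2 * (\<Sum>i\<le>n. gl_weight \<beta> (n - i) * (S i \<bullet> a' i))"
    unfolding S_def by (rule discrete_energy[OF \<beta>])
  then have "H\<^sup>2 * (norm (S n))\<^sup>2 \<le> H\<^sup>2 * (2 * (\<Sum>i\<le>n. gl_weight \<beta> (n - i) * (S i \<bullet> a' i)))"
    by (rule mult_left_mono) simp
  then have "(norm (H *\<^sub>R S n))\<^sup>2 \<le> 2 * (\<Sum>i\<le>n. H * gl_weight \<beta> (n - i) * ((H *\<^sub>R S i) \<bullet> a' i))"
    using H by (simp add: power_mult_distrib power2_eq_square sum_distrib_left mult_ac)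
  also have "(\<Sum>i\<le>n. H * gl_weight \<beta> (n - i) * ((H *\<^sub>R S i) \<bullet> a' i))
      = (\<Sum>i\<le>n. H * gl_weight \<beta> (n - i) * (volterra a b (gl_kernel \<beta> d) \<phi> (t - real (n - i) * d) \<bullet> G (n - i)))"
    by (rule sum.cong) (auto simp: S a'_def)
  also have "\<dots> = (\<Sum>j\<le>n. H * gl_weight \<beta> j * (volterra a b (gl_kernel \<beta> d) \<phi> (t - real j * d) \<bullet> G j))"
    by (rule sum.reindex_bij_witness[of _ "\<lambda>i. n - i" "\<lambda>i. n - i"]) auto
  also have "\<dots> = (\<Sum>j\<le>n. integral {a..b} (\<lambda>\<tau>. H * gl_weight \<beta> j * (volterra a b (gl_kernel \<beta> d) \<phi> (t - real j * d) \<bullet> (indicator (I j) \<tau> *\<^sub>R \<phi> \<tau>))))"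
    unfolding G_def
    by (intro sum.cong refl)
       (simp add: integral_linear[OF iI bounded_linear_inner_right, unfolded o_def, symmetric])
  also have "\<dots> = integral {a..b} (\<lambda>\<tau>. \<Sum>j\<le>n. H * gl_weight \<beta> j * (volterra a b (gl_kernel \<beta> d) \<phi> (t - real j * d) \<bullet> (indicator (I j) \<tau> *\<^sub>R \<phi> \<tau>)))"
    by (rule Henstock_Kurzweil_Integration.integral_sum[symmetric])
       (rule finite_atMost, intro integrable_on_mult_right integrable_linear[OF iI bounded_linear_inner_right, unfolded o_def])
  also have "\<dots> \<le> volterra a b (gl_kernel \<beta> d) g t"
    unfolding volterra_def[of a b "gl_kernel \<beta> d" g t]
  proof (rule integral_le)
    show "(\<lambda>\<tau>. \<Sum>j\<le>n. H * gl_weight \<beta> j * (volterra a b (gl_kernel \<beta> d) \<phi> (t - real j * d) \<bullet> (indicator (I j) \<tau> *\<^sub>R \<phi> \<tau>))) integrable_on {a..b}"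
      by (intro integrable_sum integrable_on_mult_right integrable_linear[OF iI bounded_linear_inner_right, unfolded o_def]) auto
    show "(\<lambda>\<tau>. gl_kernel \<beta> d (t - \<tau>) *\<^sub>R g \<tau>) integrable_on {a..b}"
      by (rule volterra_integrable_on[OF vkernel_gl[OF \<beta> d] g])
    fix \<tau> assume \<tau>: "\<tau> \<in> {a..b}"
    show "(\<Sum>j\<le>n. H * gl_weight \<beta> j * (volterra a b (gl_kernel \<beta> d) \<phi> (t - real j * d) \<bullet> (indicator (I j) \<tau> *\<^sub>R \<phi> \<tau>))) \<le> gl_kernel \<beta> d (t - \<tau>) *\<^sub>R g \<tau>"
    proof (cases "\<tau> < t")
      case True
      have "(\<Sum>j\<le>n. H * gl_weight \<beta> j * (volterra a b (gl_kernel \<beta> d) \<phi> (t - real j * d) \<bullet> (indicator (I j) \<tau> *\<^sub>R \<phi> \<tau>)))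
          = (\<Sum>j\<in>{J \<tau>}. H * gl_weight \<beta> j * (volterra a b (gl_kernel \<beta> d) \<phi> (t - real j * d) \<bullet> (indicator (I j) \<tau> *\<^sub>R \<phi> \<tau>)))"
        by (rule sum.mono_neutral_right) (use J_le[of \<tau>] \<tau> in \<open>auto simp: I_def\<close>)
      also have "\<dots> = gl_kernel \<beta> d (t - \<tau>) * (volterra a b (gl_kernel \<beta> d) \<phi> (t - real (J \<tau>) * d) \<bullet> \<phi> \<tau>)"
        using True by (simp add: I_def gl_kernel_def H_def J_def)
      also have "\<dots> \<le> gl_kernel \<beta> d (t - \<tau>) * g \<tau>"
        by (intro mult_left_mono near[OF \<tau> True] gl_kernel_nonneg \<beta>) (simp add: J_def)
      finally show ?thesis by simp
    next
      case False
      then have "(\<Sum>j\<le>n. H * gl_weight \<beta> j * (volterra a b (gl_kernel \<beta> d) \<phi> (t - real j * d) \<bullet> (indicator (I j) \<tau> *\<^sub>R \<phi> \<tau>))) = 0"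
        by (intro sum.neutral) (auto simp: I_def)
      then show ?thesis using False by (simp add: gl_kernel_def)
    qed
  qed
  finally have "(norm (H *\<^sub>R S n))\<^sup>2 \<le> 2 * volterra a b (gl_kernel \<beta> d) g t" by simp
  then show ?thesis using S[of n] by simp
qed

text \<open>
  The first summand is the price of replacing one kernel by the other, the second that of moving the
  argument by at most \<open>d\<close>.
\<close>

definition gl_error :: "real \<Rightarrow> real \<Rightarrow> real \<Rightarrow> real \<Rightarrow> real" where
  "gl_error \<beta> T M d = M * integral {0..T} (\<lambda>u. \<bar>gl_kernel \<beta> d u - rl_kernel \<beta> u\<bar>) + 2 * M * mass (rl_kernel \<beta>) d"

lemma volterra_gl_kernel_diff_rl_kernel:
  fixes \<phi> :: "real \<Rightarrow> 'b::euclidean_space"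
  assumes \<beta>: "0 < \<beta>" "\<beta> \<le> 1" and \<phi>: "bmeas a b M \<phi>" and t: "t \<in> {a..b}" and d: "0 < d"
  shows "norm (volterra a b (gl_kernel \<beta> d) \<phi> t - volterra a b (rl_kernel \<beta>) \<phi> t) \<le> M * integral {0..b - a} (\<lambda>u. \<bar>gl_kernel \<beta> d u - rl_kernel \<beta> u\<bar>)"
  by (rule volterra_kernel_diff[OF vkernel_gl[OF \<beta> d] vkernel_rl[OF \<beta>(1)] \<phi> t]) (use bmeas_nonneg[OF \<phi>] t in auto)

lemma L1_error_nonneg:
  assumes \<beta>: "0 < \<beta>" "\<beta> \<le> 1" and d: "0 < d" and T: "0 \<le> T"
  shows "0 \<le> integral {0..T} (\<lambda>u. \<bar>gl_kernel \<beta> d u - rl_kernel \<beta> u\<bar>)"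
  using order_trans[OF norm_ge_zero volterra_gl_kernel_diff_rl_kernel[OF \<beta> bmeas_const[of "1::real" 1] _ d, where a=0 and b=T and t=0]] T by simp

lemma gl_error_nonneg:
  assumes \<beta>: "0 < \<beta>" "\<beta> \<le> 1" and d: "0 < d" and T: "0 \<le> T" and M: "0 \<le> M"
  shows "0 \<le> gl_error \<beta> T M d"
  unfolding gl_error_def
  by (intro add_nonneg_nonneg mult_nonneg_nonneg mass_nonneg[OF vkernel_rl[OF \<beta>(1)]] L1_error_nonneg assms) (use M in auto)

lemma gl_error_tendsto:
  assumes \<beta>: "0 < \<beta>" "\<beta> \<le> 1" and h: "\<And>n. 0 < h n" "h \<longlonglongrightarrow> 0"
  shows "(\<lambda>n. gl_error \<beta> T M (h n)) \<longlonglongrightarrow> 0"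
proof -
  have kr: "vkernel (rl_kernel \<beta>)" by (rule vkernel_rl[OF \<beta>(1)])
  have "(\<lambda>n. mass (rl_kernel \<beta>) (h n)) \<longlonglongrightarrow> 0"
  proof (rule LIMSEQ_I)
    fix e :: real assume "0 < e"
    then obtain d where d: "0 < d" "\<And>u. 0 \<le> u \<Longrightarrow> u < d \<Longrightarrow> mass (rl_kernel \<beta>) u < e" using mass_small[OF kr] by blast
    obtain n0 where "\<And>n. n \<ge> n0 \<Longrightarrow> h n < d"
      using order_tendstoD(2)[OF h(2) d(1)] by (auto simp: eventually_sequentially)
    then show "\<exists>no. \<forall>n\<ge>no. norm (mass (rl_kernel \<beta>) (h n) - 0) < e"
      using d(2) h(1) mass_nonneg[OF kr] by (intro exI[of _ n0]) (auto simp: less_imp_le)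
  qed
  then have "(\<lambda>n. gl_error \<beta> T M (h n)) \<longlonglongrightarrow> M * 0 + 2 * M * 0"
    unfolding gl_error_def by (intro tendsto_intros gl_kernel_L1_convergence_seq[OF \<beta> h])
  then show ?thesis by simp
qed

lemma volterra_gl_kernel_tendsto:
  fixes \<phi> :: "real \<Rightarrow> 'b::euclidean_space"
  assumes \<beta>: "0 < \<beta>" "\<beta> \<le> 1" and h: "\<And>n. 0 < h n" "h \<longlonglongrightarrow> 0" and \<phi>: "bmeas a b M \<phi>" and t: "t \<in> {a..b}"
  shows "(\<lambda>n. volterra a b (gl_kernel \<beta> (h n)) \<phi> t) \<longlonglongrightarrow> volterra a b (rl_kernel \<beta>) \<phi> t"
proof -
  have "(\<lambda>n. volterra a b (gl_kernel \<beta> (h n)) \<phi> t - volterra a b (rl_kernel \<beta>) \<phi> t) \<longlonglongrightarrow> 0"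
    by (rule Lim_null_comparison[OF _ tendsto_mult_right_zero[OF gl_kernel_L1_convergence_seq[OF \<beta> h, of "b - a"], of M]])
       (use volterra_gl_kernel_diff_rl_kernel[OF \<beta> \<phi> t h(1)] in auto)
  then show ?thesis by (rule LIM_zero_cancel)
qed

text \<open>
  The point \<open>t - j * d\<close> of the grid lies in \<open>{\<tau>..<\<tau> + d}\<close>.
\<close>

lemma gl_sampling_error:
  fixes \<phi> :: "real \<Rightarrow> 'b::euclidean_space"
  assumes \<beta>: "0 < \<beta>" "\<beta> \<le> 1" and \<phi>: "bmeas a b M \<phi>" and t: "t \<in> {a..b}" and d: "0 < d"
    and \<tau>: "\<tau> \<in> {a..b}" "\<tau> < t" and j: "j = nat \<lfloor>(t - \<tau>) / d\<rfloor>"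
  shows "norm (volterra a b (gl_kernel \<beta> d) \<phi> (t - real j * d) - volterra a b (rl_kernel \<beta>) \<phi> \<tau>) \<le> gl_error \<beta> (b - a) M d"
proof -
  have kr: "vkernel (rl_kernel \<beta>)" by (rule vkernel_rl[OF \<beta>(1)])
  have M: "0 \<le> M" using bmeas_nonneg[OF \<phi>] t by simp
  define u where "u = t - real j * d"
  have jle: "real j \<le> (t - \<tau>) / d" "(t - \<tau>) / d < real j + 1"
    using \<tau>(2) d unfolding j by (auto simp: of_nat_floor)
  have u1: "\<tau> \<le> u" using jle(1) d by (simp add: u_def field_simps)
  have u2: "u < \<tau> + d" using jle(2) d by (simp add: u_def field_simps)
  have u3: "u \<le> t" using d by (simp add: u_def)
  have uab: "u \<in> {a..b}" using u1 u3 \<tau> t by auto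
  have "norm (volterra a b (gl_kernel \<beta> d) \<phi> u - volterra a b (rl_kernel \<beta>) \<phi> \<tau>)
      \<le> norm (volterra a b (gl_kernel \<beta> d) \<phi> u - volterra a b (rl_kernel \<beta>) \<phi> u) + norm (volterra a b (rl_kernel \<beta>) \<phi> u - volterra a b (rl_kernel \<beta>) \<phi> \<tau>)"
    by (rule order_trans[OF _ norm_triangle_ineq]) simp
  also have "\<dots> \<le> M * integral {0..b - a} (\<lambda>u. \<bar>gl_kernel \<beta> d u - rl_kernel \<beta> u\<bar>) + 2 * M * mass (rl_kernel \<beta>) \<bar>u - \<tau>\<bar>"
    by (intro add_mono volterra_gl_kernel_diff_rl_kernel[OF \<beta> \<phi> uab d] volterra_modulus[OF kr rl_kernel_antimono[OF \<beta>] \<phi> \<tau>(1) uab M])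
  also have "\<dots> \<le> gl_error \<beta> (b - a) M d"
    unfolding gl_error_def using u1 u2 M by (intro add_left_mono mult_left_mono mass_mono[OF kr]) auto
  finally show ?thesis by (simp add: u_def)
qed

text \<open>
  For \<open>\<beta> = 1\<close> this is the equality \<open>d/dt \<parallel>s\<parallel>\<^sup>2 = 2 \<langle>s, s'\<rangle>\<close> in integrated form. For other orders it follows
  from the discrete inequality when the step tends to \<open>0\<close>.
\<close>

theorem fractional_energy:
  fixes \<phi> :: "real \<Rightarrow> 'b::euclidean_space"
  assumes \<beta>: "0 < \<beta>" "\<beta> \<le> 1" and \<phi>: "bmeas a b M \<phi>" and t: "t \<in> {a..b}"
  shows "(norm (volterra a b (rl_kernel \<beta>) \<phi> t))\<^sup>2 \<le> 2 * volterra a b (rl_kernel \<beta>) (\<lambda>\<tau>. volterra a b (rl_kernel \<beta>) \<phi> \<tau> \<bullet> \<phi> \<tau>) t"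
proof -
  define s where "s = volterra a b (rl_kernel \<beta>) \<phi>"
  have kr: "vkernel (rl_kernel \<beta>)" by (rule vkernel_rl[OF \<beta>(1)])
  have M: "0 \<le> M" using bmeas_nonneg[OF \<phi>] t by simp
  define h where "h n = inverse (real (Suc n))" for n
  have h: "0 < h n" for n by (simp add: h_def)
  have h0: "h \<longlonglongrightarrow> 0" unfolding h_def by (rule LIMSEQ_inverse_real_of_nat)
  have kg: "vkernel (gl_kernel \<beta> (h n))" for n by (rule vkernel_gl[OF \<beta> h])
  define err where "err n = gl_error \<beta> (b - a) M (h n)" for n
  have err0: "err \<longlonglongrightarrow> 0" unfolding err_def by (rule gl_error_tendsto[OF \<beta> h h0])
  obtain S where bs: "bmeas a b S s"
    using volterra_bmeas[OF kr rl_kernel_antimono[OF \<beta>] \<phi>] unfolding s_def by blast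
  have bsp: "bmeas a b (S * M) (\<lambda>\<tau>. s \<tau> \<bullet> \<phi> \<tau>)" by (rule bmeas_inner[OF bs \<phi>])
  have ineq: "(norm (volterra a b (gl_kernel \<beta> (h n)) \<phi> t))\<^sup>2
      \<le> 2 * (volterra a b (gl_kernel \<beta> (h n)) (\<lambda>\<tau>. s \<tau> \<bullet> \<phi> \<tau>) t + volterra a b (gl_kernel \<beta> (h n)) (\<lambda>_. 1) t * (err n * M))" for n
  proof -
    have e0: "0 \<le> err n" unfolding err_def using t by (intro gl_error_nonneg \<beta> h M) auto
    have bc: "bmeas a b (err n * M) (\<lambda>_. err n * M)" by (rule bmeas_const) (use e0 M in auto)
    have "(norm (volterra a b (gl_kernel \<beta> (h n)) \<phi> t))\<^sup>2 \<le> 2 * volterra a b (gl_kernel \<beta> (h n)) (\<lambda>\<tau>. s \<tau> \<bullet> \<phi> \<tau> + err n * M) t"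
    proof (rule gl_energy[OF \<beta> \<phi> t h, of "S * M + err n * M"])
      show "bmeas a b (S * M + err n * M) (\<lambda>\<tau>. s \<tau> \<bullet> \<phi> \<tau> + err n * M)"
        using bsp bc unfolding bmeas_def by (auto intro!: order_trans[OF abs_triangle_ineq] add_mono)
      fix \<tau> j assume \<tau>: "\<tau> \<in> {a..b}" "\<tau> < t" and j: "j = nat \<lfloor>(t - \<tau>) / h n\<rfloor>"
      have "norm (volterra a b (gl_kernel \<beta> (h n)) \<phi> (t - real j * h n) - s \<tau>) \<le> err n"
        unfolding s_def err_def by (rule gl_sampling_error[OF \<beta> \<phi> t h \<tau> j])
      then have "(volterra a b (gl_kernel \<beta> (h n)) \<phi> (t - real j * h n) - s \<tau>) \<bullet> \<phi> \<tau> \<le> err n * M"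
        using \<phi> \<tau>(1) e0 by (intro order_trans[OF norm_cauchy_schwarz] mult_mono) (auto simp: bmeas_def)
      then show "volterra a b (gl_kernel \<beta> (h n)) \<phi> (t - real j * h n) \<bullet> \<phi> \<tau> \<le> s \<tau> \<bullet> \<phi> \<tau> + err n * M"
        by (simp add: inner_diff_left)
    qed
    also have "volterra a b (gl_kernel \<beta> (h n)) (\<lambda>\<tau>. s \<tau> \<bullet> \<phi> \<tau> + err n * M) t
       = volterra a b (gl_kernel \<beta> (h n)) (\<lambda>\<tau>. s \<tau> \<bullet> \<phi> \<tau>) t + volterra a b (gl_kernel \<beta> (h n)) (\<lambda>_. err n * M) t"
      by (rule volterra_add[OF kg bsp bc])
    also have "volterra a b (gl_kernel \<beta> (h n)) (\<lambda>_. err n * M) t = volterra a b (gl_kernel \<beta> (h n)) (\<lambda>_. 1) t * (err n * M)"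
      using volterra_cmul[of a b "gl_kernel \<beta> (h n)" "err n * M" "\<lambda>_. 1" t] by (simp add: mult.commute)
    finally show ?thesis .
  qed
  note lim = volterra_gl_kernel_tendsto[OF \<beta> h h0 _ t]
  show ?thesis
    unfolding s_def[symmetric]
  proof (rule LIMSEQ_le)
    show "(\<lambda>n. (norm (volterra a b (gl_kernel \<beta> (h n)) \<phi> t))\<^sup>2) \<longlonglongrightarrow> (norm (s t))\<^sup>2"
      unfolding s_def by (intro tendsto_intros lim[OF \<phi>])
    have "(\<lambda>n. 2 * (volterra a b (gl_kernel \<beta> (h n)) (\<lambda>\<tau>. s \<tau> \<bullet> \<phi> \<tau>) t + volterra a b (gl_kernel \<beta> (h n)) (\<lambda>_. 1) t * (err n * M)))
       \<longlonglongrightarrow> 2 * (volterra a b (rl_kernel \<beta>) (\<lambda>\<tau>. s \<tau> \<bullet> \<phi> \<tau>) t + volterra a b (rl_kernel \<beta>) (\<lambda>_. 1) t * (0 * M))"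
      by (intro tendsto_intros lim[OF bsp] lim[OF bmeas_const[of 1 1]] err0) simp
    then show "(\<lambda>n. 2 * (volterra a b (gl_kernel \<beta> (h n)) (\<lambda>\<tau>. s \<tau> \<bullet> \<phi> \<tau>) t + volterra a b (gl_kernel \<beta> (h n)) (\<lambda>_. 1) t * (err n * M)))
       \<longlonglongrightarrow> 2 * volterra a b (rl_kernel \<beta>) (\<lambda>\<tau>. s \<tau> \<bullet> \<phi> \<tau>) t" by simp
  qed (use ineq in auto)
qed

section \<open>The state as a Volterra integral of the velocity\<close>

text \<open>
  Write every delayed value of \<open>y\<close> in the finite difference as an integral of \<open>\<phi>\<close>. At the time \<open>\<tau>\<close>, the
  integrand \<open>\<phi> \<tau>\<close> is counted with the coefficients whose delayed argument is not before \<open>\<tau>\<close>, and the sum of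
  these coefficients is a weight of order \<open>\<alpha>\<close>.
\<close>

lemma approx_state_eq_volterra:
  fixes \<phi> :: "real \<Rightarrow> real ^ 'n"
  assumes \<alpha>: "0 < \<alpha>" "\<alpha> < 1" and h: "0 < h" and \<phi>: "bmeas a b M \<phi>" and t: "t \<in> {a..b}"
    and y: "\<And>s. s \<in> {a..b} \<Longrightarrow> y s = integral {a..s} \<phi>"
  shows "approx_state a \<alpha> w0 h y t = w0 + volterra a b (gl_kernel \<alpha> h) \<phi> t"
proof -
  define n where "n = nat \<lfloor>(t - a) / h\<rfloor>"
  define c where "c i = (- 1) ^ i * ((1 - \<alpha>) gchoose i)" for i
  have le_t: "real i * h \<le> t - a" if "i \<le> n" for i
  proof -
    have "real i \<le> (t - a) / h" using that t h unfolding n_def by (simp add: le_nat_iff le_floor_iff)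
    then show ?thesis using h by (simp add: field_simps)
  qed
  define X where "X i = {\<tau>::real. \<tau> \<le> t - real i * h}" for i
  have bX: "bmeas a b M (\<lambda>\<tau>. indicator (X i) \<tau> *\<^sub>R \<phi> \<tau>)" for i
    by (rule bmeas_indicator[OF \<phi>]) (simp add: X_def)
  have iX: "(\<lambda>\<tau>. indicator (X i) \<tau> *\<^sub>R \<phi> \<tau>) integrable_on {a..b}" for i
    using bmeas_integrable[OF bX[of i]] set_lebesgue_integral_eq_integral(1) by blast
  have yX: "y (t - real i * h) = integral {a..b} (\<lambda>\<tau>. indicator (X i) \<tau> *\<^sub>R \<phi> \<tau>)" if "i \<le> n" for i
  proof -
    have "t - real i * h \<in> {a..b}" using le_t[OF that] t h by (auto intro: order_trans[of _ t])
    then have "y (t - real i * h) = integral {a..t - real i * h} \<phi>" by (rule y)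
    also have "\<dots> = integral {a..b} (\<lambda>\<tau>. if \<tau> \<in> {a..t - real i * h} then \<phi> \<tau> else 0)"
    proof (rule integral_extend_zero[symmetric])
      have "t - real i * h \<le> t" using h by simp
      then show "{a..t - real i * h} \<subseteq> {a..b}" using t by auto
    qed
    also have "\<dots> = integral {a..b} (\<lambda>\<tau>. indicator (X i) \<tau> *\<^sub>R \<phi> \<tau>)"
      by (rule integral_cong) (auto simp: X_def indicator_def)
    finally show ?thesis .
  qed
  define H where "H = h powr (\<alpha> - 1)"
  have "H *\<^sub>R frac_diff a h (1 - \<alpha>) y t = (\<Sum>i\<le>n. (H * c i) *\<^sub>R y (t - real i * h))"
    unfolding frac_diff_def n_def[symmetric] c_def by (simp add: scaleR_sum_right atLeast0AtMost)
  also have "\<dots> = (\<Sum>i\<le>n. integral {a..b} (\<lambda>\<tau>. (H * c i) *\<^sub>R (indicator (X i) \<tau> *\<^sub>R \<phi> \<tau>)))"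
    by (intro sum.cong refl) (simp only: integral_cmul yX atMost_iff)
  also have "\<dots> = integral {a..b} (\<lambda>\<tau>. \<Sum>i\<le>n. (H * c i) *\<^sub>R (indicator (X i) \<tau> *\<^sub>R \<phi> \<tau>))"
    by (rule Henstock_Kurzweil_Integration.integral_sum[symmetric])
       (rule finite_atMost, intro integrable_cmul iX)
  also have "\<dots> = volterra a b (gl_kernel \<alpha> h) \<phi> t"
    unfolding volterra_def
  proof (rule integral_spike[of "{t}"])
    fix \<tau> assume "\<tau> \<in> {a..b} - {t}"
    then have \<tau>: "a \<le> \<tau>" "\<tau> \<noteq> t" by auto
    show "gl_kernel \<alpha> h (t - \<tau>) *\<^sub>R \<phi> \<tau> = (\<Sum>i\<le>n. (H * c i) *\<^sub>R (indicator (X i) \<tau> *\<^sub>R \<phi> \<tau>))"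
    proof (cases "\<tau> < t")
      case True
      define J where "J = nat \<lfloor>(t - \<tau>) / h\<rfloor>"
      have Jn: "J \<le> n"
        unfolding J_def n_def using \<tau> h by (intro nat_mono floor_mono divide_right_mono) auto
      have mem: "\<tau> \<in> X i \<longleftrightarrow> i \<le> J" for i
      proof -
        have "i \<le> J \<longleftrightarrow> real i \<le> (t - \<tau>) / h" unfolding J_def using True h by (simp add: le_nat_iff le_floor_iff)
        also have "\<dots> \<longleftrightarrow> \<tau> \<le> t - real i * h" using h by (simp add: field_simps)
        finally show ?thesis by (simp add: X_def)
      qed
      have "(\<Sum>i\<le>n. (H * c i) *\<^sub>R (indicator (X i) \<tau> *\<^sub>R \<phi> \<tau>)) = (\<Sum>i\<le>J. (H * c i) *\<^sub>R \<phi> \<tau>)"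
        by (rule sum.mono_neutral_cong_right) (use Jn mem in \<open>auto simp: indicator_def\<close>)
      also have "\<dots> = (H * gl_weight \<alpha> J) *\<^sub>R \<phi> \<tau>"
        using gl_weight_sum[of "1 - \<alpha>" J] by (simp add: c_def scaleR_left.sum[symmetric] flip: sum_distrib_left scaleR_sum_left)
      finally show ?thesis using True by (simp add: gl_kernel_def H_def J_def)
    next
      case False
      have "\<tau> \<notin> X i" for i
      proof -
        have "0 \<le> real i * h" using h by simp
        then show ?thesis using False \<tau>(2) by (simp add: X_def)
      qed
      then show ?thesis using False by (simp add: gl_kernel_def)
    qed
  qed simp
  finally show ?thesis by (simp add: approx_state_def H_def)
qed

lemma approx_state_local:
  assumes "0 < h" "a \<le> t" "\<And>s. s \<in> {a..t} \<Longrightarrow> y s = z s"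
  shows "approx_state a \<alpha> w0 h y t = approx_state a \<alpha> w0 h z t"
proof -
  have "y (t - real i * h) = z (t - real i * h)" if "i \<in> {0..nat \<lfloor>(t - a) / h\<rfloor>}" for i
  proof -
    have "real i \<le> (t - a) / h" using that assms by (simp add: le_nat_iff le_floor_iff)
    then have "real i * h \<le> t - a" using assms by (simp add: field_simps)
    then show ?thesis using assms by (intro assms(3)) auto
  qed
  then show ?thesis unfolding approx_state_def frac_diff_def by simp
qed

text \<open>
  A Lipschitz constant of the state as a function of the motion in the uniform norm. It tends to
  infinity as the step tends to \<open>0\<close> and so can only be used for a fixed step.
\<close>

definition gl_state_const :: "real \<Rightarrow> real \<Rightarrow> real \<Rightarrow> real" where
  "gl_state_const \<alpha> h T = h powr (\<alpha> - 1) * (\<Sum>i = 0..nat \<lfloor>T / h\<rfloor>. \<bar>(1 - \<alpha>) gchoose i\<bar>)"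

lemma gl_state_const_nonneg: "0 \<le> gl_state_const \<alpha> h T"
  unfolding gl_state_const_def by (intro mult_nonneg_nonneg sum_nonneg) auto

lemma approx_state_diff_le:
  fixes y z :: "real \<Rightarrow> real ^ 'n"
  assumes h: "0 < h" and t: "t \<in> {a..b}" and m: "\<And>s. s \<in> {a..t} \<Longrightarrow> norm (y s - z s) \<le> m"
  shows "norm (approx_state a \<alpha> w0 h y t - approx_state a \<alpha> w0 h z t) \<le> gl_state_const \<alpha> h (b - a) * m"
proof -
  have m0: "0 \<le> m" using order_trans[OF norm_ge_zero m[of a]] t by simp
  define n where "n = nat \<lfloor>(t - a) / h\<rfloor>"
  have nN: "n \<le> nat \<lfloor>(b - a) / h\<rfloor>"
    unfolding n_def using t h by (intro nat_mono floor_mono divide_right_mono) auto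
  have "approx_state a \<alpha> w0 h y t - approx_state a \<alpha> w0 h z t
      = h powr (\<alpha> - 1) *\<^sub>R (\<Sum>i = 0..n. ((- 1) ^ i * ((1 - \<alpha>) gchoose i)) *\<^sub>R (y (t - real i * h) - z (t - real i * h)))"
    by (simp add: approx_state_def frac_diff_def n_def scaleR_diff_right sum_subtractf)
  also have "norm \<dots> \<le> h powr (\<alpha> - 1) * (\<Sum>i = 0..n. \<bar>(1 - \<alpha>) gchoose i\<bar> * m)"
    unfolding norm_scaleR abs_of_nonneg[OF powr_ge_zero]
  proof (intro mult_left_mono sum_norm_le)
    fix i assume "i \<in> {0..n}"
    then have "real i \<le> (t - a) / h" using t h unfolding n_def by (simp add: le_nat_iff le_floor_iff)
    then have "real i * h \<le> t - a" using h by (simp add: field_simps)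
    then have "t - real i * h \<in> {a..t}" using h by auto
    then show "norm (((- 1) ^ i * ((1 - \<alpha>) gchoose i)) *\<^sub>R (y (t - real i * h) - z (t - real i * h))) \<le> \<bar>(1 - \<alpha>) gchoose i\<bar> * m"
      using m by (auto simp: abs_mult power_abs intro!: mult_left_mono)
  qed simp
  also have "\<dots> \<le> h powr (\<alpha> - 1) * (\<Sum>i = 0..nat \<lfloor>(b - a) / h\<rfloor>. \<bar>(1 - \<alpha>) gchoose i\<bar> * m)"
    using nN m0 by (intro mult_left_mono sum_mono2) auto
  finally show ?thesis by (simp add: gl_state_const_def sum_distrib_right mult.assoc)
qed

section \<open>Riemann-Liouville integrals\<close>

text \<open>
  Passes to a version of \<open>x\<close> that is bounded everywhere, and from the Lebesgue integral over \<open>{a..t}\<close> to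
  the gauge integral over the fixed interval.
\<close>

lemma rl_integral_eq_volterra:
  fixes x x' :: "real \<Rightarrow> real ^ 'n"
  assumes \<beta>: "0 < \<beta>" and x': "bmeas a b M x'" and N: "negligible N"
    and xx': "\<And>\<tau>. \<tau> \<in> {a..b} - N \<Longrightarrow> x \<tau> = x' \<tau>" and t: "t \<in> {a..b}"
  shows "rl_integral a \<beta> x t = volterra a b (rl_kernel \<beta>) x' t"
proof -
  have kp: "vkernel (power_kernel \<beta>)" by (rule vkernel_power[OF \<beta>])
  have xt: "bmeas a t M x'"
  proof -
    have "x' \<in> borel_measurable (lebesgue_on {a..t})"
      by (rule measurable_restrict_mono[of _ _ "{a..b}"]) (use x' t in \<open>auto simp: bmeas_def\<close>)
    then show ?thesis using x' t by (auto simp: bmeas_def)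
  qed
  have eq: "x \<tau> /\<^sub>R ((t - \<tau>) powr (1 - \<beta>)) = power_kernel \<beta> (t - \<tau>) *\<^sub>R x \<tau>" if "\<tau> \<le> t" for \<tau>
    using that by (auto simp: power_kernel_def powr_minus[symmetric])
  have "set_integrable lebesgue {a..t} (\<lambda>\<tau>. power_kernel \<beta> (t - \<tau>) *\<^sub>R x \<tau>)"
    by (rule absolutely_integrable_spike[OF volterra_integrable[OF kp xt] N]) (use xx' t in auto)
  then have "(LINT \<tau>:{a..t}|lebesgue. power_kernel \<beta> (t - \<tau>) *\<^sub>R x \<tau>) = integral {a..t} (\<lambda>\<tau>. power_kernel \<beta> (t - \<tau>) *\<^sub>R x \<tau>)"
    by (rule set_lebesgue_integral_eq_integral(2))
  moreover have "(LINT \<tau>:{a..t}|lebesgue. x \<tau> /\<^sub>R ((t - \<tau>) powr (1 - \<beta>))) = (LINT \<tau>:{a..t}|lebesgue. power_kernel \<beta> (t - \<tau>) *\<^sub>R x \<tau>)"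
    by (rule set_lebesgue_integral_cong) (auto simp: eq)
  moreover have "integral {a..t} (\<lambda>\<tau>. power_kernel \<beta> (t - \<tau>) *\<^sub>R x \<tau>) = integral {a..b} (\<lambda>\<tau>. power_kernel \<beta> (t - \<tau>) *\<^sub>R x' \<tau>)"
  proof -
    have "integral {a..t} (\<lambda>\<tau>. power_kernel \<beta> (t - \<tau>) *\<^sub>R x \<tau>) = integral {a..t} (\<lambda>\<tau>. power_kernel \<beta> (t - \<tau>) *\<^sub>R x' \<tau>)"
      by (rule integral_spike[OF N]) (use xx' t in auto)
    moreover
    have "integral {a..b} (\<lambda>\<tau>. if \<tau> \<in> {a..t} then power_kernel \<beta> (t - \<tau>) *\<^sub>R x' \<tau> else 0) = integral {a..t} (\<lambda>\<tau>. power_kernel \<beta> (t - \<tau>) *\<^sub>R x' \<tau>)"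
      using t by (intro integral_extend_zero) auto
    moreover have "integral {a..b} (\<lambda>\<tau>. if \<tau> \<in> {a..t} then power_kernel \<beta> (t - \<tau>) *\<^sub>R x' \<tau> else 0) = integral {a..b} (\<lambda>\<tau>. power_kernel \<beta> (t - \<tau>) *\<^sub>R x' \<tau>)"
      by (rule integral_cong) (auto simp: power_kernel_def)
    ultimately show ?thesis by simp
  qed
  ultimately have "rl_integral a \<beta> x t = (1 / Gamma \<beta>) *\<^sub>R integral {a..b} (\<lambda>\<tau>. power_kernel \<beta> (t - \<tau>) *\<^sub>R x' \<tau>)"
    by (simp add: rl_integral_def)
  also have "\<dots> = volterra a b (rl_kernel \<beta>) x' t"
    unfolding volterra_def rl_kernel_def by (subst integral_cmul[symmetric]) (simp add: divide_inverse mult.commute)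
  finally show ?thesis .
qed

lemma volterra_rl_kernel_1:
  assumes "t \<in> {a..b}" shows "volterra a b (rl_kernel 1) \<phi> t = integral {a..t} \<phi>"
proof -
  have "volterra a b (rl_kernel 1) \<phi> t = integral {a..b} (\<lambda>\<tau>. if \<tau> \<in> {a..t} then \<phi> \<tau> else 0)"
    unfolding volterra_def by (rule integral_spike[of "{t}"]) (auto simp: rl_kernel_1)
  also have "\<dots> = integral {a..t} \<phi>" using assms by (intro integral_extend_zero) auto
  finally show ?thesis .
qed

lemma integral_indicator_cell:
  assumes "a \<le> t - (real j + 1) * h" "t \<le> b" "0 < h"
  shows "((\<lambda>\<tau>. indicator {\<tau>. \<tau> < t \<and> nat \<lfloor>(t - \<tau>) / h\<rfloor> = j} \<tau>) has_integral h) {a..b}"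
proof -
  have jh: "0 \<le> real j * h" using assms by simp
  have 0: "((\<lambda>_. 1::real) has_integral h) {t - (real j + 1) * h..t - real j * h}"
    using has_integral_const_real[of "1::real" "t - (real j + 1) * h" "t - real j * h"] assms by (simp add: algebra_simps)
  have 1: "((\<lambda>\<tau>. if \<tau> \<in> {t - (real j + 1) * h..t - real j * h} then 1 else 0::real) has_integral h) {a..b}"
  proof (rule has_integral_restrict[THEN iffD2, OF _ 0])
    show "{t - (real j + 1) * h..t - real j * h} \<subseteq> {a..b}"
      unfolding atLeastatMost_subset_iff using assms(1,2) jh by linarith
  qed
  show ?thesis
  proof (rule has_integral_spike[OF _ _ 1, of "{t - (real j + 1) * h, t}"])
    fix \<tau> assume \<tau>: "\<tau> \<in> {a..b} - {t - (real j + 1) * h, t}"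
    have "nat \<lfloor>(t - \<tau>) / h\<rfloor> = j \<longleftrightarrow> real j \<le> (t - \<tau>) / h \<and> (t - \<tau>) / h < real j + 1" if "\<tau> < t"
    proof -
      have "0 \<le> (t - \<tau>) / h" using that assms by simp
      then have "nat \<lfloor>(t - \<tau>) / h\<rfloor> = j \<longleftrightarrow> \<lfloor>(t - \<tau>) / h\<rfloor> = int j" by auto
      then show ?thesis by (simp add: floor_eq_iff)
    qed
    moreover have "real j \<le> (t - \<tau>) / h \<longleftrightarrow> \<tau> \<le> t - real j * h"
      "(t - \<tau>) / h < real j + 1 \<longleftrightarrow> t - (real j + 1) * h < \<tau>" using assms by (auto simp: field_simps)
    ultimately have "\<tau> < t \<Longrightarrow> nat \<lfloor>(t - \<tau>) / h\<rfloor> = j \<longleftrightarrow> \<tau> \<le> t - real j * h \<and> t - (real j + 1) * h < \<tau>"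
      by simp
    then show "indicator {\<tau>. \<tau> < t \<and> nat \<lfloor>(t - \<tau>) / h\<rfloor> = j} \<tau> = (if \<tau> \<in> {t - (real j + 1) * h..t - real j * h} then 1 else (0::real))"
      using \<tau> jh by (auto simp: indicator_def)
  qed simp
qed

text \<open>
  The discrete analogue is the fact that the weights of order \<open>1 - \<alpha>\<close> invert the coefficients of
  the difference of order \<open>1 - \<alpha>\<close>. This difference of \<open>y\<close> is, up to a power of the step, a discrete integral
  of order \<open>\<alpha>\<close> of \<open>\<phi>\<close>, so the convolution of the latter with the weights on a grid gives back \<open>y\<close> exactly (\<open>yt\<close>).
  The errors of sampling and of the kernels tend to \<open>0\<close> with the step.
\<close>

theorem rl_semigroup:
  fixes \<phi> :: "real \<Rightarrow> real ^ 'n"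
  assumes \<alpha>: "0 < \<alpha>" "\<alpha> < 1" and \<phi>: "bmeas a b M \<phi>" and t: "t \<in> {a..b}"
  shows "volterra a b (rl_kernel (1 - \<alpha>)) (volterra a b (rl_kernel \<alpha>) \<phi>) t = integral {a..t} \<phi>"
proof (cases "t = a")
  case True
  then show ?thesis using volterra_at_start[OF vkernel_rl[of "1 - \<alpha>"]] \<alpha> by simp
next
  case False
  then have ta: "a < t" using t by simp
  have \<alpha>1: "\<alpha> \<le> 1" using \<alpha> by simp
  define \<beta> where "\<beta> = 1 - \<alpha>"
  have \<beta>: "0 < \<beta>" "\<beta> \<le> 1" using \<alpha> by (auto simp: \<beta>_def)
  have M: "0 \<le> M" using bmeas_nonneg[OF \<phi>] t by simp
  define s where "s = volterra a b (rl_kernel \<alpha>) \<phi>"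
  define y where "y u = integral {a..u} \<phi>" for u
  obtain S where bs: "bmeas a b S s"
    using volterra_bmeas[OF vkernel_rl[OF \<alpha>(1)] rl_kernel_antimono[OF \<alpha>(1) \<alpha>1] \<phi>] unfolding s_def by blast
  \<comment> \<open>These steps divide \<open>t - a\<close>, so the grid through \<open>t\<close> reaches \<open>a\<close>, where the convolution vanishes; thus
    the last, degenerate cell causes no error.\<close>
  define h where "h n = (t - a) * inverse (real (Suc n))" for n
  have h: "0 < h n" for n using ta by (simp add: h_def)
  have h0: "h \<longlonglongrightarrow> 0" unfolding h_def
    using tendsto_mult_right_zero[OF LIMSEQ_inverse_real_of_nat, of "t - a"] by simp
  define err where "err n = gl_error \<alpha> (b - a) M (h n)" for n
  have err0: "err \<longlonglongrightarrow> 0" unfolding err_def by (rule gl_error_tendsto[OF \<alpha>(1) \<alpha>1 h h0])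
  have est: "norm (y t - volterra a b (gl_kernel \<beta> (h N)) s t) \<le> volterra a b (gl_kernel \<beta> (h N)) (\<lambda>_. 1) t * err N" for N
  proof -
    define m where "m = Suc N"
    define d where "d = h N"
    have d: "0 < d" using h by (simp add: d_def)
    have md: "real m * d = t - a" by (simp add: m_def d_def h_def)
    have jd: "real j * d \<le> t - a" if "j \<le> m" for j
      using mult_right_mono[of "real j" "real m" d] that d md by simp
    have e0: "0 \<le> err N" unfolding err_def using t by (intro gl_error_nonneg \<alpha> \<alpha>1 h M) auto
    define sh where "sh = volterra a b (gl_kernel \<alpha> d) \<phi>"
    define c where "c i = (- 1) ^ i * (\<beta> gchoose i)" for i
    have sh: "d powr (1 - \<alpha>) *\<^sub>R sh (t - real j * d) = (\<Sum>i\<le>m - j. c i *\<^sub>R y (t - real (j + i) * d))" if j: "j \<le> m" for j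
    proof -
      have in_ab: "t - real j * d \<in> {a..b}" using jd[OF j] t d by (auto intro: order_trans[of _ t])
      have "(t - real j * d - a) / d = real (m - j)"
        using md d j by (simp add: field_simps of_nat_diff)
      then have fl: "nat \<lfloor>(t - real j * d - a) / d\<rfloor> = m - j" by simp
      have "sh (t - real j * d) = approx_state a \<alpha> 0 d y (t - real j * d)"
        unfolding sh_def using approx_state_eq_volterra[OF \<alpha> d \<phi> in_ab, of y 0] by (simp add: y_def)
      also have "\<dots> = d powr (\<alpha> - 1) *\<^sub>R (\<Sum>i\<le>m - j. c i *\<^sub>R y (t - real j * d - real i * d))"
        unfolding approx_state_def frac_diff_def fl by (simp add: c_def \<beta>_def atLeast0AtMost)
      also have "d powr (1 - \<alpha>) *\<^sub>R \<dots> = (\<Sum>i\<le>m - j. c i *\<^sub>R y (t - real j * d - real i * d))"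
        using d by (simp add: powr_add[symmetric])
      finally show ?thesis by (simp add: algebra_simps)
    qed
    have "(\<Sum>j\<le>m. gl_weight \<beta> j *\<^sub>R (d powr (1 - \<alpha>) *\<^sub>R sh (t - real j * d)))
        = (\<Sum>j\<le>m. \<Sum>i\<le>m - j. (gl_weight \<beta> j * c i) *\<^sub>R y (t - real (j + i) * d))"
      by (rule sum.cong) (auto simp: sh scaleR_sum_right simp del: of_nat_add)
    also have "\<dots> = (\<Sum>k\<le>m. \<Sum>j\<le>k. (gl_weight \<beta> j * c (k - j)) *\<^sub>R y (t - real (j + (k - j)) * d))"
    proof -
      define g where "g j i = (gl_weight \<beta> j * c i) *\<^sub>R y (t - real (j + i) * d)" for j i
      have "(\<Sum>j\<le>m. \<Sum>i\<le>m - j. g j i) = (\<Sum>(j, i)\<in>Sigma {..m} (\<lambda>j. {..m - j}). g j i)"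
        by (simp add: sum.Sigma)
      also have "Sigma {..m} (\<lambda>j. {..m - j}) = {(i, j). i + j \<le> m}" by auto
      also have "(\<Sum>(j, i)\<in>{(i, j). i + j \<le> m}. g j i) = (\<Sum>k\<le>m. \<Sum>j\<le>k. g j (k - j))"
        by (rule sum.triangle_reindex_eq)
      finally show ?thesis by (simp only: g_def)
    qed
    also have "\<dots> = (\<Sum>k\<le>m. (\<Sum>i\<le>k. c i * gl_weight \<beta> (k - i)) *\<^sub>R y (t - real k * d))"
    proof (rule sum.cong)
      fix k
      have "(\<Sum>j\<le>k. (gl_weight \<beta> j * c (k - j)) *\<^sub>R y (t - real (j + (k - j)) * d)) = (\<Sum>j\<le>k. gl_weight \<beta> j * c (k - j)) *\<^sub>R y (t - real k * d)"
        by (simp add: scaleR_sum_left)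
      also have "(\<Sum>j\<le>k. gl_weight \<beta> j * c (k - j)) = (\<Sum>i\<le>k. c i * gl_weight \<beta> (k - i))"
        by (rule sum.reindex_bij_witness[of _ "\<lambda>i. k - i" "\<lambda>i. k - i"]) auto
      finally show "(\<Sum>j\<le>k. (gl_weight \<beta> j * c (k - j)) *\<^sub>R y (t - real (j + (k - j)) * d)) = (\<Sum>i\<le>k. c i * gl_weight \<beta> (k - i)) *\<^sub>R y (t - real k * d)" .
    qed simp
    also have "\<dots> = (\<Sum>k\<le>m. if k = 0 then y t else 0)"
      using gl_inverse_weights(2)[OF \<beta>] by (intro sum.cong) (auto simp: c_def)
    also have "\<dots> = y t" by simp
    finally have yt: "y t = (\<Sum>j\<le>m. gl_weight \<beta> j *\<^sub>R (d powr (1 - \<alpha>) *\<^sub>R sh (t - real j * d)))" by simp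
    define I where "I j = {\<tau>. \<tau> < t \<and> nat \<lfloor>(t - \<tau>) / d\<rfloor> = j}" for j
    \<comment> \<open>\<open>Q\<close> is the function of \<open>\<tau>\<close> that agrees with the integrand of the convolution of \<open>gl_kernel \<beta> d\<close> and \<open>s\<close>, but with
      \<open>s\<close> replaced by the discrete convolution sampled at the grid; its integral is exactly \<open>y t\<close>.\<close>
    define v where "v j = (d powr (\<beta> - 1) * gl_weight \<beta> j) *\<^sub>R sh (t - real j * d)" for j
    have int_cell: "((\<lambda>\<tau>. indicator (I j) \<tau> *\<^sub>R v j) has_integral gl_weight \<beta> j *\<^sub>R (d powr (1 - \<alpha>) *\<^sub>R sh (t - real j * d))) {a..b}" if j: "j \<le> m" for j
    proof (cases "j = m")
      case True
      then have "sh (t - real j * d) = 0" using md volterra_at_start[OF vkernel_gl[OF \<alpha>(1) \<alpha>1 d]] by (simp add: sh_def)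
      then show ?thesis by (simp add: v_def)
    next
      case False
      then have "real (Suc j) * d \<le> t - a" using j by (intro jd) simp
      then have 1: "((\<lambda>\<tau>. indicator (I j) \<tau>) has_integral d) {a..b}"
        unfolding I_def by (intro integral_indicator_cell) (use t d in \<open>auto simp: algebra_simps\<close>)
      have "d * d powr (\<beta> - 1) = d powr (1 - \<alpha>)"
        using d by (simp add: \<beta>_def powr_mult_base)
      then have "d *\<^sub>R v j = gl_weight \<beta> j *\<^sub>R (d powr (1 - \<alpha>) *\<^sub>R sh (t - real j * d))"
        by (simp add: v_def mult_ac)
      then show ?thesis using has_integral_scaleR_left[OF 1, of "v j"] by simp
    qed
    define Q where "Q \<tau> = (\<Sum>j\<le>m. indicator (I j) \<tau> *\<^sub>R v j)" for \<tau>
    have Q: "(Q has_integral y t) {a..b}"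
      unfolding Q_def yt by (rule has_integral_sum) (use int_cell in auto)
    have V: "((\<lambda>\<tau>. gl_kernel \<beta> d (t - \<tau>) *\<^sub>R s \<tau>) has_integral volterra a b (gl_kernel \<beta> d) s t) {a..b}"
      unfolding volterra_def by (rule integrable_integral[OF volterra_integrable_on[OF vkernel_gl[OF \<beta> d] bs]])
    have "norm (y t - volterra a b (gl_kernel \<beta> d) s t) = norm (integral {a..b} (\<lambda>\<tau>. Q \<tau> - gl_kernel \<beta> d (t - \<tau>) *\<^sub>R s \<tau>))"
      using integral_unique[OF has_integral_diff[OF Q V]] by simp
    also have "\<dots> \<le> integral {a..b} (\<lambda>\<tau>. gl_kernel \<beta> d (t - \<tau>) *\<^sub>R err N)"
    proof (rule integral_norm_bound_integral)
      show "(\<lambda>\<tau>. Q \<tau> - gl_kernel \<beta> d (t - \<tau>) *\<^sub>R s \<tau>) integrable_on {a..b}"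
        using has_integral_diff[OF Q V] by blast
      show "(\<lambda>\<tau>. gl_kernel \<beta> d (t - \<tau>) *\<^sub>R err N) integrable_on {a..b}"
        by (rule volterra_integrable_on[OF vkernel_gl[OF \<beta> d] bmeas_const[OF order_refl]])
      fix \<tau> assume \<tau>: "\<tau> \<in> {a..b}"
      show "norm (Q \<tau> - gl_kernel \<beta> d (t - \<tau>) *\<^sub>R s \<tau>) \<le> gl_kernel \<beta> d (t - \<tau>) *\<^sub>R err N"
      proof (cases "\<tau> < t")
        case True
        define j where "j = nat \<lfloor>(t - \<tau>) / d\<rfloor>"
        have "(t - \<tau>) / d \<le> real m" using md \<tau> d by (simp add: field_simps)
        then have jm: "j \<le> m" unfolding j_def by (simp add: nat_le_iff floor_le_iff)
        have "Q \<tau> = (\<Sum>i\<in>{j}. indicator (I i) \<tau> *\<^sub>R v i)"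
          unfolding Q_def by (rule sum.mono_neutral_right) (use jm in \<open>auto simp: I_def j_def\<close>)
        also have "\<dots> = gl_kernel \<beta> d (t - \<tau>) *\<^sub>R sh (t - real j * d)"
          using True by (simp add: I_def v_def gl_kernel_def j_def)
        finally have "Q \<tau> - gl_kernel \<beta> d (t - \<tau>) *\<^sub>R s \<tau> = gl_kernel \<beta> d (t - \<tau>) *\<^sub>R (sh (t - real j * d) - s \<tau>)"
          by (simp add: scaleR_diff_right)
        moreover have "norm (sh (t - real j * d) - s \<tau>) \<le> err N"
          unfolding sh_def s_def err_def d_def[symmetric]
          by (rule gl_sampling_error[OF \<alpha>(1) \<alpha>1 \<phi> t d \<tau> True j_def])
        ultimately show ?thesis using gl_kernel_nonneg[OF \<beta>(1), of d "t - \<tau>"] by (simp add: mult_left_mono)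
      next
        case False
        then have "Q \<tau> = 0" unfolding Q_def by (intro sum.neutral) (auto simp: I_def)
        then show ?thesis using False by (simp add: gl_kernel_def)
      qed
    qed
    also have "\<dots> = volterra a b (gl_kernel \<beta> d) (\<lambda>_. 1) t * err N"
      using volterra_cmul[of a b "gl_kernel \<beta> d" "err N" "\<lambda>_. 1" t] by (simp add: volterra_def mult.commute)
    finally show ?thesis by (simp add: d_def)
  qed
  have "(\<lambda>N. y t - volterra a b (gl_kernel \<beta> (h N)) s t) \<longlonglongrightarrow> 0"
  proof (rule Lim_null_comparison)
    show "\<forall>\<^sub>F N in sequentially. norm (y t - volterra a b (gl_kernel \<beta> (h N)) s t) \<le> volterra a b (gl_kernel \<beta> (h N)) (\<lambda>_. 1) t * err N"
      using est by simp
    have "(\<lambda>N. volterra a b (gl_kernel \<beta> (h N)) (\<lambda>_. 1) t * err N) \<longlonglongrightarrow> volterra a b (rl_kernel \<beta>) (\<lambda>_. 1) t * 0"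
      by (intro tendsto_mult err0 volterra_gl_kernel_tendsto[OF \<beta> h h0 bmeas_const[of 1 1] t]) simp
    then show "(\<lambda>N. volterra a b (gl_kernel \<beta> (h N)) (\<lambda>_. 1) t * err N) \<longlonglongrightarrow> 0" by simp
  qed
  moreover have "(\<lambda>N. y t - volterra a b (gl_kernel \<beta> (h N)) s t) \<longlonglongrightarrow> y t - volterra a b (rl_kernel \<beta>) s t"
    by (intro tendsto_intros volterra_gl_kernel_tendsto[OF \<beta> h h0 bs t])
  ultimately have "y t - volterra a b (rl_kernel \<beta>) s t = 0" using LIMSEQ_unique by blast
  then show ?thesis by (simp add: y_def s_def \<beta>_def)
qed

section \<open>Admissible positions\<close>

text \<open>
  If \<open>w = w(t0) + I\<^sup>\<alpha> \<phi>\<close>, then \<open>I\<^sup>1\<^sup>-\<^sup>\<alpha> (w - w(t0))\<close> is the integral of \<open>\<phi>\<close>, so \<open>\<phi>\<close> is the Caputo derivative of \<open>w\<close>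
  almost everywhere. The growth condition on the latter and a Gronwall argument bound \<open>w\<close>, and then \<open>\<phi>\<close>,
  by constants that depend on the data of the class only.
\<close>

lemma admissible_position_normal_form:
  fixes t0 \<theta> \<alpha> c R0 :: real
  assumes \<alpha>: "0 < \<alpha>" "\<alpha> < 1" and c: "0 < c" and R0: "0 < R0"
  obtains M where "0 \<le> M" "\<And>ts ws. (ts, ws) \<in> (admissible_positions t0 \<theta> \<alpha> c R0 :: (real \<times> (real \<Rightarrow> real ^ 'n)) set) \<Longrightarrow>
    ts \<in> {t0..\<theta>} \<and> ws t0 \<in> cball 0 R0 \<and> (\<exists>\<phi>. bmeas t0 ts M \<phi> \<and>
      (\<forall>t\<in>{t0..ts}. rl_integral t0 (1 - \<alpha>) (\<lambda>t. ws t - ws t0) t = integral {t0..t} \<phi>))"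
proof -
  have \<alpha>1: "\<alpha> \<le> 1" using \<alpha> by simp
  define T where "T = \<theta> - t0"
  define K where "K \<tau> = c * rl_kernel \<alpha> \<tau>" for \<tau>
  have kr: "vkernel (rl_kernel \<alpha>)" by (rule vkernel_rl[OF \<alpha>(1)])
  have K: "vkernel K" unfolding K_def using vkernel_cmul[OF kr, of c] c by simp
  obtain G where G: "0 < G" and gf: "gronwall_factor K T G" by (rule volterra_gronwall[OF K])
  define A where "A = R0 + c * mass (rl_kernel \<alpha>) \<bar>T\<bar>"
  have A: "0 \<le> A" unfolding A_def using R0 c mass_nonneg[OF kr] by simp
  define M where "M = (1 + G * A) * c"
  have M: "0 \<le> M" unfolding M_def using A G c by simp
  show thesis
  proof (rule that[OF M])
    fix ts and ws :: "real \<Rightarrow> real ^ 'n" assume "(ts, ws) \<in> admissible_positions t0 \<theta> \<alpha> c R0"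
    then obtain \<phi>0 where ts: "ts \<in> {t0..\<theta>}" and ws: "continuous_on {t0..ts} ws" and w0: "ws t0 \<in> cball 0 R0"
      and \<phi>0: "\<phi>0 \<in> Linf t0 ts" and rep: "\<And>\<tau>. \<tau> \<in> {t0..ts} \<Longrightarrow> ws \<tau> = ws t0 + rl_integral t0 \<alpha> \<phi>0 \<tau>"
      and cap: "AE \<tau> in lebesgue_on {t0..ts}. norm (caputo_deriv t0 ts \<alpha> ws \<tau>) \<le> (1 + norm (ws \<tau>)) * c"
    proof -
      assume a: "\<And>\<phi>0. \<lbrakk>ts \<in> {t0..\<theta>}; continuous_on {t0..ts} ws; ws t0 \<in> cball 0 R0; \<phi>0 \<in> Linf t0 ts;
          \<And>\<tau>. \<tau> \<in> {t0..ts} \<Longrightarrow> ws \<tau> = ws t0 + rl_integral t0 \<alpha> \<phi>0 \<tau>;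
          AE \<tau> in lebesgue_on {t0..ts}. norm (caputo_deriv t0 ts \<alpha> ws \<tau>) \<le> (1 + norm (ws \<tau>)) * c\<rbrakk> \<Longrightarrow> thesis"
      assume "(ts, ws) \<in> admissible_positions t0 \<theta> \<alpha> c R0"
      then have "ts \<in> {t0..\<theta>} \<and> continuous_on {t0..ts} ws \<and> ws t0 \<in> cball 0 R0 \<and>
          (\<exists>\<phi>\<in>Linf t0 ts. \<forall>\<tau>\<in>{t0..ts}. ws \<tau> = ws t0 + rl_integral t0 \<alpha> \<phi> \<tau>) \<and>
          (AE \<tau> in lebesgue_on {t0..ts}. norm (caputo_deriv t0 ts \<alpha> ws \<tau>) \<le> (1 + norm (ws \<tau>)) * c)"
        unfolding admissible_positions_def positions_def mem_Collect_eq prod.case by (elim conjE) (intro conjI)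
      then show thesis using a by meson
    qed
    obtain B where \<phi>0m: "\<phi>0 \<in> borel_measurable (lebesgue_on {t0..ts})" and "AE t in lebesgue_on {t0..ts}. norm (\<phi>0 t) \<le> B"
      using \<phi>0 by (auto simp: Linf_def)
    then obtain N0 where N0: "negligible N0" "\<And>t. t \<in> {t0..ts} - N0 \<Longrightarrow> norm (\<phi>0 t) \<le> max B 0"
      unfolding AE_lebesgue_on_interval_iff by (meson le_max_iff_disj)
    \<comment> \<open>A version of the density that is bounded at every point.\<close>
    define \<phi>1 where "\<phi>1 t = (if t \<in> N0 then 0 else \<phi>0 t)" for t
    have b1: "bmeas t0 ts (max B 0) \<phi>1" unfolding \<phi>1_def by (rule bmeas_spike[OF \<phi>0m N0]) auto
    define s where "s = volterra t0 ts (rl_kernel \<alpha>) \<phi>1"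
    have s_eq: "ws \<tau> - ws t0 = s \<tau>" if "\<tau> \<in> {t0..ts}" for \<tau>
    proof -
      have "rl_integral t0 \<alpha> \<phi>0 \<tau> = s \<tau>"
        unfolding s_def by (rule rl_integral_eq_volterra[OF \<alpha>(1) b1 N0(1) _ that]) (simp add: \<phi>1_def)
      then show ?thesis using rep[OF that] by simp
    qed
    obtain S where bs: "bmeas t0 ts S s" using volterra_bmeas[OF kr rl_kernel_antimono[OF \<alpha>(1) \<alpha>1] b1] unfolding s_def by blast
    have r_eq: "rl_integral t0 (1 - \<alpha>) (\<lambda>t. ws t - ws t0) t = integral {t0..t} \<phi>1" if "t \<in> {t0..ts}" for t
    proof -
      have "rl_integral t0 (1 - \<alpha>) (\<lambda>t. ws t - ws t0) t = volterra t0 ts (rl_kernel (1 - \<alpha>)) s t"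
        by (rule rl_integral_eq_volterra[OF _ bs negligible_empty _ that]) (use s_eq \<alpha> in auto)
      also have "\<dots> = integral {t0..t} \<phi>1" unfolding s_def by (rule rl_semigroup[OF \<alpha> b1 that])
      finally show ?thesis .
    qed
    show "ts \<in> {t0..\<theta>} \<and> ws t0 \<in> cball 0 R0 \<and> (\<exists>\<phi>. bmeas t0 ts M \<phi> \<and>
      (\<forall>t\<in>{t0..ts}. rl_integral t0 (1 - \<alpha>) (\<lambda>t. ws t - ws t0) t = integral {t0..t} \<phi>))"
    \<comment> \<open>Over a single point the derivative that defines the Caputo derivative is meaningless.\<close>
    proof (cases "ts = t0")
      case True
      have "bmeas t0 ts M (\<lambda>_. 0::real^'n)" using M by (simp add: bmeas_const)
      moreover have "rl_integral t0 (1 - \<alpha>) (\<lambda>t. ws t - ws t0) t = integral {t0..t} (\<lambda>_. 0)" if "t \<in> {t0..ts}" for t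
        using r_eq[OF that] that True by simp
      ultimately show ?thesis using ts w0 by blast
    next
      case False
      then have t0s: "t0 < ts" using ts by simp
      obtain N1 where N1: "negligible N1" and der: "\<And>t. t \<in> {t0..ts} - N1 \<Longrightarrow>
          ((\<lambda>u. integral {t0..u} \<phi>1) has_vector_derivative \<phi>1 t) (at t within {t0..ts})"
        using indefinite_integral_has_derivative_AE[OF set_lebesgue_integral_eq_integral(1)[OF bmeas_integrable[OF b1]]] by blast
      obtain N2 where N2: "negligible N2" "\<And>t. t \<in> {t0..ts} - N2 \<Longrightarrow> norm (caputo_deriv t0 ts \<alpha> ws t) \<le> (1 + norm (ws t)) * c"
        using cap unfolding AE_lebesgue_on_interval_iff by blast
      define N where "N = N1 \<union> N2"
      have N: "negligible N" using N1 N2 by (simp add: N_def)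
      have bound: "norm (\<phi>1 t) \<le> (1 + norm (ws t)) * c" if t: "t \<in> {t0..ts} - N" for t
      proof -
        have "(rl_integral t0 (1 - \<alpha>) (\<lambda>t. ws t - ws t0) has_vector_derivative \<phi>1 t) (at t within {t0..ts})"
          by (rule has_vector_derivative_transform[OF _ _ der]) (use t r_eq in \<open>auto simp: N_def\<close>)
        then have "vector_derivative (rl_integral t0 (1 - \<alpha>) (\<lambda>t. ws t - ws t0)) (at t within {t0..ts}) = \<phi>1 t"
          using vector_derivative_within_cbox[of t0 ts t] t0s t by auto
        then have "caputo_deriv t0 ts \<alpha> ws t = \<phi>1 t" by (simp add: caputo_deriv_def rl_deriv_def)
        then show ?thesis using N2(2)[of t] t by (auto simp: N_def)
      qed
      define \<phi> where "\<phi> t = (if t \<in> N then 0 else \<phi>1 t)" for t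
      obtain W where W: "0 \<le> W" "bmeas t0 ts W ws" using bmeas_continuous[OF ws] by blast
      have b\<phi>0: "bmeas t0 ts ((1 + W) * c) \<phi>" unfolding \<phi>_def
      proof (rule bmeas_spike[OF _ N])
        show "norm (\<phi>1 t) \<le> (1 + W) * c" if "t \<in> {t0..ts} - N" for t
          using order_trans[OF bound[OF that] mult_right_mono[of "1 + norm (ws t)" "1 + W" c]] W(2) that c by (auto simp: bmeas_def)
      qed (use b1 W c in \<open>auto simp: bmeas_def\<close>)
      have \<phi>_le: "norm (\<phi> t) \<le> (1 + norm (ws t)) * c" if "t \<in> {t0..ts}" for t
        using bound[of t] that c by (auto simp: \<phi>_def)
      have s_\<phi>: "s t = volterra t0 ts (rl_kernel \<alpha>) \<phi> t" for t unfolding s_def by (rule volterra_spike[OF N]) (simp add: \<phi>_def)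
      have e_cont: "continuous_on {t0..ts} (\<lambda>t. norm (ws t))" by (intro continuous_intros ws)
      obtain E where E: "bmeas t0 ts E (\<lambda>t. norm (ws t))" using bmeas_continuous[OF e_cont] by blast
      obtain E' where E': "bmeas t0 ts E' (\<lambda>t. (1 + norm (ws t)) * c)"
        by (rule bmeas_continuous[of t0 ts "\<lambda>t. (1 + norm (ws t)) * c"]) (auto intro!: continuous_intros ws)
      obtain E'' where E'': "bmeas t0 ts E'' (\<lambda>t. norm (ws t) * c)"
        by (rule bmeas_continuous[of t0 ts "\<lambda>t. norm (ws t) * c"]) (auto intro!: continuous_intros ws)
      have "exp_subsolution t0 ts K A (\<lambda>t. norm (ws t))"
      proof (rule volterra_exp_subsolution[OF K e_cont])
        fix t assume t: "t \<in> {t0..ts}"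
        have "norm (ws t) \<le> norm (ws t0) + norm (s t)"
          using norm_triangle_ineq[of "ws t0" "s t"] unfolding s_eq[OF t, symmetric] by simp
        also have "norm (s t) \<le> volterra t0 ts (rl_kernel \<alpha>) (\<lambda>t. (1 + norm (ws t)) * c) t"
          unfolding s_\<phi> by (rule volterra_norm_le[OF kr b\<phi>0 E' \<phi>_le])
        also have "(\<lambda>t. (1 + norm (ws t)) * c) = (\<lambda>t. c + norm (ws t) * c)" by (simp add: algebra_simps)
        also have "volterra t0 ts (rl_kernel \<alpha>) (\<lambda>t. c + norm (ws t) * c) t = volterra t0 ts (rl_kernel \<alpha>) (\<lambda>t. c) t + volterra t0 ts (rl_kernel \<alpha>) (\<lambda>t. norm (ws t) * c) t"
          by (rule volterra_add[OF kr bmeas_const[of c "norm c"] E'']) simp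
        also have "volterra t0 ts (rl_kernel \<alpha>) (\<lambda>t. c) t = mass (rl_kernel \<alpha>) (t - t0) * c" using volterra_const[OF kr, of t ts t0 c] t by simp
        also have "\<dots> \<le> mass (rl_kernel \<alpha>) \<bar>T\<bar> * c"
          using t ts c by (intro mult_right_mono mass_mono[OF kr]) (auto simp: T_def)
        also have "volterra t0 ts (rl_kernel \<alpha>) (\<lambda>t. norm (ws t) * c) t = volterra t0 ts K (\<lambda>t. norm (ws t)) t"
          by (simp add: volterra_def K_def mult_ac)
        finally show "norm (ws t) \<le> A + volterra t0 ts K (\<lambda>t. norm (ws t)) t"
          using w0 by (simp add: A_def mult.commute)
      qed
      from gronwall_factorD[OF gf this _ _ e_cont A]
      have w_le: "norm (ws t) \<le> G * A" if "t \<in> {t0..ts}" for t using ts that by (simp add: T_def)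
      have "bmeas t0 ts M \<phi>"
        unfolding bmeas_def
      proof (intro conjI ballI)
        show "\<phi> \<in> borel_measurable (lebesgue_on {t0..ts})" using b\<phi>0 by (simp add: bmeas_def)
        show "norm (\<phi> t) \<le> M" if "t \<in> {t0..ts}" for t
          using order_trans[OF \<phi>_le[OF that] mult_right_mono[of "1 + norm (ws t)" "1 + G * A" c]] w_le[OF that] c by (simp add: M_def)
      qed
      moreover have "rl_integral t0 (1 - \<alpha>) (\<lambda>t. ws t - ws t0) t = integral {t0..t} \<phi>" if "t \<in> {t0..ts}" for t
        unfolding r_eq[OF that] by (rule integral_spike[OF N]) (simp add: \<phi>_def)
      ultimately show ?thesis using ts w0 by blast
    qed
  qed
qed

section \<open>Motions of the approximating system\<close>

text \<open>
  The number of summands of the difference jumps at the points \<open>a + i * h\<close>, but the summand that enters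
  there has the value \<open>y a = 0\<close>. Extended by \<open>0\<close> to the left of \<open>a\<close>, the same number of summands serves
  for all times.
\<close>

lemma approx_state_continuous:
  fixes y :: "real \<Rightarrow> real ^ 'n"
  assumes h: "0 < h" and y: "continuous_on {a..b} y" and ya: "y a = 0"
  shows "continuous_on {a..b} (approx_state a \<alpha> w0 h y)"
proof -
  define n where "n = nat \<lfloor>(b - a) / h\<rfloor>"
  define E where "E t = y (max a (min t b))" for t
  define D where "D t = w0 + h powr (\<alpha> - 1) *\<^sub>R (\<Sum>i = 0..n. ((- 1) ^ i * ((1 - \<alpha>) gchoose i)) *\<^sub>R E (t - real i * h))" for t
  show ?thesis
  proof (cases "a \<le> b")
    case ab: True
    have E: "continuous_on UNIV E"
      unfolding E_def by (rule continuous_on_compose2[OF y]) (use ab in \<open>auto intro!: continuous_intros\<close>)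
    have "continuous_on {a..b} D"
      unfolding D_def by (intro continuous_intros continuous_on_compose2[OF E]) auto
    moreover have "approx_state a \<alpha> w0 h y t = D t" if t: "t \<in> {a..b}" for t
    proof -
      define k where "k = nat \<lfloor>(t - a) / h\<rfloor>"
      have kn: "k \<le> n" unfolding k_def n_def using t h by (intro nat_mono floor_mono divide_right_mono) auto
      have iff: "i \<le> k \<longleftrightarrow> a \<le> t - real i * h" for i
      proof -
        have "i \<le> k \<longleftrightarrow> real i \<le> (t - a) / h" unfolding k_def using t h by (simp add: le_nat_iff le_floor_iff)
        also have "\<dots> \<longleftrightarrow> a \<le> t - real i * h" using h by (simp add: field_simps)
        finally show ?thesis .
      qed
      have "(\<Sum>i = 0..n. ((- 1) ^ i * ((1 - \<alpha>) gchoose i)) *\<^sub>R E (t - real i * h))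
          = (\<Sum>i = 0..k. ((- 1) ^ i * ((1 - \<alpha>) gchoose i)) *\<^sub>R y (t - real i * h))"
      proof (rule sum.mono_neutral_cong_right)
        show "\<forall>i\<in>{0..n} - {0..k}. ((- 1) ^ i * ((1 - \<alpha>) gchoose i)) *\<^sub>R E (t - real i * h) = 0"
        proof
          fix i assume "i \<in> {0..n} - {0..k}"
          then have "t - real i * h < a" using iff[of i] by auto
          then have "E (t - real i * h) = 0" using ab ya by (simp add: E_def)
          then show "((- 1) ^ i * ((1 - \<alpha>) gchoose i)) *\<^sub>R E (t - real i * h) = 0" by simp
        qed
        fix i assume "i \<in> {0..k}"
        then have "a \<le> t - real i * h" using iff by auto
        moreover have "t - real i * h \<le> t" using h by simp
        ultimately show "((- 1) ^ i * ((1 - \<alpha>) gchoose i)) *\<^sub>R E (t - real i * h) = ((- 1) ^ i * ((1 - \<alpha>) gchoose i)) *\<^sub>R y (t - real i * h)"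
          using t by (simp add: E_def min_def max_def)
      qed (use kn in auto)
      then show ?thesis by (simp add: approx_state_def frac_diff_def D_def k_def)
    qed
    ultimately show ?thesis by (metis (no_types, lifting) continuous_on_cong)
  qed simp
qed

text \<open>
  The derivative of the motion on the whole interval: that of the given initial piece up to \<open>ts\<close>, then the
  right-hand side of the system. At \<open>\<theta>\<close>, where controls may have values outside \<open>U\<close> and \<open>V\<close>, and later it
  is \<open>0\<close>.
\<close>

definition velocity :: "real \<Rightarrow> real \<Rightarrow> real \<Rightarrow> (real \<Rightarrow> real ^ 'n \<Rightarrow> real ^ 'r \<Rightarrow> real ^ 's \<Rightarrow> real ^ 'n) \<Rightarrow> real ^ 'n \<Rightarrow> real
   \<Rightarrow> real \<Rightarrow> (real \<Rightarrow> real ^ 'n) \<Rightarrow> (real \<Rightarrow> real ^ 'r) \<Rightarrow> (real \<Rightarrow> real ^ 's) \<Rightarrow> (real \<Rightarrow> real ^ 'n) \<Rightarrow> real \<Rightarrow> real ^ 'n" where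
  "velocity t0 \<theta> \<alpha> f w0 h ts \<phi> p q y \<tau> =
     (if \<tau> \<le> ts then \<phi> \<tau> else if \<tau> < \<theta> then f \<tau> (approx_state t0 \<alpha> w0 h y \<tau>) (p \<tau>) (q \<tau>) else 0)"

locale approx_system =
  fixes t0 \<theta> \<alpha> c :: real
    and U :: "(real ^ 'r) set" and V :: "(real ^ 's) set"
    and f :: "real \<Rightarrow> real ^ 'n \<Rightarrow> real ^ 'r \<Rightarrow> real ^ 's \<Rightarrow> real ^ 'n"
  assumes t0\<theta>: "t0 < \<theta>" and \<alpha>0: "0 < \<alpha>" and \<alpha>1: "\<alpha> < 1"
    and U: "compact U" "U \<noteq> {}" and V: "compact V" "V \<noteq> {}"
    and f_cont: "continuous_on ({t0..\<theta>} \<times> UNIV \<times> U \<times> V) (\<lambda>(t, x, u, v). f t x u v)"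
    and f_lip: "\<forall>R\<ge>0. \<exists>L>0. \<forall>t\<in>{t0..\<theta>}. \<forall>x\<in>cball 0 R. \<forall>x'\<in>cball 0 R. \<forall>u\<in>U. \<forall>v\<in>V.
         norm (f t x u v - f t x' u v) \<le> L * norm (x - x')"
    and c: "0 < c"
    and f_growth: "\<forall>t\<in>{t0..\<theta>}. \<forall>x. \<forall>u\<in>U. \<forall>v\<in>V. norm (f t x u v) \<le> (1 + norm x) * c"
begin

lemma \<alpha>1': "\<alpha> \<le> 1" using \<alpha>1 by simp

lemma velocity_measurable:
  assumes h: "0 < h" and ts: "ts \<in> {t0..\<theta>}" and \<phi>: "bmeas t0 ts M \<phi>"
    and p: "p \<in> controls ts \<theta> U" and q: "q \<in> controls ts \<theta> V"
    and y: "continuous_on {t0..\<theta>} y" and y0: "y t0 = 0"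
  shows "velocity t0 \<theta> \<alpha> f w0 h ts \<phi> p q y \<in> borel_measurable (lebesgue_on {t0..\<theta>})"
proof -
  define x where "x = approx_state t0 \<alpha> w0 h y"
  have x: "continuous_on {t0..\<theta>} x" unfolding x_def by (rule approx_state_continuous[OF h y y0])
  define D where "D = {t0..\<theta>} \<times> (UNIV :: (real^'n) set) \<times> U \<times> V"
  \<comment> \<open>\<open>U\<close> and \<open>V\<close> are closed, so the extension of the right-hand side by \<open>0\<close> is Borel.\<close>
  define F where "F z = (if z \<in> D then (case z of (t, x, u, v) \<Rightarrow> f t x u v) else 0)" for z
  have D: "closed D" unfolding D_def by (simp add: closed_Times compact_imp_closed U V)
  have F: "F \<in> borel_measurable borel"
    unfolding F_def by (rule borel_measurable_continuous_on_if) (use D f_cont in \<open>auto simp: D_def\<close>)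
  have pm: "p \<in> borel_measurable (lebesgue_on {ts..<\<theta>})" and qm: "q \<in> borel_measurable (lebesgue_on {ts..<\<theta>})"
    using p q by (auto simp: controls_def)
  have xm: "x \<in> borel_measurable (lebesgue_on {ts..<\<theta>})"
  proof (rule measurable_restrict_mono)
    show "x \<in> borel_measurable (lebesgue_on {t0..\<theta>})"
      by (intro continuous_imp_measurable_on_sets_lebesgue x) auto
  qed (use ts in auto)
  have tm: "(\<lambda>t::real. t) \<in> borel_measurable (lebesgue_on {ts..<\<theta>})"
    by (intro continuous_imp_measurable_on_sets_lebesgue continuous_intros) auto
  have "(\<lambda>t. F (t, x t, p t, q t)) \<in> borel_measurable (lebesgue_on {ts..<\<theta>})"
  proof (rule measurable_compose[OF _ F])
    show "(\<lambda>t. (t, x t, p t, q t)) \<in> borel_measurable (lebesgue_on {ts..<\<theta>})"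
      by (intro borel_measurable_Pair tm xm pm qm)
  qed
  moreover have "F (t, x t, p t, q t) = f t (x t) (p t) (q t)" if "t \<in> {ts..<\<theta>}" for t
    using that p q ts by (auto simp: F_def D_def controls_def)
  ultimately have fm: "(\<lambda>t. f t (x t) (p t) (q t)) \<in> borel_measurable (lebesgue_on {ts..<\<theta>})"
    by (subst measurable_cong[where g="\<lambda>t. F (t, x t, p t, q t)"]) auto
  have ext: "(\<lambda>t. if t \<in> S then g t else 0) \<in> borel_measurable lebesgue"
    if "g \<in> borel_measurable (lebesgue_on S)" "S \<in> sets lebesgue" for g :: "real \<Rightarrow> real^'n" and S
    using that borel_measurable_if by blast
  have "(\<lambda>t. (if t \<in> {t0..ts} then \<phi> t else 0) + (if t \<in> {ts..<\<theta>} - {ts} then f t (x t) (p t) (q t) else 0)) \<in> borel_measurable lebesgue"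
    by (intro borel_measurable_add ext measurable_restrict_mono[OF fm]) (use \<phi> in \<open>auto simp: bmeas_def\<close>)
  then have "(\<lambda>t. (if t \<in> {t0..ts} then \<phi> t else 0) + (if t \<in> {ts..<\<theta>} - {ts} then f t (x t) (p t) (q t) else 0)) \<in> borel_measurable (lebesgue_on {t0..\<theta>})"
    by (rule measurable_restrict_space1)
  then show ?thesis
    by (subst measurable_cong[where g="\<lambda>t. (if t \<in> {t0..ts} then \<phi> t else 0) + (if t \<in> {ts..<\<theta>} - {ts} then f t (x t) (p t) (q t) else 0)"])
       (auto simp: velocity_def x_def)
qed

lemma velocity_norm_le:
  assumes ts: "ts \<in> {t0..\<theta>}" and \<phi>: "bmeas t0 ts M \<phi>" and M: "0 \<le> M"
    and p: "p \<in> controls ts \<theta> U" and q: "q \<in> controls ts \<theta> V" and t: "t \<in> {t0..\<theta>}"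
  shows "norm (velocity t0 \<theta> \<alpha> f w0 h ts \<phi> p q y t) \<le> M + (1 + norm (approx_state t0 \<alpha> w0 h y t)) * c"
proof -
  have c0: "0 \<le> (1 + norm (approx_state t0 \<alpha> w0 h y t)) * c" using c by simp
  consider "t \<le> ts" | "ts < t" "t < \<theta>" | "ts < t" "\<theta> \<le> t" by linarith
  then show ?thesis
  proof cases
    case 1
    then show ?thesis using \<phi> t c0 by (auto simp: velocity_def bmeas_def intro: add_increasing2)
  next
    case 2
    then have "norm (f t (approx_state t0 \<alpha> w0 h y t) (p t) (q t)) \<le> (1 + norm (approx_state t0 \<alpha> w0 h y t)) * c"
      using f_growth p q t by (auto simp: controls_def)
    then show ?thesis using 2 M by (simp add: velocity_def)
  qed (use M c0 in \<open>simp add: velocity_def\<close>)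
qed

lemma velocity_bmeas:
  assumes h: "0 < h" and ts: "ts \<in> {t0..\<theta>}" and \<phi>: "bmeas t0 ts M \<phi>"
    and p: "p \<in> controls ts \<theta> U" and q: "q \<in> controls ts \<theta> V"
    and y: "continuous_on {t0..\<theta>} y" and y0: "y t0 = 0"
  obtains M' where "bmeas t0 \<theta> M' (velocity t0 \<theta> \<alpha> f w0 h ts \<phi> p q y)"
proof -
  have M: "0 \<le> M" using bmeas_nonneg[OF \<phi>] ts by simp
  obtain X where X: "bmeas t0 \<theta> X (approx_state t0 \<alpha> w0 h y)"
    using bmeas_continuous[OF approx_state_continuous[OF h y y0]] by metis
  have "bmeas t0 \<theta> (M + (1 + X) * c) (velocity t0 \<theta> \<alpha> f w0 h ts \<phi> p q y)"
    unfolding bmeas_def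
  proof (intro conjI ballI velocity_measurable[OF assms])
    fix t assume t: "t \<in> {t0..\<theta>}"
    show "norm (velocity t0 \<theta> \<alpha> f w0 h ts \<phi> p q y t) \<le> M + (1 + X) * c"
      using velocity_norm_le[OF ts \<phi> M p q t, of w0 h y] X t c
      by (auto simp: bmeas_def intro: order_trans intro!: add_left_mono mult_right_mono)
  qed
  then show thesis using that by blast
qed

lemma motion_integral_form:
  assumes h: "0 < h" and ts: "ts \<in> {t0..\<theta>}" and \<phi>: "bmeas t0 ts M \<phi>"
    and rs: "\<And>t. t \<in> {t0..ts} \<Longrightarrow> rs t = integral {t0..t} \<phi>"
    and p: "p \<in> controls ts \<theta> U" and q: "q \<in> controls ts \<theta> V"
    and y: "is_motion t0 \<theta> \<alpha> f w0 h ts rs p q y" and t: "t \<in> {t0..\<theta>}"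
  shows "y t = integral {t0..t} (velocity t0 \<theta> \<alpha> f w0 h ts \<phi> p q y)"
proof -
  let ?v = "velocity t0 \<theta> \<alpha> f w0 h ts \<phi> p q y"
  obtain L where L: "L-lipschitz_on {t0..\<theta>} y" and y0: "y t0 = 0" and yr: "\<And>t. t \<in> {t0..ts} \<Longrightarrow> y t = rs t"
    and der: "AE t in lebesgue_on {ts..\<theta>}. (y has_vector_derivative f t (approx_state t0 \<alpha> w0 h y t) (p t) (q t)) (at t within {t0..\<theta>})"
    using y by (auto simp: is_motion_def Lip0_def)
  have yc: "continuous_on {t0..\<theta>} y" using L lipschitz_on_continuous_on by blast
  obtain M' where b: "bmeas t0 \<theta> M' ?v" using velocity_bmeas[OF h ts \<phi> p q yc y0] by blast
  have v1: "integral {t0..t} ?v = integral {t0..t} \<phi>" if "t \<in> {t0..ts}" for t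
    by (rule integral_cong) (use that in \<open>auto simp: velocity_def\<close>)
  show ?thesis
  proof (cases "t \<le> ts")
    case True
    then show ?thesis using v1[of t] yr[of t] rs[of t] t by simp
  next
    case False
    obtain N where N: "negligible N" "\<And>t. t \<in> {ts..\<theta>} - N \<Longrightarrow> (y has_vector_derivative f t (approx_state t0 \<alpha> w0 h y t) (p t) (q t)) (at t within {t0..\<theta>})"
      using der unfolding AE_lebesgue_on_interval_iff by blast
    have "(?v has_integral y t - y ts) {ts..t}"
    proof (rule lipschitz_has_integral_derivative)
      show "L-lipschitz_on {ts..t} y" by (rule lipschitz_on_subset[OF L]) (use ts t in auto)
      show "negligible (N \<union> {ts, \<theta>})" using N(1) by simp
      fix u assume u: "u \<in> {ts..t} - (N \<union> {ts, \<theta>})"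
      have "(y has_vector_derivative f u (approx_state t0 \<alpha> w0 h y u) (p u) (q u)) (at u within {t0..\<theta>})"
        by (rule N(2)) (use u t in auto)
      moreover have "f u (approx_state t0 \<alpha> w0 h y u) (p u) (q u) = ?v u" using u t by (auto simp: velocity_def)
      ultimately show "(y has_vector_derivative ?v u) (at u within {ts..t})"
        by (metis has_vector_derivative_within_subset atLeastatMost_subset_iff atLeastAtMost_iff ts t)
    qed (use False in simp)
    then have "integral {ts..t} ?v = y t - y ts" by (rule integral_unique)
    moreover have "integral {t0..ts} ?v + integral {ts..t} ?v = integral {t0..t} ?v"
      by (rule Henstock_Kurzweil_Integration.integral_combine)
         (use False ts t bmeas_integrable_on[OF bmeas_subinterval[OF b]] in auto)
    moreover have "y ts = integral {t0..ts} ?v" using v1[of ts] yr[of ts] rs[of ts] ts by simp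
    ultimately show ?thesis by simp
  qed
qed

lemma integral_form_motion:
  assumes ts: "ts \<in> {t0..\<theta>}"
    and rs: "\<And>t. t \<in> {t0..ts} \<Longrightarrow> rs t = integral {t0..t} \<phi>"
    and b: "bmeas t0 \<theta> M' (velocity t0 \<theta> \<alpha> f w0 h ts \<phi> p q y)"
    and y: "\<And>t. t \<in> {t0..\<theta>} \<Longrightarrow> y t = integral {t0..t} (velocity t0 \<theta> \<alpha> f w0 h ts \<phi> p q y)"
  shows "is_motion t0 \<theta> \<alpha> f w0 h ts rs p q y"
proof -
  let ?v = "velocity t0 \<theta> \<alpha> f w0 h ts \<phi> p q y"
  have "M'-lipschitz_on {t0..\<theta>} y"
  proof (rule lipschitz_onI)
    show "0 \<le> M'" using bmeas_nonneg[OF b] t0\<theta> by simp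
    show "dist (y s) (y t) \<le> M' * dist s t" if "s \<in> {t0..\<theta>}" "t \<in> {t0..\<theta>}" for s t
      using integral_lipschitz[OF b that(2,1)] that by (simp add: dist_norm y dist_real_def)
  qed
  moreover have "y t0 = 0" using y[of t0] t0\<theta> by simp
  moreover have "y t = rs t" if "t \<in> {t0..ts}" for t
  proof -
    have "y t = integral {t0..t} ?v" using y that ts by simp
    also have "\<dots> = integral {t0..t} \<phi>" by (rule integral_cong) (use that in \<open>auto simp: velocity_def\<close>)
    finally show ?thesis using rs[OF that] by simp
  qed
  moreover have "AE t in lebesgue_on {ts..\<theta>}. (y has_vector_derivative f t (approx_state t0 \<alpha> w0 h y t) (p t) (q t)) (at t within {t0..\<theta>})"
  proof -
    obtain N where N: "negligible N" and der: "\<And>t. t \<in> {t0..\<theta>} - N \<Longrightarrow>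
        ((\<lambda>s. integral {t0..s} ?v) has_vector_derivative ?v t) (at t within {t0..\<theta>})"
      using indefinite_integral_has_derivative_AE[OF bmeas_integrable_on[OF b]] by blast
    have "(y has_vector_derivative f t (approx_state t0 \<alpha> w0 h y t) (p t) (q t)) (at t within {t0..\<theta>})"
      if t: "t \<in> {ts..\<theta>} - (N \<union> {ts, \<theta>})" for t
    proof -
      have "(y has_vector_derivative ?v t) (at t within {t0..\<theta>})"
        by (rule has_vector_derivative_transform[OF _ _ der]) (use t ts y in auto)
      then show ?thesis using t by (simp add: velocity_def)
    qed
    then show ?thesis unfolding AE_lebesgue_on_interval_iff
      by (intro exI[of _ "N \<union> {ts, \<theta>}"]) (use N in auto)
  qed
  ultimately show ?thesis unfolding is_motion_def Lip0_def by blast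
qed

text \<open>
  \<open>B\<close> bounds the states of all velocities of linear growth, for every step at once. As the right-hand
  side of the system does not occur, the bound also holds for other right-hand sides with the same
  growth constant.
\<close>

definition state_bound :: "real \<Rightarrow> real \<Rightarrow> real \<Rightarrow> bool" where
  "state_bound M R B \<longleftrightarrow> 0 \<le> B \<and> (\<forall>h (w0 :: real ^ 'n) \<phi> M'. 0 < h \<longrightarrow> norm w0 \<le> R \<longrightarrow> bmeas t0 \<theta> M' \<phi> \<longrightarrow>
     (\<forall>\<tau>\<in>{t0..\<theta>}. norm (\<phi> \<tau>) \<le> M + (1 + norm (w0 + volterra t0 \<theta> (gl_kernel \<alpha> h) \<phi> \<tau>)) * c) \<longrightarrow>
     (\<forall>t\<in>{t0..\<theta>}. norm (w0 + volterra t0 \<theta> (gl_kernel \<alpha> h) \<phi> t) \<le> B))"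

lemma state_boundD:
  assumes "state_bound M R B" "0 < h" "norm (w0 :: real ^ 'n) \<le> R" "bmeas t0 \<theta> M' \<phi>"
    "\<And>\<tau>. \<tau> \<in> {t0..\<theta>} \<Longrightarrow> norm (\<phi> \<tau>) \<le> M + (1 + norm (w0 + volterra t0 \<theta> (gl_kernel \<alpha> h) \<phi> \<tau>)) * c" "t \<in> {t0..\<theta>}"
  shows "norm (w0 + volterra t0 \<theta> (gl_kernel \<alpha> h) \<phi> t) \<le> B"
  using assms unfolding state_bound_def by blast

text \<open>
  The kernels have a majorant that does not depend on the step, so one Gronwall factor serves for all
  steps.
\<close>

lemma state_apriori_bound:
  assumes M: "0 \<le> M" and R: "0 \<le> R"
  obtains B where "state_bound M R B"
proof -
  obtain C where C: "1 \<le> C" "\<And>h \<tau>. 0 < h \<Longrightarrow> gl_kernel \<alpha> h \<tau> \<le> C * power_kernel \<alpha> \<tau>"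
    using gl_kernel_le_power_kernel[OF \<alpha>0 \<alpha>1'] by blast
  define K' where "K' \<tau> = C * power_kernel \<alpha> \<tau>" for \<tau>
  define K where "K \<tau> = c * K' \<tau>" for \<tau>
  have K': "vkernel K'" unfolding K'_def using vkernel_cmul[OF vkernel_power[OF \<alpha>0], of C] C(1) by simp
  have K: "vkernel K" unfolding K_def using vkernel_cmul[OF K', of c] c by simp
  define T where "T = \<theta> - t0"
  obtain G where G: "0 < G" and gf: "gronwall_factor K T G" by (rule volterra_gronwall[OF K])
  define A where "A = R + (M + c) * mass K' T"
  have A: "0 \<le> A" unfolding A_def using R M c mass_nonneg[OF K'] by simp
  have "state_bound M R (G * A)"
    unfolding state_bound_def
  proof (intro conjI allI impI ballI)
    show "0 \<le> G * A" using G A by simp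
    fix h and w0 :: "real ^ 'n" and \<phi> :: "real \<Rightarrow> real ^ 'n" and M'
    assume h: "0 < h" and w0: "norm w0 \<le> R" and \<phi>: "bmeas t0 \<theta> M' \<phi>"
      and le: "\<forall>\<tau>\<in>{t0..\<theta>}. norm (\<phi> \<tau>) \<le> M + (1 + norm (w0 + volterra t0 \<theta> (gl_kernel \<alpha> h) \<phi> \<tau>)) * c"
    have kg: "vkernel (gl_kernel \<alpha> h)" by (rule vkernel_gl[OF \<alpha>0 \<alpha>1' h])
    define x where "x t = w0 + volterra t0 \<theta> (gl_kernel \<alpha> h) \<phi> t" for t
    have xc: "continuous_on {t0..\<theta>} x"
      unfolding x_def by (intro continuous_intros volterra_continuous[OF kg gl_kernel_antimono[OF \<alpha>0 \<alpha>1' h] \<phi>])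
    have ec: "continuous_on {t0..\<theta>} (\<lambda>t. norm (x t))" by (intro continuous_intros xc)
    obtain E where E: "bmeas t0 \<theta> E (\<lambda>t. (M + c) + norm (x t) * c)"
      by (rule bmeas_continuous[of t0 \<theta> "\<lambda>t. (M + c) + norm (x t) * c"]) (auto intro!: continuous_intros xc)
    obtain E' where E': "bmeas t0 \<theta> E' (\<lambda>t. norm (x t) * c)"
      by (rule bmeas_continuous[of t0 \<theta> "\<lambda>t. norm (x t) * c"]) (auto intro!: continuous_intros xc)
    have "exp_subsolution t0 \<theta> K A (\<lambda>t. norm (x t))"
    proof (rule volterra_exp_subsolution[OF K ec])
      fix t assume t: "t \<in> {t0..\<theta>}"
      have "norm (x t) \<le> norm w0 + norm (volterra t0 \<theta> (gl_kernel \<alpha> h) \<phi> t)" unfolding x_def by (rule norm_triangle_ineq)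
      also have "norm (volterra t0 \<theta> (gl_kernel \<alpha> h) \<phi> t) \<le> volterra t0 \<theta> (gl_kernel \<alpha> h) (\<lambda>t. (M + c) + norm (x t) * c) t"
        by (rule volterra_norm_le[OF kg \<phi> E]) (use le in \<open>auto simp: x_def algebra_simps\<close>)
      also have "\<dots> \<le> volterra t0 \<theta> K' (\<lambda>t. (M + c) + norm (x t) * c) t"
        by (rule volterra_kernel_mono[OF kg K' E]) (use M c C(2)[OF h] in \<open>auto simp: K'_def\<close>)
      also have "\<dots> = volterra t0 \<theta> K' (\<lambda>t. M + c) t + volterra t0 \<theta> K' (\<lambda>t. norm (x t) * c) t"
        by (rule volterra_add[OF K' bmeas_const[OF order_refl] E'])
      also have "volterra t0 \<theta> K' (\<lambda>t. M + c) t = mass K' (t - t0) * (M + c)" using volterra_const[OF K', of t \<theta> t0 "M + c"] t by simp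
      also have "\<dots> \<le> mass K' T * (M + c)"
        using t c M by (intro mult_right_mono mass_mono[OF K']) (auto simp: T_def)
      also have "volterra t0 \<theta> K' (\<lambda>t. norm (x t) * c) t = volterra t0 \<theta> K (\<lambda>t. norm (x t)) t"
        by (simp add: volterra_def K_def mult_ac)
      finally show "norm (x t) \<le> A + volterra t0 \<theta> K (\<lambda>t. norm (x t)) t"
        using w0 by (simp add: A_def mult.commute)
    qed
    from gronwall_factorD[OF gf this _ _ ec A]
    show "norm (w0 + volterra t0 \<theta> (gl_kernel \<alpha> h) \<phi> t) \<le> G * A" if "t \<in> {t0..\<theta>}" for t
      using t0\<theta> that unfolding x_def T_def by simp
  qed
  then show thesis by (rule that)
qed

text \<open>
  The motions of the system as solutions of an integral equation; the boundedness ensures that the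
  integrals exist.
\<close>

definition solution where
  "solution h w0 ts \<phi> p q y \<longleftrightarrow> (\<exists>M. bmeas t0 \<theta> M (velocity t0 \<theta> \<alpha> f w0 h ts \<phi> p q y)) \<and>
     (\<forall>t\<in>{t0..\<theta>}. y t = integral {t0..t} (velocity t0 \<theta> \<alpha> f w0 h ts \<phi> p q y))"

lemma solution_state:
  assumes h: "0 < h" and y: "solution h w0 ts \<phi> p q y" and t: "t \<in> {t0..\<theta>}"
  shows "approx_state t0 \<alpha> w0 h y t = w0 + volterra t0 \<theta> (gl_kernel \<alpha> h) (velocity t0 \<theta> \<alpha> f w0 h ts \<phi> p q y) t"
proof -
  obtain M where "bmeas t0 \<theta> M (velocity t0 \<theta> \<alpha> f w0 h ts \<phi> p q y)" using y unfolding solution_def by blast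
  then show ?thesis
    by (rule approx_state_eq_volterra[OF \<alpha>0 \<alpha>1 h _ t]) (use y in \<open>simp add: solution_def\<close>)
qed

lemma solution_bound:
  assumes sb: "state_bound M R B" and h: "0 < h" and w0: "norm w0 \<le> R" and ts: "ts \<in> {t0..\<theta>}" and \<phi>: "bmeas t0 ts M \<phi>"
    and p: "p \<in> controls ts \<theta> U" and q: "q \<in> controls ts \<theta> V" and y: "solution h w0 ts \<phi> p q y"
  shows "t \<in> {t0..\<theta>} \<Longrightarrow> norm (approx_state t0 \<alpha> w0 h y t) \<le> B"
    and "bmeas t0 \<theta> (M + (1 + B) * c) (velocity t0 \<theta> \<alpha> f w0 h ts \<phi> p q y)"
proof -
  let ?v = "velocity t0 \<theta> \<alpha> f w0 h ts \<phi> p q y"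
  have M: "0 \<le> M" using bmeas_nonneg[OF \<phi>] ts by simp
  obtain M' where v: "bmeas t0 \<theta> M' ?v" using y by (auto simp: solution_def)
  have "norm (?v \<tau>) \<le> M + (1 + norm (w0 + volterra t0 \<theta> (gl_kernel \<alpha> h) ?v \<tau>)) * c" if \<tau>: "\<tau> \<in> {t0..\<theta>}" for \<tau>
    using velocity_norm_le[OF ts \<phi> M p q \<tau>, of w0 h y] solution_state[OF h y \<tau>] by simp
  from state_boundD[OF sb h w0 v this]
  show xB: "norm (approx_state t0 \<alpha> w0 h y t) \<le> B" if "t \<in> {t0..\<theta>}" for t
    using solution_state[OF h y that] that by simp
  show "bmeas t0 \<theta> (M + (1 + B) * c) ?v"
    unfolding bmeas_def
  proof (intro conjI ballI)
    show "?v \<in> borel_measurable (lebesgue_on {t0..\<theta>})" using v by (simp add: bmeas_def)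
    fix t assume t: "t \<in> {t0..\<theta>}"
    show "norm (?v t) \<le> M + (1 + B) * c"
      using velocity_norm_le[OF ts \<phi> M p q t, of w0 h y] xB[OF t] c
      by (auto intro: order_trans intro!: add_left_mono mult_right_mono)
  qed
qed

text \<open>
  Uniqueness and causality in one statement: the solution up to \<open>t1\<close> depends, up to null sets, only on
  the controls up to \<open>t1\<close>. The difference of two solutions is bounded by the integral of its running
  supremum, because the state depends on the past of the motion, and a Gronwall argument applies.
\<close>

lemma solution_unique:
  assumes h: "0 < h" and ts: "ts \<in> {t0..\<theta>}" and \<phi>: "bmeas t0 ts M \<phi>"
    and p: "p \<in> controls ts \<theta> U" "p' \<in> controls ts \<theta> U" and q: "q \<in> controls ts \<theta> V" "q' \<in> controls ts \<theta> V"
    and y: "solution h w0 ts \<phi> p q y" and y': "solution h w0 ts \<phi> p' q' y'"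
    and t1: "t1 \<in> {t0..\<theta>}" and pp: "ae_eq ts t1 p p'" and qq: "ae_eq ts t1 q q'"
    and t: "t \<in> {t0..t1}"
  shows "y t = y' t"
proof -
  let ?v = "velocity t0 \<theta> \<alpha> f w0 h ts \<phi> p q y" and ?v' = "velocity t0 \<theta> \<alpha> f w0 h ts \<phi> p' q' y'"
  have M: "0 \<le> M" using bmeas_nonneg[OF \<phi>] ts by simp
  obtain B where sb: "state_bound M (norm w0) B" by (rule state_apriori_bound[OF M norm_ge_zero])
  have B: "0 \<le> B" using sb by (simp add: state_bound_def)
  note bd = solution_bound[OF sb h order_refl ts \<phi> p(1) q(1) y] and bd' = solution_bound[OF sb h order_refl ts \<phi> p(2) q(2) y']
  note xB = bd(1) and v = bd(2) and xB' = bd'(1) and v' = bd'(2)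
  obtain L where L: "0 < L" and lip: "\<And>t x x' u v. t \<in> {t0..\<theta>} \<Longrightarrow> norm x \<le> B \<Longrightarrow> norm x' \<le> B \<Longrightarrow> u \<in> U \<Longrightarrow> v \<in> V \<Longrightarrow>
      norm (f t x u v - f t x' u v) \<le> L * norm (x - x')"
    using f_lip[rule_format, OF B] by auto
  obtain N1 where N1: "negligible N1" "\<And>t. t \<in> {ts..t1} - N1 \<Longrightarrow> p t = p' t"
    using pp unfolding ae_eq_def AE_lebesgue_on_interval_iff by blast
  obtain N2 where N2: "negligible N2" "\<And>t. t \<in> {ts..t1} - N2 \<Longrightarrow> q t = q' t"
    using qq unfolding ae_eq_def AE_lebesgue_on_interval_iff by blast
  define N where "N = N1 \<union> N2"
  have N: "negligible N" using N1 N2 by (simp add: N_def)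
  have sub: "{t0..t1} \<subseteq> {t0..\<theta>}" using t1 by auto
  define D where "D = L * gl_state_const \<alpha> h (\<theta> - t0)"
  have D: "0 \<le> D" unfolding D_def using L gl_state_const_nonneg by simp
  define K where "K \<tau> = D * rl_kernel 1 \<tau>" for \<tau>
  have kr: "vkernel (rl_kernel 1)" by (rule vkernel_rl) simp
  have K: "vkernel K" unfolding K_def using vkernel_cmul[OF kr D] by simp
  define e where "e t = norm (y t - y' t)" for t
  have e_eq: "e t = norm (integral {t0..t} (\<lambda>\<tau>. ?v \<tau> - ?v' \<tau>))" if "t \<in> {t0..\<theta>}" for t
  proof -
    have "{t0..t} \<subseteq> {t0..\<theta>}" using that by auto
    then show ?thesis
      using y y' that bmeas_integrable_on[OF bmeas_subinterval[OF v]] bmeas_integrable_on[OF bmeas_subinterval[OF v']]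
      by (simp add: e_def solution_def Henstock_Kurzweil_Integration.integral_diff)
  qed
  have yc: "continuous_on {t0..\<theta>} z" if sol: "solution h w0 ts \<phi> r s z" for r s z
  proof -
    obtain M' where b: "bmeas t0 \<theta> M' (velocity t0 \<theta> \<alpha> f w0 h ts \<phi> r s z)" and z: "\<forall>t\<in>{t0..\<theta>}. z t = integral {t0..t} (velocity t0 \<theta> \<alpha> f w0 h ts \<phi> r s z)"
      using sol unfolding solution_def by blast
    have "continuous_on {t0..\<theta>} (\<lambda>t. integral {t0..t} (velocity t0 \<theta> \<alpha> f w0 h ts \<phi> r s z))"
      by (rule indefinite_integral_continuous_1[OF bmeas_integrable_on[OF b]])
    then show ?thesis using z by (metis (no_types, lifting) continuous_on_cong)
  qed
  have ec: "continuous_on {t0..t1} e"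
    unfolding e_def by (intro continuous_intros continuous_on_subset[OF yc[OF y] sub] continuous_on_subset[OF yc[OF y'] sub])
  obtain G where G: "0 < G" and gf: "gronwall_factor K (\<theta> - t0) G" by (rule volterra_gronwall[OF K])
  have sub0: "exp_subsolution t0 t1 K 0 e"
    unfolding exp_subsolution_def
  proof (intro allI impI ballI)
    fix m \<kappa> t :: real assume \<kappa>: "0 < \<kappa>" and m: "0 \<le> m" and dom: "\<forall>\<tau>\<in>{t0..t1}. e \<tau> \<le> m * exp (\<kappa> * (\<tau> - t0))" and t: "t \<in> {t0..t1}"
    have t\<theta>: "t \<in> {t0..\<theta>}" using t sub by blast
    have tsub: "{t0..t} \<subseteq> {t0..\<theta>}" using t\<theta> by auto
    define g where "g \<tau> = (if \<tau> \<in> N then 0 else ?v \<tau> - ?v' \<tau>)" for \<tau>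
    have int: "(\<lambda>\<tau>. ?v \<tau> - ?v' \<tau>) integrable_on {t0..t}"
      by (intro integrable_diff bmeas_integrable_on[OF bmeas_subinterval[OF v tsub]] bmeas_integrable_on[OF bmeas_subinterval[OF v' tsub]])
    have "norm (integral {t0..t} g) \<le> integral {t0..t} (\<lambda>\<tau>. D * (m * exp (\<kappa> * (\<tau> - t0))))"
    proof (rule integral_norm_bound_integral)
      show "g integrable_on {t0..t}" by (rule integrable_spike[OF int N]) (simp add: g_def)
      show "(\<lambda>\<tau>. D * (m * exp (\<kappa> * (\<tau> - t0)))) integrable_on {t0..t}"
        by (intro integrable_continuous_real continuous_intros)
      fix \<tau> assume \<tau>: "\<tau> \<in> {t0..t}"
      have \<tau>\<theta>: "\<tau> \<in> {t0..\<theta>}" using \<tau> tsub by blast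
      have nn: "0 \<le> D * (m * exp (\<kappa> * (\<tau> - t0)))" using D m by simp
      show "norm (g \<tau>) \<le> D * (m * exp (\<kappa> * (\<tau> - t0)))"
      proof (cases "\<tau> \<in> N \<or> \<tau> \<le> ts \<or> \<theta> \<le> \<tau>")
        case True
        then have "g \<tau> = 0" using \<tau> by (auto simp: g_def velocity_def)
        then show ?thesis using nn by simp
      next
        case False
        let ?x = "approx_state t0 \<alpha> w0 h y \<tau>" and ?x' = "approx_state t0 \<alpha> w0 h y' \<tau>"
        have pq: "p \<tau> = p' \<tau>" "q \<tau> = q' \<tau>" using N1(2)[of \<tau>] N2(2)[of \<tau>] False \<tau> t by (auto simp: N_def)
        have "g \<tau> = f \<tau> ?x (p \<tau>) (q \<tau>) - f \<tau> ?x' (p \<tau>) (q \<tau>)" using False pq by (simp add: g_def velocity_def)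
        also have "norm \<dots> \<le> L * norm (?x - ?x')"
          by (rule lip[OF \<tau>\<theta> xB[OF \<tau>\<theta>] xB'[OF \<tau>\<theta>]]) (use p q False \<tau>\<theta> in \<open>auto simp: controls_def\<close>)
        also have "\<dots> \<le> L * (gl_state_const \<alpha> h (\<theta> - t0) * (m * exp (\<kappa> * (\<tau> - t0))))"
        proof (rule mult_left_mono[OF approx_state_diff_le[OF h \<tau>\<theta>]])
          fix s assume s: "s \<in> {t0..\<tau>}"
          have "norm (y s - y' s) \<le> m * exp (\<kappa> * (s - t0))" using dom s \<tau> t by (auto simp: e_def)
          also have "\<dots> \<le> m * exp (\<kappa> * (\<tau> - t0))" using s \<kappa> m by (intro mult_left_mono) auto
          finally show "norm (y s - y' s) \<le> m * exp (\<kappa> * (\<tau> - t0))" .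
        qed (use L in simp)
        finally show ?thesis by (simp add: D_def mult_ac)
      qed
    qed
    moreover have "integral {t0..t} g = integral {t0..t} (\<lambda>\<tau>. ?v \<tau> - ?v' \<tau>)"
      by (rule integral_spike[OF N]) (simp add: g_def)
    moreover have "volterra t0 t1 K (\<lambda>\<tau>. exp (\<kappa> * (\<tau> - t0))) t = D * integral {t0..t} (\<lambda>\<tau>. exp (\<kappa> * (\<tau> - t0)))"
      using volterra_rl_kernel_1[OF t, of "\<lambda>\<tau>. exp (\<kappa> * (\<tau> - t0))"] by (simp add: volterra_def K_def mult.assoc)
    ultimately show "e t \<le> 0 + m * volterra t0 t1 K (\<lambda>\<tau>. exp (\<kappa> * (\<tau> - t0))) t"
      using e_eq[OF t\<theta>] by (simp add: mult.left_commute)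
  qed
  have "e t \<le> G * 0"
    by (rule gronwall_factorD[OF gf sub0 _ _ ec order_refl _ t]) (use t1 in \<open>auto simp: e_def\<close>)
  then show ?thesis by (simp add: e_def)
qed

text \<open>
  Picard's iteration as a fixed point problem for \<open>exp (- \<kappa> * (t - t0)) *\<^sub>R y t\<close> in the space of bounded
  continuous functions; for large \<open>\<kappa>\<close> the map is a contraction.
\<close>

lemma solution_exists_lipschitz:
  assumes lip: "\<And>t x x' u v. t \<in> {t0..\<theta>} \<Longrightarrow> u \<in> U \<Longrightarrow> v \<in> V \<Longrightarrow> norm (f t x u v - f t x' u v) \<le> L * norm (x - x')"
    and L: "0 \<le> L" and h: "0 < h" and ts: "ts \<in> {t0..\<theta>}" and \<phi>: "bmeas t0 ts M \<phi>"
    and p: "p \<in> controls ts \<theta> U" and q: "q \<in> controls ts \<theta> V"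
  shows "\<exists>y. solution h w0 ts \<phi> p q y"
proof -
  define D where "D = L * gl_state_const \<alpha> h (\<theta> - t0)"
  have D: "0 \<le> D" unfolding D_def using L gl_state_const_nonneg by simp
  define \<kappa> where "\<kappa> = 4 * D + 1"
  have \<kappa>: "0 < \<kappa>" using D by (simp add: \<kappa>_def)
  define cl where "cl t = max t0 (min t \<theta>)" for t
  have cl: "cl t \<in> {t0..\<theta>}" for t using t0\<theta> by (auto simp: cl_def)
  have cl_id: "cl t = t" if "t \<in> {t0..\<theta>}" for t using that by (auto simp: cl_def)
  have cl_cont: "continuous_on UNIV cl" unfolding cl_def by (intro continuous_intros)
  \<comment> \<open>\<open>Y u\<close> is the candidate for the motion that belongs to \<open>u\<close>. It must vanish at \<open>t0\<close> for its state to
    be continuous, so \<open>u t0\<close> is subtracted; this costs the factor \<open>2\<close> below, which explains the \<open>4\<close> in \<open>\<kappa>\<close>.\<close>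
  define Y where "Y u t = exp (\<kappa> * (t - t0)) *\<^sub>R (apply_bcontfun u t - apply_bcontfun u t0)" for u :: "real \<Rightarrow>\<^sub>C (real ^ 'n)" and t
  define v where "v u = velocity t0 \<theta> \<alpha> f w0 h ts \<phi> p q (Y u)" for u
  have Yc: "continuous_on {t0..\<theta>} (Y u)" for u
    unfolding Y_def by (intro continuous_intros continuous_on_apply_bcontfun)
  have Y0: "Y u t0 = 0" for u by (simp add: Y_def)
  have vb: "\<exists>M'. bmeas t0 \<theta> M' (v u)" for u
    unfolding v_def using velocity_bmeas[OF h ts \<phi> p q Yc Y0] by metis
  have vi: "v u integrable_on {t0..t}" if "t \<in> {t0..\<theta>}" for u t
  proof -
    obtain M' where M': "bmeas t0 \<theta> M' (v u)" using vb by blast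
    show ?thesis by (rule bmeas_integrable_on[OF bmeas_subinterval[OF M']]) (use that in auto)
  qed
  define W where "W u t = exp (- \<kappa> * (cl t - t0)) *\<^sub>R integral {t0..cl t} (v u)" for u t
  have Wb: "W u \<in> bcontfun" for u
  proof -
    have ic: "continuous_on {t0..\<theta>} (\<lambda>t. integral {t0..t} (v u))"
      by (rule indefinite_integral_continuous_1[OF vi]) (use t0\<theta> in simp)
    have Wc: "continuous_on UNIV (W u)"
      unfolding W_def by (intro continuous_intros continuous_on_compose2[OF ic cl_cont] cl_cont) (use cl in auto)
    have Wcl: "W u t = W u (cl t)" for t by (simp add: W_def cl_id[OF cl])
    have "W u t \<in> W u ` {t0..\<theta>}" for t by (subst Wcl) (rule imageI[OF cl])
    then have "range (W u) = W u ` {t0..\<theta>}" by blast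
    moreover have "compact (W u ` {t0..\<theta>})"
      by (intro compact_continuous_image continuous_on_subset[OF Wc]) auto
    ultimately show ?thesis using Wc by (simp add: bcontfun_def compact_imp_bounded)
  qed
  define \<Phi> where "\<Phi> u = Bcontfun (W u)" for u
  have \<Phi>: "apply_bcontfun (\<Phi> u) t = W u t" for u t
    unfolding \<Phi>_def using Wb by (simp add: Bcontfun_inverse)
  have contr: "dist (\<Phi> u) (\<Phi> u') \<le> (1/2) * dist u u'" for u u'
  proof (rule dist_bound)
    fix t
    define s where "s = cl t"
    have s: "s \<in> {t0..\<theta>}" unfolding s_def by (rule cl)
    define d where "d = dist u u'"
    have d: "0 \<le> d" by (simp add: d_def)
    have Yd: "norm (Y u r - Y u' r) \<le> exp (\<kappa> * (r - t0)) * (2 * d)" for r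
    proof -
      have "norm ((apply_bcontfun u r - apply_bcontfun u' r) - (apply_bcontfun u t0 - apply_bcontfun u' t0))
          \<le> dist (apply_bcontfun u r) (apply_bcontfun u' r) + dist (apply_bcontfun u t0) (apply_bcontfun u' t0)"
        unfolding dist_norm by (rule norm_triangle_ineq4)
      also have "\<dots> \<le> d + d" unfolding d_def by (intro add_mono dist_bounded)
      finally have *: "norm ((apply_bcontfun u r - apply_bcontfun u t0) - (apply_bcontfun u' r - apply_bcontfun u' t0)) \<le> 2 * d"
        by (simp add: algebra_simps)
      have "Y u r - Y u' r = exp (\<kappa> * (r - t0)) *\<^sub>R ((apply_bcontfun u r - apply_bcontfun u t0) - (apply_bcontfun u' r - apply_bcontfun u' t0))"
        by (simp add: Y_def scaleR_diff_right)
      then show ?thesis using * by (simp add: mult_left_mono)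
    qed
    have vd: "norm (v u \<tau> - v u' \<tau>) \<le> D * (exp (\<kappa> * (\<tau> - t0)) * (2 * d))" if \<tau>: "\<tau> \<in> {t0..\<theta>}" for \<tau>
    proof (cases "\<tau> \<le> ts \<or> \<theta> \<le> \<tau>")
      case True
      then show ?thesis using D d by (auto simp: v_def velocity_def)
    next
      case False
      let ?x = "approx_state t0 \<alpha> w0 h (Y u) \<tau>" and ?x' = "approx_state t0 \<alpha> w0 h (Y u') \<tau>"
      have "norm (v u \<tau> - v u' \<tau>) \<le> L * norm (?x - ?x')"
        using False lip[OF \<tau>, of "p \<tau>" "q \<tau>" ?x ?x'] p q by (auto simp: v_def velocity_def controls_def)
      also have "\<dots> \<le> L * (gl_state_const \<alpha> h (\<theta> - t0) * (exp (\<kappa> * (\<tau> - t0)) * (2 * d)))"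
      proof (rule mult_left_mono[OF approx_state_diff_le[OF h \<tau>] L])
        fix r assume r: "r \<in> {t0..\<tau>}"
        have "norm (Y u r - Y u' r) \<le> exp (\<kappa> * (r - t0)) * (2 * d)" by (rule Yd)
        also have "\<dots> \<le> exp (\<kappa> * (\<tau> - t0)) * (2 * d)" using r \<kappa> d by (intro mult_right_mono) auto
        finally show "norm (Y u r - Y u' r) \<le> exp (\<kappa> * (\<tau> - t0)) * (2 * d)" .
      qed
      finally show ?thesis by (simp add: D_def mult_ac)
    qed
    have ei: "((\<lambda>\<tau>. exp (\<kappa> * (\<tau> - t0))) has_integral exp (\<kappa> * (s - t0)) / \<kappa> - exp (\<kappa> * (t0 - t0)) / \<kappa>) {t0..s}"
      by (rule fundamental_theorem_of_calculus)
         (use s \<kappa> in \<open>auto intro!: derivative_eq_intros simp flip: has_real_derivative_iff_has_vector_derivative\<close>)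
    have "norm (integral {t0..s} (v u) - integral {t0..s} (v u')) = norm (integral {t0..s} (\<lambda>\<tau>. v u \<tau> - v u' \<tau>))"
      by (simp only: Henstock_Kurzweil_Integration.integral_diff[OF vi[OF s] vi[OF s]])
    also have "\<dots> \<le> integral {t0..s} (\<lambda>\<tau>. D * (2 * d) * exp (\<kappa> * (\<tau> - t0)))"
    proof (rule integral_norm_bound_integral)
      show "(\<lambda>\<tau>. v u \<tau> - v u' \<tau>) integrable_on {t0..s}" by (intro integrable_diff vi s)
      show "(\<lambda>\<tau>. D * (2 * d) * exp (\<kappa> * (\<tau> - t0))) integrable_on {t0..s}"
        using has_integral_mult_right[OF ei] by blast
      show "norm (v u \<tau> - v u' \<tau>) \<le> D * (2 * d) * exp (\<kappa> * (\<tau> - t0))" if "\<tau> \<in> {t0..s}" for \<tau>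
        using vd[of \<tau>] that s by (simp add: mult_ac)
    qed
    also have "\<dots> = D * (2 * d) * ((exp (\<kappa> * (s - t0)) - 1) / \<kappa>)"
      using integral_unique[OF has_integral_mult_right[OF ei]] by (simp add: diff_divide_distrib)
    also have "\<dots> \<le> D * (2 * d) * (exp (\<kappa> * (s - t0)) / \<kappa>)"
      using D d \<kappa> by (intro mult_left_mono divide_right_mono) auto
    finally have I: "norm (integral {t0..s} (v u) - integral {t0..s} (v u')) \<le> D * (2 * d) * (exp (\<kappa> * (s - t0)) / \<kappa>)" .
    have "dist (apply_bcontfun (\<Phi> u) t) (apply_bcontfun (\<Phi> u') t)
        = exp (- \<kappa> * (s - t0)) * norm (integral {t0..s} (v u) - integral {t0..s} (v u'))"
      unfolding \<Phi> W_def s_def[symmetric] dist_norm by (simp flip: scaleR_diff_right)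
    also have "\<dots> \<le> exp (- \<kappa> * (s - t0)) * (D * (2 * d) * (exp (\<kappa> * (s - t0)) / \<kappa>))"
      by (intro mult_left_mono I) simp
    also have "\<dots> = (exp (- \<kappa> * (s - t0)) * exp (\<kappa> * (s - t0))) * ((2 * D / \<kappa>) * d)" by simp
    also have "exp (- \<kappa> * (s - t0)) * exp (\<kappa> * (s - t0)) = 1" by (simp add: mult_exp_exp)
    also have "1 * ((2 * D / \<kappa>) * d) = (2 * D / \<kappa>) * d" by simp
    also have "\<dots> \<le> (1/2) * d"
      using D d \<kappa> by (intro mult_right_mono) (auto simp: \<kappa>_def field_simps)
    finally show "dist (apply_bcontfun (\<Phi> u) t) (apply_bcontfun (\<Phi> u') t) \<le> (1/2) * dist u u'" by (simp add: d_def)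
  qed
  have "\<exists>!u. \<Phi> u = u"
    by (rule banach_fix_type[of "1/2"]) (use contr in auto)
  then obtain u where u: "\<Phi> u = u" by blast
  have ut: "apply_bcontfun u t = W u t" for t using \<Phi>[of u t] u by simp
  have u0: "apply_bcontfun u t0 = 0" unfolding ut using t0\<theta> by (simp add: W_def cl_id)
  have "Y u t = integral {t0..t} (v u)" if "t \<in> {t0..\<theta>}" for t
    unfolding Y_def u0 unfolding ut W_def cl_id[OF that] by (simp add: mult_exp_exp)
  then have "solution h w0 ts \<phi> p q (Y u)" using vb[of u] by (simp add: solution_def v_def)
  then show ?thesis by blast
qed

end

lemma closest_point_cball:
  fixes x :: "'a::euclidean_space"
  assumes "0 \<le> R"
  shows "norm (closest_point (cball 0 R) x) \<le> R" "norm x \<le> R \<Longrightarrow> closest_point (cball 0 R) x = x"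
    "norm (closest_point (cball 0 R) x - closest_point (cball 0 R) y) \<le> norm (x - y)"
    "norm (closest_point (cball 0 R) x) \<le> norm x"
    "continuous_on S (closest_point (cball (0::'a) R))"
proof -
  have ne: "cball (0::'a) R \<noteq> {}" using assms by simp
  have "closest_point (cball 0 R) x \<in> cball 0 R" by (rule closest_point_in_set) (use ne in auto)
  then show "norm (closest_point (cball 0 R) x) \<le> R" by simp
  show "norm x \<le> R \<Longrightarrow> closest_point (cball 0 R) x = x" by (rule closest_point_self) simp
  show lip: "norm (closest_point (cball 0 R) x - closest_point (cball 0 R) y) \<le> norm (x - y)" for x y :: 'a
    using closest_point_lipschitz[of "cball (0::'a) R" x y] ne by (simp add: dist_norm)
  have "closest_point (cball 0 R) (0::'a) = 0" by (rule closest_point_self) (use assms in simp)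
  then show "norm (closest_point (cball 0 R) x) \<le> norm x" using lip[of x 0] by simp
  show "continuous_on S (closest_point (cball (0::'a) R))"
    by (rule continuous_on_closest_point) (use ne in auto)
qed

context approx_system
begin

text \<open>
  The right-hand side is only locally Lipschitz, so its state argument is first projected to the ball
  given by the a priori bound. This preserves the growth constant, hence the solution of the modified
  system obeys the same a priori bound and solves the original one.
\<close>

lemma solution_exists:
  assumes h: "0 < h" and ts: "ts \<in> {t0..\<theta>}" and \<phi>: "bmeas t0 ts M \<phi>"
    and p: "p \<in> controls ts \<theta> U" and q: "q \<in> controls ts \<theta> V"
  shows "\<exists>y. solution h w0 ts \<phi> p q y"
proof -
  have M: "0 \<le> M" using bmeas_nonneg[OF \<phi>] ts by simp
  obtain B where sb: "state_bound M (norm w0) B" by (rule state_apriori_bound[OF M norm_ge_zero])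
  have B: "0 \<le> B" using sb by (simp add: state_bound_def)
  define P where "P = closest_point (cball (0 :: real^'n) B)"
  define F where "F t x u v = f t (P x) u v" for t x u v
  obtain L where L: "0 < L" and lip: "\<And>t x x' u v. t \<in> {t0..\<theta>} \<Longrightarrow> norm x \<le> B \<Longrightarrow> norm x' \<le> B \<Longrightarrow> u \<in> U \<Longrightarrow> v \<in> V \<Longrightarrow>
      norm (f t x u v - f t x' u v) \<le> L * norm (x - x')"
    using f_lip[rule_format, OF B] by auto
  have Flip: "norm (F t x u v - F t x' u v) \<le> L * norm (x - x')" if "t \<in> {t0..\<theta>}" "u \<in> U" "v \<in> V" for t x x' u v
  proof -
    have "norm (F t x u v - F t x' u v) \<le> L * norm (P x - P x')"
      unfolding F_def by (rule lip) (use that closest_point_cball(1)[OF B] in \<open>auto simp: P_def\<close>)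
    also have "\<dots> \<le> L * norm (x - x')" using L closest_point_cball(3)[OF B] by (intro mult_left_mono) (auto simp: P_def)
    finally show ?thesis .
  qed
  have Fgrowth: "norm (F t x u v) \<le> (1 + norm x) * c" if "t \<in> {t0..\<theta>}" "u \<in> U" "v \<in> V" for t x u v
  proof -
    have "norm (F t x u v) \<le> (1 + norm (P x)) * c" using f_growth that by (simp add: F_def)
    also have "\<dots> \<le> (1 + norm x) * c" using c closest_point_cball(4)[OF B] by (intro mult_right_mono add_left_mono) (auto simp: P_def)
    finally show ?thesis .
  qed
  have Pc: "continuous_on S P" for S unfolding P_def by (rule closest_point_cball(5)[OF B])
  have Fcont: "continuous_on ({t0..\<theta>} \<times> UNIV \<times> U \<times> V) (\<lambda>(t, x, u, v). F t x u v)"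
  proof -
    have "continuous_on ({t0..\<theta>} \<times> UNIV \<times> U \<times> V) (\<lambda>z. (fst z, P (fst (snd z)), fst (snd (snd z)), snd (snd (snd z))))"
      by (intro continuous_intros continuous_on_compose2[OF Pc[of UNIV]]) auto
    from continuous_on_compose2[OF f_cont this] show ?thesis
      by (force simp: F_def split_def)
  qed
  interpret F: approx_system t0 \<theta> \<alpha> c U V F
  proof
    show "\<forall>R\<ge>0. \<exists>L>0. \<forall>t\<in>{t0..\<theta>}. \<forall>x\<in>cball 0 R. \<forall>x'\<in>cball 0 R. \<forall>u\<in>U. \<forall>v\<in>V.
         norm (F t x u v - F t x' u v) \<le> L * norm (x - x')" using Flip L by blast
  qed (use t0\<theta> \<alpha>0 \<alpha>1 U V c Fcont Fgrowth in auto)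
  obtain y where y: "F.solution h w0 ts \<phi> p q y"
    using F.solution_exists_lipschitz[OF Flip less_imp_le[OF L] h ts \<phi> p q] by blast
  let ?v = "velocity t0 \<theta> \<alpha> F w0 h ts \<phi> p q y"
  obtain M' where v: "bmeas t0 \<theta> M' ?v" using y unfolding F.solution_def by blast
  note xB = F.solution_bound(1)[OF sb h order_refl ts \<phi> p q y]
  have veq: "velocity t0 \<theta> \<alpha> f w0 h ts \<phi> p q y \<tau> = ?v \<tau>" if "\<tau> \<in> {t0..\<theta>}" for \<tau>
  proof -
    have "P (approx_state t0 \<alpha> w0 h y \<tau>) = approx_state t0 \<alpha> w0 h y \<tau>"
      unfolding P_def by (rule closest_point_cball(2)[OF B]) (use xB that in blast)
    then show ?thesis by (simp add: velocity_def F_def)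
  qed
  have "bmeas t0 \<theta> M' (velocity t0 \<theta> \<alpha> f w0 h ts \<phi> p q y)"
    using v veq unfolding bmeas_def by (subst measurable_cong[where g="?v"]) auto
  moreover have "integral {t0..t} (velocity t0 \<theta> \<alpha> f w0 h ts \<phi> p q y) = integral {t0..t} ?v" if "t \<in> {t0..\<theta>}" for t
    by (rule integral_cong) (use that veq in auto)
  ultimately have "solution h w0 ts \<phi> p q y"
    using y unfolding solution_def F.solution_def by auto
  then show ?thesis by blast
qed

end

section \<open>Continuous functionals on equicontinuous classes\<close>

definition equi_class :: "real \<Rightarrow> real \<Rightarrow> real \<Rightarrow> (real \<Rightarrow> real) \<Rightarrow> (real \<Rightarrow> real ^ 'n) set" where
  "equi_class a b B \<omega> = {x. \<forall>t\<in>{a..b}. norm (x t) \<le> B \<and> (\<forall>s\<in>{a..b}. norm (x t - x s) \<le> \<omega> \<bar>t - s\<bar>)}"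

lemma equi_class_subsequence:
  fixes X :: "nat \<Rightarrow> real \<Rightarrow> real ^ 'n"
  assumes X: "\<And>n. X n \<in> equi_class a b B \<omega>"
    and \<omega>: "\<And>e. 0 < e \<Longrightarrow> \<exists>d>0. \<forall>u. 0 \<le> u \<and> u < d \<longrightarrow> \<omega> u < e"
  obtains g k where "continuous_on {a..b} g" "strict_mono (k :: nat \<Rightarrow> nat)"
    "\<And>e. 0 < e \<Longrightarrow> \<exists>N. \<forall>n x. n \<ge> N \<and> x \<in> {a..b} \<longrightarrow> norm (X (k n) x - g x) < e"
proof (rule Arzela_Ascoli[of "{a..b}" X B])
  show "norm (X n x) \<le> B" if "x \<in> {a..b}" for n x using X[of n] that by (auto simp: equi_class_def)
  show "\<exists>d>0. \<forall>n y. y \<in> {a..b} \<and> norm (x - y) < d \<longrightarrow> norm (X n x - X n y) < e"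
    if x: "x \<in> {a..b}" and e: "0 < e" for x e
  proof -
    obtain d where d: "0 < d" "\<And>u. 0 \<le> u \<Longrightarrow> u < d \<Longrightarrow> \<omega> u < e" using \<omega>[OF e] by blast
    have "norm (X n x - X n y) < e" if "y \<in> {a..b}" "norm (x - y) < d" for n y
    proof -
      have "norm (X n x - X n y) \<le> \<omega> \<bar>x - y\<bar>" using X[of n] x that by (auto simp: equi_class_def)
      also have "\<dots> < e" using d(2)[of "\<bar>x - y\<bar>"] that by simp
      finally show ?thesis .
    qed
    then show ?thesis using d(1) by blast
  qed
qed (use that in auto)

lemma equi_class_continuous:
  assumes x: "x \<in> equi_class a b B \<omega>"
    and \<omega>: "\<And>e. 0 < e \<Longrightarrow> \<exists>d>0. \<forall>u. 0 \<le> u \<and> u < d \<longrightarrow> \<omega> u < e"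
  shows "continuous_on {a..b} x"
  unfolding continuous_on_iff
proof (intro ballI allI impI)
  fix t and e :: real assume t: "t \<in> {a..b}" and e: "0 < e"
  obtain d where d: "0 < d" "\<And>u. 0 \<le> u \<Longrightarrow> u < d \<Longrightarrow> \<omega> u < e" using \<omega>[OF e] by blast
  have "dist (x s) (x t) < e" if "s \<in> {a..b}" "dist s t < d" for s
  proof -
    have "dist (x s) (x t) \<le> \<omega> \<bar>s - t\<bar>" using x t that by (auto simp: equi_class_def dist_norm)
    also have "\<dots> < e" using d(2)[of "\<bar>s - t\<bar>"] that by (simp add: dist_real_def)
    finally show ?thesis .
  qed
  then show "\<exists>d>0. \<forall>s\<in>{a..b}. dist s t < d \<longrightarrow> dist (x s) (x t) < e" using d(1) by blast
qed

text \<open>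
  The class is relatively compact in the uniform norm, and a continuous functional is uniformly
  continuous near a compact set.
\<close>

lemma functional_uniform_on_equi_class:
  fixes \<sigma> :: "(real \<Rightarrow> real ^ 'n) \<Rightarrow> real"
  assumes \<sigma>: "continuous_functional a b \<sigma>"
    and \<omega>: "\<And>e. 0 < e \<Longrightarrow> \<exists>d>0. \<forall>u. 0 \<le> u \<and> u < d \<longrightarrow> \<omega> u < e"
    and e: "0 < \<epsilon>"
  shows "\<exists>\<delta>>0. \<forall>x\<in>equi_class a b B \<omega>. \<forall>y\<in>equi_class a b B \<omega>.
      (\<forall>t\<in>{a..b}. norm (x t - y t) < \<delta>) \<longrightarrow> \<bar>\<sigma> x - \<sigma> y\<bar> < \<epsilon>"
proof (rule ccontr)
  assume no: "\<not> ?thesis"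
  have "\<exists>x y. x \<in> equi_class a b B \<omega> \<and> y \<in> equi_class a b B \<omega> \<and>
      (\<forall>t\<in>{a..b}. norm (x t - y t) < inverse (real (Suc n))) \<and> \<not> \<bar>\<sigma> x - \<sigma> y\<bar> < \<epsilon>" for n
    using no by (metis inverse_positive_iff_positive of_nat_0_less_iff zero_less_Suc)
  then obtain X Y where X: "\<And>n. X n \<in> equi_class a b B \<omega>" and Y: "\<And>n. Y n \<in> equi_class a b B \<omega>"
    and near: "\<And>n t. t \<in> {a..b} \<Longrightarrow> norm (X n t - Y n t) < inverse (real (Suc n))"
    and far: "\<And>n. \<not> \<bar>\<sigma> (X n) - \<sigma> (Y n)\<bar> < \<epsilon>" by metis
  obtain g k where g: "continuous_on {a..b} g" and k: "strict_mono (k :: nat \<Rightarrow> nat)"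
    and lim: "\<And>e. 0 < e \<Longrightarrow> \<exists>N. \<forall>n x. n \<ge> N \<and> x \<in> {a..b} \<longrightarrow> norm (X (k n) x - g x) < e"
    by (rule equi_class_subsequence[OF X \<omega>], assumption, rule that)
  obtain \<delta> where \<delta>: "0 < \<delta>" and D: "\<And>y. continuous_on {a..b} y \<Longrightarrow> (\<forall>t\<in>{a..b}. norm (y t - g t) < \<delta>) \<Longrightarrow> \<bar>\<sigma> y - \<sigma> g\<bar> < \<epsilon> / 2"
    using \<sigma>[unfolded continuous_functional_def, rule_format, OF g, of "\<epsilon> / 2"] e by auto
  obtain N where N: "\<And>n t. n \<ge> N \<Longrightarrow> t \<in> {a..b} \<Longrightarrow> norm (X (k n) t - g t) < \<delta> / 2"
    using lim[of "\<delta> / 2"] \<delta> by auto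
  obtain m where m: "inverse (real (Suc m)) < \<delta> / 2" using reals_Archimedean[of "\<delta> / 2"] \<delta> by auto
  define n where "n = max N m"
  have "m \<le> k n" using seq_suble[OF k, of n] by (simp add: n_def)
  then have kn: "inverse (real (Suc (k n))) < \<delta> / 2" using m by (smt (verit) le_imp_inverse_le of_nat_0_less_iff of_nat_mono Suc_le_mono zero_less_Suc)
  have 1: "norm (X (k n) t - g t) < \<delta>" if "t \<in> {a..b}" for t
    using N[of n t] that \<delta> by (simp add: n_def)
  have 2: "norm (Y (k n) t - g t) < \<delta>" if "t \<in> {a..b}" for t
  proof -
    have "norm (Y (k n) t - g t) \<le> norm (X (k n) t - Y (k n) t) + norm (X (k n) t - g t)"
      using norm_triangle_ineq4[of "X (k n) t - g t" "X (k n) t - Y (k n) t"] by simp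
    then show ?thesis using near[OF that, of "k n"] kn N[of n t] that by (simp add: n_def)
  qed
  have "\<bar>\<sigma> (X (k n)) - \<sigma> g\<bar> < \<epsilon> / 2" by (rule D) (use 1 equi_class_continuous[OF X \<omega>] in auto)
  moreover have "\<bar>\<sigma> (Y (k n)) - \<sigma> g\<bar> < \<epsilon> / 2" by (rule D) (use 2 equi_class_continuous[OF Y \<omega>] in auto)
  ultimately show False using far[of "k n"] by linarith
qed

lemma functional_bounded_on_equi_class:
  fixes \<sigma> :: "(real \<Rightarrow> real ^ 'n) \<Rightarrow> real"
  assumes \<sigma>: "continuous_functional a b \<sigma>"
    and \<omega>: "\<And>e. 0 < e \<Longrightarrow> \<exists>d>0. \<forall>u. 0 \<le> u \<and> u < d \<longrightarrow> \<omega> u < e"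
  shows "\<exists>C. \<forall>x\<in>equi_class a b B \<omega>. \<bar>\<sigma> x\<bar> \<le> C"
proof (rule ccontr)
  assume "\<not> ?thesis"
  then have "\<forall>n. \<exists>x\<in>equi_class a b B \<omega>. \<not> \<bar>\<sigma> x\<bar> \<le> real n" by blast
  then obtain X where X: "\<And>n. X n \<in> equi_class a b B \<omega>" and big: "\<And>n. \<not> \<bar>\<sigma> (X n)\<bar> \<le> real n" by metis
  obtain g k where g: "continuous_on {a..b} g" and k: "strict_mono (k :: nat \<Rightarrow> nat)"
    and lim: "\<And>e. 0 < e \<Longrightarrow> \<exists>N. \<forall>n x. n \<ge> N \<and> x \<in> {a..b} \<longrightarrow> norm (X (k n) x - g x) < e"
    by (rule equi_class_subsequence[OF X \<omega>], assumption, rule that)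
  obtain \<delta> where \<delta>: "0 < \<delta>" and D: "\<And>y. continuous_on {a..b} y \<Longrightarrow> (\<forall>t\<in>{a..b}. norm (y t - g t) < \<delta>) \<Longrightarrow> \<bar>\<sigma> y - \<sigma> g\<bar> < 1"
    using \<sigma>[unfolded continuous_functional_def, rule_format, OF g, of 1] by auto
  obtain N where N: "\<And>n t. n \<ge> N \<Longrightarrow> t \<in> {a..b} \<Longrightarrow> norm (X (k n) t - g t) < \<delta>" using lim[OF \<delta>] by auto
  obtain m :: nat where m: "\<bar>\<sigma> g\<bar> + 1 \<le> real m" using real_arch_simple by blast
  define n where "n = max N m"
  have "\<bar>\<sigma> (X (k n)) - \<sigma> g\<bar> < 1" by (rule D) (use N[of n] equi_class_continuous[OF X \<omega>] in \<open>auto simp: n_def\<close>)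
  moreover have "real m \<le> real (k n)" using seq_suble[OF k, of n] by (simp add: n_def)
  ultimately show False using big[of "k n"] m by linarith
qed

section \<open>Aiming\<close>

text \<open>
  A nearly optimal pair of the minmax and maxmin problems, which have the same value.
\<close>

lemma approx_saddle_point:
  fixes F :: "'u \<Rightarrow> 'v \<Rightarrow> real"
  assumes U: "U \<noteq> {}" and V: "V \<noteq> {}" and bd: "\<And>u v. u \<in> U \<Longrightarrow> v \<in> V \<Longrightarrow> \<bar>F u v\<bar> \<le> C"
    and eq: "(INF u\<in>U. SUP v\<in>V. F u v) = (SUP v\<in>V. INF u\<in>U. F u v)" and e: "0 < e"
  shows "\<exists>u\<in>U. \<exists>v\<in>V. \<forall>u'\<in>U. \<forall>v'\<in>V. F u v' \<le> F u' v + e"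
proof -
  define w where "w = (INF u\<in>U. SUP v\<in>V. F u v)"
  have up: "bdd_above ((\<lambda>v. F u v) ` V)" if "u \<in> U" for u
    using bd[OF that] by (intro bdd_aboveI2[of _ _ C]) (auto simp: abs_le_iff)
  have dn: "bdd_below ((\<lambda>u. F u v) ` U)" if "v \<in> V" for v
    using bd[OF _ that] by (intro bdd_belowI2[of _ "- C"]) (auto simp: abs_le_iff minus_le_iff)
  obtain u where u: "u \<in> U" "(SUP v\<in>V. F u v) < w + e / 2"
  proof -
    have "\<exists>y\<in>(\<lambda>u. SUP v\<in>V. F u v) ` U. y < w + e / 2"
      by (rule cInf_lessD) (use U e in \<open>auto simp: w_def\<close>)
    then show thesis using that by auto
  qed
  obtain v where v: "v \<in> V" "w - e / 2 < (INF u\<in>U. F u v)"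
  proof -
    have "\<exists>y\<in>(\<lambda>v. INF u\<in>U. F u v) ` V. w - e / 2 < y"
      by (rule less_cSupD) (use V e eq in \<open>auto simp: w_def\<close>)
    then show thesis using that by auto
  qed
  have "F u v' \<le> F u' v + e" if "u' \<in> U" "v' \<in> V" for u' v'
    using cSUP_upper[OF that(2) up[OF u(1)]] cINF_lower[OF dn[OF v(1)] that(1)] u(2) v(2) by linarith
  then show ?thesis using u(1) v(1) by blast
qed

context approx_system
begin

text \<open>
  Two plays, numbered \<open>1\<close> and \<open>2\<close>, of possibly different systems with the right-hand side \<open>f\<close>, which start
  from a common initial piece. The last but one clause says that the difference of the states is
  controlled by \<open>s = I\<^sup>\<beta> (\<phi>1 - \<phi>2)\<close>. The last clause is the effect of aiming: at a time \<open>\<tau>\<close> shortly before \<open>t\<close>,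
  the direction \<open>s \<tau>\<close> and the state \<open>x1 \<tau>\<close> were such that the controls now in force push the first play
  less in this direction than the second one.
\<close>

definition aimed where
  "aimed M B \<omega> \<beta> A r \<delta> ts x1 x2 \<phi>1 \<phi>2 p1 q1 p2 q2 \<longleftrightarrow>
     bmeas t0 \<theta> M \<phi>1 \<and> bmeas t0 \<theta> M \<phi>2 \<and> ts \<in> {t0..\<theta>} \<and>
     x1 \<in> equi_class t0 \<theta> B \<omega> \<and> x2 \<in> equi_class t0 \<theta> B \<omega> \<and>
     (\<forall>t. t \<le> ts \<or> \<theta> \<le> t \<longrightarrow> \<phi>1 t = \<phi>2 t) \<and>
     (\<forall>t. ts < t \<and> t < \<theta> \<longrightarrow> p1 t \<in> U \<and> q1 t \<in> V \<and> p2 t \<in> U \<and> q2 t \<in> V \<and>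
        \<phi>1 t = f t (x1 t) (p1 t) (q1 t) \<and> \<phi>2 t = f t (x2 t) (p2 t) (q2 t)) \<and>
     (\<forall>t\<in>{t0..\<theta>}. \<forall>m. (\<forall>\<xi>\<in>{t0..t}. norm (volterra t0 \<theta> (rl_kernel \<beta>) (\<lambda>\<tau>. \<phi>1 \<tau> - \<phi>2 \<tau>) \<xi>) \<le> m) \<longrightarrow>
        norm (x1 t - x2 t) \<le> A * m + r) \<and>
     (\<forall>t. ts < t \<and> t < \<theta> \<longrightarrow> (\<exists>\<tau>\<in>{ts..t}. t - \<tau> < \<delta> \<and>
        volterra t0 \<theta> (rl_kernel \<beta>) (\<lambda>\<tau>. \<phi>1 \<tau> - \<phi>2 \<tau>) \<tau> \<bullet> f \<tau> (x1 \<tau>) (p1 t) (q1 t) \<le>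
        volterra t0 \<theta> (rl_kernel \<beta>) (\<lambda>\<tau>. \<phi>1 \<tau> - \<phi>2 \<tau>) \<tau> \<bullet> f \<tau> (x1 \<tau>) (p2 t) (q2 t) + r))"

definition aiming_bound where
  "aiming_bound M B \<omega> \<beta> A r e \<longleftrightarrow> (\<exists>\<delta>>0. \<forall>ts x1 x2 \<phi>1 \<phi>2 p1 q1 p2 q2.
     aimed M B \<omega> \<beta> A r \<delta> ts x1 x2 \<phi>1 \<phi>2 p1 q1 p2 q2 \<longrightarrow>
     (\<forall>t\<in>{t0..\<theta>}. norm (volterra t0 \<theta> (rl_kernel \<beta>) (\<lambda>\<tau>. \<phi>1 \<tau> - \<phi>2 \<tau>) t) \<le> e))"

lemma f_uniformly_continuous:
  assumes B: "0 \<le> B" and e: "0 < e"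
  obtains d where "0 < d" "\<And>t t' x x' u v. t \<in> {t0..\<theta>} \<Longrightarrow> t' \<in> {t0..\<theta>} \<Longrightarrow> norm x \<le> B \<Longrightarrow> norm x' \<le> B \<Longrightarrow>
     u \<in> U \<Longrightarrow> v \<in> V \<Longrightarrow> \<bar>t - t'\<bar> < d \<Longrightarrow> norm (x - x') < d \<Longrightarrow> norm (f t x u v - f t' x' u v) < e"
proof -
  define D where "D = {t0..\<theta>} \<times> cball (0::real^'n) B \<times> U \<times> V"
  have "uniformly_continuous_on D (\<lambda>(t, x, u, v). f t x u v)"
    by (rule compact_uniformly_continuous)
       (auto simp: D_def intro!: compact_Times U V continuous_on_subset[OF f_cont])
  then obtain d where d: "0 < d" and D: "\<And>z z'. z \<in> D \<Longrightarrow> z' \<in> D \<Longrightarrow> dist z' z < d \<Longrightarrow>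
      dist (case z' of (t, x, u, v) \<Rightarrow> f t x u v) (case z of (t, x, u, v) \<Rightarrow> f t x u v) < e"
    unfolding uniformly_continuous_on_def using e by metis
  show thesis
  proof (rule that[of "d / 2"])
    fix t t' x x' u v
    assume a: "t \<in> {t0..\<theta>}" "t' \<in> {t0..\<theta>}" "norm (x :: real^'n) \<le> B" "norm x' \<le> B" "u \<in> U" "v \<in> V" "\<bar>t - t'\<bar> < d / 2" "norm (x - x') < d / 2"
    have "dist (t, x, u, v) (t', x', u, v) \<le> dist t t' + dist x x'"
      using sqrt_sum_squares_le_sum[of "dist t t'" "dist x x'"] by (simp add: dist_Pair_Pair)
    also have "\<dots> < d" using a by (simp add: dist_norm)
    finally have "dist (f t x u v) (f t' x' u v) < e"
      using D[of "(t', x', u, v)" "(t, x, u, v)"] a by (simp add: D_def)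
    then show "norm (f t x u v - f t' x' u v) < e" by (simp add: dist_norm)
  qed (use d in simp)
qed

text \<open>
  Compare the velocities at \<open>t\<close> with the aimed-at values at \<open>\<tau>\<close>: the controls are the same, the arguments
  of \<open>f\<close> are close, and \<open>s\<close> has hardly changed. This bounds \<open>s t \<bullet> (\<phi>1 t - \<phi>2 t)\<close> by \<open>L * A\<close> times the
  squared supremum of \<open>\<parallel>s\<parallel>\<close> over the past, up to a multiple of \<open>r\<close>. The energy inequality turns this into a
  Volterra inequality for \<open>\<parallel>s\<parallel>\<^sup>2\<close>, and the Gronwall factor gives \<open>\<parallel>s\<parallel>\<^sup>2 \<le> G * (r + r)\<close> with a constant \<open>G\<close> that
  does not depend on \<open>r\<close>.
\<close>

lemma aiming_estimate:
  assumes \<beta>: "0 < \<beta>" "\<beta> \<le> 1" and A: "0 \<le> A" and M: "0 \<le> M" and B: "0 \<le> B" and \<eta>: "0 < \<eta>"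
    and \<omega>: "\<And>e. 0 < e \<Longrightarrow> \<exists>d>0. \<forall>u. 0 \<le> u \<and> u < d \<longrightarrow> \<omega> u < e"
  obtains r e where "0 < r" "A * e + r < \<eta>" "aiming_bound M B \<omega> \<beta> A r e"
proof -
  have kr: "vkernel (rl_kernel \<beta>)" by (rule vkernel_rl[OF \<beta>(1)])
  define T where "T = \<theta> - t0"
  have T: "0 < T" using t0\<theta> by (simp add: T_def)
  define mT where "mT = mass (rl_kernel \<beta>) T"
  have mT: "0 \<le> mT" unfolding mT_def by (rule mass_nonneg[OF kr])
  define S where "S = mT * (M + M)"
  have S: "0 \<le> S" using mT M by (simp add: S_def)
  obtain L where L: "0 < L" and lip: "\<And>t x x' u v. t \<in> {t0..\<theta>} \<Longrightarrow> norm x \<le> B \<Longrightarrow> norm x' \<le> B \<Longrightarrow> u \<in> U \<Longrightarrow> v \<in> V \<Longrightarrow>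
      norm (f t x u v - f t x' u v) \<le> L * norm (x - x')"
    using f_lip[rule_format, OF B] by auto
  define K where "K \<tau> = 2 * L * A * rl_kernel \<beta> \<tau>" for \<tau>
  have K: "vkernel K" unfolding K_def using vkernel_cmul[OF kr, of "2 * L * A"] L A by simp
  obtain G0 where G0: "0 < G0" and gf: "gronwall_factor K T G0" by (rule volterra_gronwall[OF K])
  define G where "G = G0 * (2 * mT * (2 + 2 * S + S * L))"
  have G: "0 \<le> G" unfolding G_def using G0 mT S L by simp
  define e where "e = \<eta> / (A + 2)"
  \<comment> \<open>The first bound on \<open>r\<close> gives \<open>A * e + r < \<eta>\<close>, the second one \<open>G * (r + r) \<le> e\<^sup>2\<close>; adding \<open>1\<close> covers \<open>G = 0\<close>.\<close>
  define r where "r = min e (e\<^sup>2 / (2 * G + 1))"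
  have e: "0 < e" unfolding e_def using \<eta> A by simp
  have r: "0 < r" "0 \<le> r" unfolding r_def using e G by simp_all
  have "A * e + r \<le> A * e + e" by (simp add: r_def)
  also have "\<dots> < (A + 2) * e" using e by (simp add: distrib_right)
  also have "(A + 2) * e = \<eta>" using A by (simp add: e_def)
  finally have re: "A * e + r < \<eta>" .
  have "r \<le> e\<^sup>2 / (2 * G + 1)" by (simp add: r_def)
  then have "r * (2 * G + 1) \<le> e\<^sup>2" using G by (simp add: pos_le_divide_eq)
  then have Ge: "G * (r + r) \<le> e\<^sup>2" using r by (simp add: algebra_simps)
  have "aiming_bound M B \<omega> \<beta> A r e"
  proof -
    obtain d1 where d1: "0 < d1" and F: "\<And>t t' x x' u v. t \<in> {t0..\<theta>} \<Longrightarrow> t' \<in> {t0..\<theta>} \<Longrightarrow> norm x \<le> B \<Longrightarrow> norm x' \<le> B \<Longrightarrow>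
     u \<in> U \<Longrightarrow> v \<in> V \<Longrightarrow> \<bar>t - t'\<bar> < d1 \<Longrightarrow> norm (x - x') < d1 \<Longrightarrow> norm (f t x u v - f t' x' u v) < r"
      by (rule f_uniformly_continuous[OF B r(1)], rule that)
    obtain d2 where d2: "0 < d2" "\<And>u. 0 \<le> u \<Longrightarrow> u < d2 \<Longrightarrow> \<omega> u < d1" using \<omega>[OF d1] by blast
    \<comment> \<open>By \<open>volterra_modulus\<close>, \<open>s\<close> moves by at most \<open>2 * (M + M) * e3\<close> between \<open>\<tau>\<close> and \<open>t\<close>; the inner product
      with \<open>\<phi> t\<close>, of norm at most \<open>M + M\<close>, turns this into at most \<open>r\<close>.\<close>
    define e3 where "e3 = r / (8 * M * M + 1)"
    have e3: "0 < e3" unfolding e3_def using r M by (intro divide_pos_pos) (auto intro: add_nonneg_pos)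
    obtain d3 where d3: "0 < d3" "\<And>u. 0 \<le> u \<Longrightarrow> u < d3 \<Longrightarrow> mass (rl_kernel \<beta>) u < e3" using mass_small[OF kr e3] by blast
    define \<delta> where "\<delta> = min d1 (min d2 d3)"
    show ?thesis
      unfolding aiming_bound_def
    proof (intro exI[of _ \<delta>] conjI allI impI)
      show "0 < \<delta>" using d1 d2 d3 by (simp add: \<delta>_def)
      fix ts x1 x2 \<phi>1 \<phi>2 p1 q1 p2 q2
      assume am: "aimed M B \<omega> \<beta> A r \<delta> ts x1 x2 \<phi>1 \<phi>2 p1 q1 p2 q2"
      define \<phi> where "\<phi> \<tau> = \<phi>1 \<tau> - \<phi>2 \<tau>" for \<tau>
      define s where "s = volterra t0 \<theta> (rl_kernel \<beta>) \<phi>"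
      have \<phi>12: "bmeas t0 \<theta> M \<phi>1" "bmeas t0 \<theta> M \<phi>2" and ts: "ts \<in> {t0..\<theta>}"
        and x1: "x1 \<in> equi_class t0 \<theta> B \<omega>" and x2: "x2 \<in> equi_class t0 \<theta> B \<omega>"
        using am unfolding aimed_def by auto
      have \<phi>0: "\<phi> t = 0" if "t \<le> ts \<or> \<theta> \<le> t" for t
      proof -
        have "\<forall>t. t \<le> ts \<or> \<theta> \<le> t \<longrightarrow> \<phi>1 t = \<phi>2 t" using am unfolding aimed_def by blast
        then show ?thesis using that by (auto simp: \<phi>_def)
      qed
      have inUV: "p1 t \<in> U" "q1 t \<in> V" "p2 t \<in> U" "q2 t \<in> V"
        and \<phi>f: "\<phi> t = f t (x1 t) (p1 t) (q1 t) - f t (x2 t) (p2 t) (q2 t)" if "ts < t" "t < \<theta>" for t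
        using am that unfolding aimed_def \<phi>_def by auto
      have H: "norm (x1 t - x2 t) \<le> A * m + r" if "t \<in> {t0..\<theta>}" "\<And>\<xi>. \<xi> \<in> {t0..t} \<Longrightarrow> norm (s \<xi>) \<le> m" for t m
        using am that unfolding aimed_def s_def \<phi>_def[abs_def] by blast
      have aim: "\<exists>\<tau>\<in>{ts..t}. t - \<tau> < \<delta> \<and> s \<tau> \<bullet> f \<tau> (x1 \<tau>) (p1 t) (q1 t) \<le> s \<tau> \<bullet> f \<tau> (x1 \<tau>) (p2 t) (q2 t) + r"
        if "ts < t" "t < \<theta>" for t
        using am that unfolding aimed_def s_def \<phi>_def[abs_def] by blast
      have b\<phi>: "bmeas t0 \<theta> (M + M) \<phi>" unfolding \<phi>_def by (rule bmeas_diff[OF \<phi>12])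
      have sc: "continuous_on {t0..\<theta>} s" unfolding s_def by (rule volterra_continuous[OF kr rl_kernel_antimono[OF \<beta>] b\<phi>])
      have bs: "bmeas t0 \<theta> S s" using volterra_bmeas[OF kr rl_kernel_antimono[OF \<beta>] b\<phi>] by (simp add: s_def S_def mT_def T_def)
      have xB: "norm (x1 t) \<le> B" "norm (x2 t) \<le> B" if "t \<in> {t0..\<theta>}" for t
        using x1 x2 that by (auto simp: equi_class_def)
      have point: "s t \<bullet> \<phi> t \<le> L * A * m\<^sup>2 + ((2 + 2 * S) * r + S * L * r)"
        if t: "t \<in> {t0..\<theta>}" and m: "\<And>\<xi>. \<xi> \<in> {t0..t} \<Longrightarrow> norm (s \<xi>) \<le> m" for t m
      proof (cases "t \<le> ts \<or> \<theta> \<le> t")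
        case True
        have "0 \<le> L * A * m\<^sup>2 + ((2 + 2 * S) * r + S * L * r)" using L A S r by simp
        then show ?thesis using \<phi>0[OF True] by simp
      next
        case False
        then have t': "ts < t" "t < \<theta>" by auto
        obtain \<tau> where \<tau>: "\<tau> \<in> {ts..t}" "t - \<tau> < \<delta>"
          and aim\<tau>: "s \<tau> \<bullet> f \<tau> (x1 \<tau>) (p1 t) (q1 t) \<le> s \<tau> \<bullet> f \<tau> (x1 \<tau>) (p2 t) (q2 t) + r"
          using aim[OF t'] by blast
        have \<tau>\<theta>: "\<tau> \<in> {t0..\<theta>}" using \<tau> ts t by auto
        have ab: "\<bar>t - \<tau>\<bar> = t - \<tau>" "0 \<le> t - \<tau>" using \<tau> by auto
        have sm: "norm (s \<tau>) \<le> m" using m \<tau> ts by auto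
        have m0: "0 \<le> m" using order_trans[OF norm_ge_zero sm] .
        have sS: "norm (s \<tau>) \<le> S" using bs \<tau>\<theta> by (auto simp: bmeas_def)
        have dx: "norm (x1 t - x1 \<tau>) < d1"
        proof -
          have "norm (x1 t - x1 \<tau>) \<le> \<omega> \<bar>t - \<tau>\<bar>" using x1 t \<tau>\<theta> unfolding equi_class_def by blast
          then have "norm (x1 t - x1 \<tau>) \<le> \<omega> (t - \<tau>)" by (simp only: ab(1))
          also have "\<dots> < d1" by (rule d2(2)) (use \<tau> ab in \<open>auto simp: \<delta>_def\<close>)
          finally show ?thesis .
        qed
        have dt: "\<bar>t - \<tau>\<bar> < d1" using \<tau> ab by (simp add: \<delta>_def)
        have f1: "norm (f t (x1 t) (p1 t) (q1 t) - f \<tau> (x1 \<tau>) (p1 t) (q1 t)) \<le> r"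
          using F[OF t \<tau>\<theta> xB(1)[OF t] xB(1)[OF \<tau>\<theta>] inUV(1,2)[OF t'] dt dx] by simp
        have f2: "norm (f t (x1 t) (p2 t) (q2 t) - f \<tau> (x1 \<tau>) (p2 t) (q2 t)) \<le> r"
          using F[OF t \<tau>\<theta> xB(1)[OF t] xB(1)[OF \<tau>\<theta>] inUV(3,4)[OF t'] dt dx] by simp
        have f3: "norm (f t (x1 t) (p2 t) (q2 t) - f t (x2 t) (p2 t) (q2 t)) \<le> L * (A * m + r)"
        proof -
          have "norm (f t (x1 t) (p2 t) (q2 t) - f t (x2 t) (p2 t) (q2 t)) \<le> L * norm (x1 t - x2 t)"
            by (rule lip[OF t xB[OF t] inUV(3,4)[OF t']])
          also have "\<dots> \<le> L * (A * m + r)" using H[OF t m] L by (intro mult_left_mono) auto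
          finally show ?thesis .
        qed
        have CS: "s \<tau> \<bullet> w \<le> norm (s \<tau>) * k" if "norm w \<le> k" for w k
          using norm_cauchy_schwarz[of "s \<tau>" w] mult_left_mono[OF that norm_ge_zero[of "s \<tau>"]] by linarith
        have g1: "s \<tau> \<bullet> (f t (x1 t) (p1 t) (q1 t) - f \<tau> (x1 \<tau>) (p1 t) (q1 t)) \<le> S * r"
          using CS[OF f1] mult_right_mono[OF sS, of r] r by linarith
        have g2: "s \<tau> \<bullet> (f \<tau> (x1 \<tau>) (p2 t) (q2 t) - f t (x1 t) (p2 t) (q2 t)) \<le> S * r"
          using CS[OF f2[unfolded norm_minus_commute[of "f t (x1 t) (p2 t) (q2 t)"]]] mult_right_mono[OF sS, of r] r by linarith
        have g3: "s \<tau> \<bullet> (f t (x1 t) (p2 t) (q2 t) - f t (x2 t) (p2 t) (q2 t)) \<le> L * A * m\<^sup>2 + S * L * r"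
        proof -
          have "s \<tau> \<bullet> (f t (x1 t) (p2 t) (q2 t) - f t (x2 t) (p2 t) (q2 t)) \<le> norm (s \<tau>) * (L * (A * m + r))"
            by (rule CS[OF f3])
          also have "\<dots> = norm (s \<tau>) * (L * A * m) + norm (s \<tau>) * (L * r)" by (simp add: algebra_simps)
          also have "\<dots> \<le> m * (L * A * m) + S * (L * r)"
            using sm sS L A r m0 by (intro add_mono mult_right_mono) auto
          finally show ?thesis by (simp add: power2_eq_square algebra_simps)
        qed
        have g4: "(s t - s \<tau>) \<bullet> \<phi> t \<le> r"
        proof -
          have "norm (s t - s \<tau>) \<le> 2 * (M + M) * mass (rl_kernel \<beta>) \<bar>t - \<tau>\<bar>"
            unfolding s_def using volterra_modulus[OF kr _ b\<phi> \<tau>\<theta> t] rl_kernel_antimono[OF \<beta>] M by force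
          also have "\<dots> \<le> 2 * (M + M) * e3"
            using d3(2)[of "t - \<tau>"] \<tau> ab M by (intro mult_left_mono) (auto simp: \<delta>_def)
          finally have "norm (s t - s \<tau>) * norm (\<phi> t) \<le> (2 * (M + M) * e3) * (M + M)"
            using b\<phi> t e3 M by (intro mult_mono) (auto simp: bmeas_def)
          also have "\<dots> = r * ((8 * M * M) / (8 * M * M + 1))" by (simp add: e3_def)
          also have "\<dots> \<le> r" using r M by (intro mult_left_le) (auto simp: divide_le_eq_1 add_nonneg_pos)
          finally show ?thesis using norm_cauchy_schwarz[of "s t - s \<tau>" "\<phi> t"] by linarith
        qed
        have "s t \<bullet> \<phi> t = (s t - s \<tau>) \<bullet> \<phi> t + s \<tau> \<bullet> (f t (x1 t) (p1 t) (q1 t) - f \<tau> (x1 \<tau>) (p1 t) (q1 t))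
            + (s \<tau> \<bullet> f \<tau> (x1 \<tau>) (p1 t) (q1 t) - s \<tau> \<bullet> f \<tau> (x1 \<tau>) (p2 t) (q2 t))
            + s \<tau> \<bullet> (f \<tau> (x1 \<tau>) (p2 t) (q2 t) - f t (x1 t) (p2 t) (q2 t))
            + s \<tau> \<bullet> (f t (x1 t) (p2 t) (q2 t) - f t (x2 t) (p2 t) (q2 t))"
          unfolding \<phi>f[OF t'] by (simp add: inner_diff_left inner_diff_right)
        also have "\<dots> \<le> r + S * r + r + S * r + (L * A * m\<^sup>2 + S * L * r)"
          using g1 g2 g3 g4 aim\<tau> by linarith
        finally show ?thesis by (simp add: algebra_simps)
      qed
      define a1 where "a1 = (2 + 2 * S) * r + S * L * r"
      have a1: "0 \<le> a1" unfolding a1_def using S L r by simp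
      have bsp: "bmeas t0 \<theta> (S * (M + M)) (\<lambda>\<tau>. s \<tau> \<bullet> \<phi> \<tau>)" by (rule bmeas_inner[OF bs b\<phi>])
      have ec: "continuous_on {t0..\<theta>} (\<lambda>t. (norm (s t))\<^sup>2)" by (intro continuous_intros sc)
      have sub: "exp_subsolution t0 \<theta> K (2 * (mT * a1)) (\<lambda>t. (norm (s t))\<^sup>2)"
        unfolding exp_subsolution_def
      proof (intro allI impI ballI)
        fix m \<kappa> t :: real assume \<kappa>: "0 < \<kappa>" and m: "0 \<le> m"
          and dom: "\<forall>\<tau>\<in>{t0..\<theta>}. (norm (s \<tau>))\<^sup>2 \<le> m * exp (\<kappa> * (\<tau> - t0))" and t: "t \<in> {t0..\<theta>}"
        obtain E where E: "bmeas t0 \<theta> E (\<lambda>\<tau>. L * A * m * exp (\<kappa> * (\<tau> - t0)))"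
          by (rule bmeas_continuous[of t0 \<theta> "\<lambda>\<tau>. L * A * m * exp (\<kappa> * (\<tau> - t0))"]) (auto intro!: continuous_intros)
        obtain E' where E': "bmeas t0 \<theta> E' (\<lambda>\<tau>. L * A * m * exp (\<kappa> * (\<tau> - t0)) + a1)"
          by (rule bmeas_continuous[of t0 \<theta> "\<lambda>\<tau>. L * A * m * exp (\<kappa> * (\<tau> - t0)) + a1"]) (auto intro!: continuous_intros)
        have "(norm (s t))\<^sup>2 \<le> 2 * volterra t0 \<theta> (rl_kernel \<beta>) (\<lambda>\<tau>. s \<tau> \<bullet> \<phi> \<tau>) t"
          unfolding s_def by (rule fractional_energy[OF \<beta> b\<phi> t])
        also have "volterra t0 \<theta> (rl_kernel \<beta>) (\<lambda>\<tau>. s \<tau> \<bullet> \<phi> \<tau>) t \<le> volterra t0 \<theta> (rl_kernel \<beta>) (\<lambda>\<tau>. L * A * m * exp (\<kappa> * (\<tau> - t0)) + a1) t"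
        proof (rule volterra_mono[OF kr bsp E'])
          fix \<tau> assume \<tau>: "\<tau> \<in> {t0..\<theta>}"
          define \<rho> where "\<rho> = sqrt (m * exp (\<kappa> * (\<tau> - t0)))"
          have \<rho>2: "\<rho>\<^sup>2 = m * exp (\<kappa> * (\<tau> - t0))" using m by (simp add: \<rho>_def)
          have "norm (s \<xi>) \<le> \<rho>" if \<xi>: "\<xi> \<in> {t0..\<tau>}" for \<xi>
          proof (rule power2_le_imp_le)
            have "(norm (s \<xi>))\<^sup>2 \<le> m * exp (\<kappa> * (\<xi> - t0))" using dom \<xi> \<tau> by auto
            also have "\<dots> \<le> m * exp (\<kappa> * (\<tau> - t0))" using \<xi> \<kappa> m by (intro mult_left_mono) auto
            finally show "(norm (s \<xi>))\<^sup>2 \<le> \<rho>\<^sup>2" using \<rho>2 by simp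
            show "0 \<le> \<rho>" using m by (simp add: \<rho>_def)
          qed
          from point[OF \<tau> this] show "s \<tau> \<bullet> \<phi> \<tau> \<le> L * A * m * exp (\<kappa> * (\<tau> - t0)) + a1"
            by (simp add: \<rho>2 a1_def mult.assoc)
        qed
        also have "volterra t0 \<theta> (rl_kernel \<beta>) (\<lambda>\<tau>. L * A * m * exp (\<kappa> * (\<tau> - t0)) + a1) t
            = volterra t0 \<theta> (rl_kernel \<beta>) (\<lambda>\<tau>. L * A * m * exp (\<kappa> * (\<tau> - t0))) t + volterra t0 \<theta> (rl_kernel \<beta>) (\<lambda>_. a1) t"
          by (rule volterra_add[OF kr E bmeas_const[OF order_refl]])
        also have "volterra t0 \<theta> (rl_kernel \<beta>) (\<lambda>_. a1) t = mass (rl_kernel \<beta>) (t - t0) * a1" using volterra_const[OF kr, of t \<theta> t0 a1] t by simp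
        also have "\<dots> \<le> mT * a1"
          unfolding mT_def using a1 t by (intro mult_right_mono mass_mono[OF kr]) (auto simp: T_def)
        also have "volterra t0 \<theta> (rl_kernel \<beta>) (\<lambda>\<tau>. L * A * m * exp (\<kappa> * (\<tau> - t0))) t = L * A * m * volterra t0 \<theta> (rl_kernel \<beta>) (\<lambda>\<tau>. exp (\<kappa> * (\<tau> - t0))) t"
          by (rule volterra_cmul)
        finally have "(norm (s t))\<^sup>2 \<le> 2 * (L * A * m * volterra t0 \<theta> (rl_kernel \<beta>) (\<lambda>\<tau>. exp (\<kappa> * (\<tau> - t0))) t + mT * a1)" by simp
        moreover have "volterra t0 \<theta> K (\<lambda>\<tau>. exp (\<kappa> * (\<tau> - t0))) t = 2 * L * A * volterra t0 \<theta> (rl_kernel \<beta>) (\<lambda>\<tau>. exp (\<kappa> * (\<tau> - t0))) t"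
          by (simp add: volterra_def K_def mult.assoc)
        ultimately show "(norm (s t))\<^sup>2 \<le> 2 * (mT * a1) + m * volterra t0 \<theta> K (\<lambda>\<tau>. exp (\<kappa> * (\<tau> - t0))) t"
          by (simp add: algebra_simps)
      qed
      have "\<forall>t\<in>{t0..\<theta>}. (norm (s t))\<^sup>2 \<le> G0 * (2 * (mT * a1))"
        by (intro ballI gronwall_factorD[OF gf sub _ _ ec]) (use t0\<theta> mT a1 in \<open>auto simp: T_def\<close>)
      moreover have "G0 * (2 * (mT * a1)) \<le> G * (r + r)"
      proof -
        have "a1 \<le> (2 + 2 * S + S * L) * (r + r)"
          using S L r by (simp add: a1_def algebra_simps)
        then have "G0 * (2 * (mT * a1)) \<le> G0 * (2 * (mT * ((2 + 2 * S + S * L) * (r + r))))"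
          using G0 mT by (intro mult_left_mono) auto
        then show ?thesis by (simp add: G_def mult_ac)
      qed
      ultimately have "(norm (s t))\<^sup>2 \<le> e\<^sup>2" if "t \<in> {t0..\<theta>}" for t using Ge that by (blast intro: order_trans)
      then show "\<forall>t\<in>{t0..\<theta>}. norm (volterra t0 \<theta> (rl_kernel \<beta>) (\<lambda>\<tau>. \<phi>1 \<tau> - \<phi>2 \<tau>) t) \<le> e"
        unfolding s_def \<phi>_def[abs_def] using power2_le_imp_le e by (meson less_imp_le)
    qed
  qed
  then show thesis by (rule that[OF r(1) re])
qed

end

section \<open>Comparison of the approximating games\<close>

text \<open>
  \<open>M1\<close> bounds the density of the initial pieces, \<open>B\<close> the states of all motions, and \<open>C\<close> is the constant of the
  majorant common to the kernels of all steps.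
\<close>

locale bounded_game = approx_system t0 \<theta> \<alpha> c U V f
  for t0 \<theta> \<alpha> c :: real
    and U :: "(real ^ 'r) set" and V :: "(real ^ 's) set"
    and f :: "real \<Rightarrow> real ^ 'n \<Rightarrow> real ^ 'r \<Rightarrow> real ^ 's \<Rightarrow> real ^ 'n" +
  fixes M1 R0 B C :: real and \<sigma> :: "(real \<Rightarrow> real ^ 'n) \<Rightarrow> real"
  assumes M1: "0 \<le> M1" and C: "1 \<le> C"
    and gl_kernel_le: "\<And>h \<tau>. 0 < h \<Longrightarrow> gl_kernel \<alpha> h \<tau> \<le> C * power_kernel \<alpha> \<tau>"
    and bounded: "state_bound M1 R0 B"
    and saddle: "\<forall>t\<in>{t0..\<theta>}. \<forall>x l.
         (INF u\<in>U. SUP v\<in>V. inner l (f t x u v)) = (SUP v\<in>V. INF u\<in>U. inner l (f t x u v))"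
    and \<sigma>: "continuous_functional t0 \<theta> \<sigma>"
begin

definition "M = M1 + (1 + B) * c"

definition "\<omega> u = 2 * M * C * mass (power_kernel \<alpha>) u"

definition "pos w0 ts \<phi> rs \<longleftrightarrow> norm w0 \<le> R0 \<and> ts \<in> {t0..\<theta>} \<and> bmeas t0 ts M1 \<phi> \<and> (\<forall>t\<in>{t0..ts}. rs t = integral {t0..t} \<phi>)"

abbreviation "mot h w0 ts rs p q \<equiv> motion t0 \<theta> \<alpha> f w0 h ts rs p q"

abbreviation "st h w0 ts rs p q \<equiv> approx_state t0 \<alpha> w0 h (mot h w0 ts rs p q)"

abbreviation "ve h w0 ts \<phi> rs p q \<equiv> velocity t0 \<theta> \<alpha> f w0 h ts \<phi> p q (mot h w0 ts rs p q)"

lemma B: "0 \<le> B" using bounded by (simp add: state_bound_def)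

lemma M0: "0 \<le> M" unfolding M_def using M1 B c by simp

lemma \<omega>_small: "0 < e \<Longrightarrow> \<exists>d>0. \<forall>u. 0 \<le> u \<and> u < d \<longrightarrow> \<omega> u < e"
proof -
  assume e: "0 < e"
  have p: "0 < 2 * M * C + 1" using M0 C by (intro add_nonneg_pos) auto
  obtain d where d: "0 < d" "\<And>u. 0 \<le> u \<Longrightarrow> u < d \<Longrightarrow> mass (power_kernel \<alpha>) u < e / (2 * M * C + 1)"
    using mass_small[OF vkernel_power[OF \<alpha>0], of "e / (2 * M * C + 1)"] e p by auto
  have "\<omega> u < e" if "0 \<le> u" "u < d" for u
  proof -
    have "\<omega> u \<le> (2 * M * C + 1) * mass (power_kernel \<alpha>) u"
      unfolding \<omega>_def using mass_nonneg[OF vkernel_power[OF \<alpha>0]] by (intro mult_right_mono) auto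
    also have "\<dots> < e" using d(2)[OF that] p by (simp add: field_simps)
    finally show ?thesis .
  qed
  then show "\<exists>d>0. \<forall>u. 0 \<le> u \<and> u < d \<longrightarrow> \<omega> u < e" using d(1) by blast
qed

lemma motion_solution:
  assumes "pos w0 ts \<phi> rs" and h: "0 < h" and p: "p \<in> controls ts \<theta> U" and q: "q \<in> controls ts \<theta> V"
  shows "solution h w0 ts \<phi> p q (mot h w0 ts rs p q)"
proof -
  have ts: "ts \<in> {t0..\<theta>}" and \<phi>: "bmeas t0 ts M1 \<phi>" and rs: "\<And>t. t \<in> {t0..ts} \<Longrightarrow> rs t = integral {t0..t} \<phi>"
    using assms(1) by (auto simp: pos_def)
  obtain y where y: "solution h w0 ts \<phi> p q y" using solution_exists[OF h ts \<phi> p q] by blast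
  then obtain M' where v: "bmeas t0 \<theta> M' (velocity t0 \<theta> \<alpha> f w0 h ts \<phi> p q y)" unfolding solution_def by blast
  have "is_motion t0 \<theta> \<alpha> f w0 h ts rs p q y"
    by (rule integral_form_motion[OF ts rs v]) (use y in \<open>auto simp: solution_def\<close>)
  then have m: "is_motion t0 \<theta> \<alpha> f w0 h ts rs p q (mot h w0 ts rs p q)"
    unfolding motion_def by (rule someI[of "is_motion t0 \<theta> \<alpha> f w0 h ts rs p q"])
  then obtain L where L: "L-lipschitz_on {t0..\<theta>} (mot h w0 ts rs p q)" and y0: "mot h w0 ts rs p q t0 = 0"
    by (auto simp: is_motion_def Lip0_def)
  obtain M' where "bmeas t0 \<theta> M' (ve h w0 ts \<phi> rs p q)"
    using velocity_bmeas[OF h ts \<phi> p q lipschitz_on_continuous_on[OF L] y0] by metis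
  then show ?thesis
    unfolding solution_def using motion_integral_form[OF h ts \<phi> rs p q m] by blast
qed

text \<open>
  The velocities of all motions have the common bound \<open>M\<close>. By \<open>volterra_modulus\<close> and the common majorant
  of the kernels, the states have the common modulus of continuity \<open>\<omega>\<close>.
\<close>

lemma motion_facts:
  assumes ps: "pos w0 ts \<phi> rs" and h: "0 < h" and p: "p \<in> controls ts \<theta> U" and q: "q \<in> controls ts \<theta> V"
  shows "bmeas t0 \<theta> M (ve h w0 ts \<phi> rs p q)"
    and "t \<in> {t0..\<theta>} \<Longrightarrow> st h w0 ts rs p q t = w0 + volterra t0 \<theta> (gl_kernel \<alpha> h) (ve h w0 ts \<phi> rs p q) t"
    and "st h w0 ts rs p q \<in> equi_class t0 \<theta> B \<omega>"
proof -
  have w0: "norm w0 \<le> R0" and ts: "ts \<in> {t0..\<theta>}" and \<phi>: "bmeas t0 ts M1 \<phi>"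
    using ps by (auto simp: pos_def)
  note y = motion_solution[OF ps h p q]
  have bd: "\<forall>t\<in>{t0..\<theta>}. norm (st h w0 ts rs p q t) \<le> B" and v: "bmeas t0 \<theta> M (ve h w0 ts \<phi> rs p q)"
    using solution_bound[OF bounded h w0 ts \<phi> p q y] by (auto simp: M_def)
  show "bmeas t0 \<theta> M (ve h w0 ts \<phi> rs p q)" by (rule v)
  show eq: "st h w0 ts rs p q t = w0 + volterra t0 \<theta> (gl_kernel \<alpha> h) (ve h w0 ts \<phi> rs p q) t" if "t \<in> {t0..\<theta>}" for t
    by (rule solution_state[OF h y that])
  have "norm (st h w0 ts rs p q t - st h w0 ts rs p q s) \<le> \<omega> \<bar>t - s\<bar>" if t: "t \<in> {t0..\<theta>}" and s: "s \<in> {t0..\<theta>}" for t s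
  proof -
    have "norm (st h w0 ts rs p q t - st h w0 ts rs p q s) \<le> 2 * M * mass (gl_kernel \<alpha> h) \<bar>t - s\<bar>"
      unfolding eq[OF t] eq[OF s]
      using volterra_modulus[OF vkernel_gl[OF \<alpha>0 \<alpha>1' h] gl_kernel_antimono[OF \<alpha>0 \<alpha>1' h] v s t M0] by simp
    also have "mass (gl_kernel \<alpha> h) \<bar>t - s\<bar> \<le> C * mass (power_kernel \<alpha>) \<bar>t - s\<bar>"
    proof -
      have "mass (gl_kernel \<alpha> h) \<bar>t - s\<bar> \<le> integral {0..\<bar>t - s\<bar>} (\<lambda>\<tau>. C * power_kernel \<alpha> \<tau>)"
        unfolding mass_def
        by (rule integral_le)
           (auto intro!: kernel_integrable vkernel_gl \<alpha>0 \<alpha>1' h integrable_on_mult_right vkernel_power gl_kernel_le)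
      then show ?thesis by (simp add: mass_def)
    qed
    finally show ?thesis using M0 by (simp add: \<omega>_def mult_left_mono mult.assoc)
  qed
  then show "st h w0 ts rs p q \<in> equi_class t0 \<theta> B \<omega>" using bd by (auto simp: equi_class_def)
qed

lemma motion_causal:
  assumes ps: "pos w0 ts \<phi> rs" and h: "0 < h" and p: "p \<in> controls ts \<theta> U" "p' \<in> controls ts \<theta> U"
    and q: "q \<in> controls ts \<theta> V" "q' \<in> controls ts \<theta> V"
    and t1: "t1 \<in> {t0..\<theta>}" and pp: "ae_eq ts t1 p p'" and qq: "ae_eq ts t1 q q'"
  shows "t \<in> {t0..t1} \<Longrightarrow> st h w0 ts rs p q t = st h w0 ts rs p' q' t"
    and "ae_eq t0 t1 (ve h w0 ts \<phi> rs p q) (ve h w0 ts \<phi> rs p' q')"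
proof -
  have ts: "ts \<in> {t0..\<theta>}" and \<phi>: "bmeas t0 ts M1 \<phi>" using ps by (auto simp: pos_def)
  have m: "mot h w0 ts rs p q s = mot h w0 ts rs p' q' s" if "s \<in> {t0..t1}" for s
    by (rule solution_unique[OF h ts \<phi> p q motion_solution[OF ps h p(1) q(1)] motion_solution[OF ps h p(2) q(2)] t1 pp qq that])
  show st: "st h w0 ts rs p q t = st h w0 ts rs p' q' t" if "t \<in> {t0..t1}" for t
    by (rule approx_state_local[OF h]) (use that m in auto)
  obtain N1 where N1: "negligible N1" "\<And>t. t \<in> {ts..t1} - N1 \<Longrightarrow> p t = p' t"
    using pp unfolding ae_eq_def AE_lebesgue_on_interval_iff by blast
  obtain N2 where N2: "negligible N2" "\<And>t. t \<in> {ts..t1} - N2 \<Longrightarrow> q t = q' t"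
    using qq unfolding ae_eq_def AE_lebesgue_on_interval_iff by blast
  have "ve h w0 ts \<phi> rs p q t = ve h w0 ts \<phi> rs p' q' t" if "t \<in> {t0..t1} - (N1 \<union> N2)" for t
    using that N1(2)[of t] N2(2)[of t] st[of t] by (auto simp: velocity_def)
  then show "ae_eq t0 t1 (ve h w0 ts \<phi> rs p q) (ve h w0 ts \<phi> rs p' q')"
    unfolding ae_eq_def AE_lebesgue_on_interval_iff using N1(1) N2(1) by (intro exI[of _ "N1 \<union> N2"]) auto
qed

definition "game_payoff h w0 ts rs p q = quality t0 \<theta> \<alpha> f \<sigma> w0 h ts rs p q"

lemma payoff_eq: "game_payoff h w0 ts rs p q = \<sigma> (st h w0 ts rs p q)"
  by (simp add: game_payoff_def quality_def)

text \<open>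
  Controls that agree almost everywhere give states that agree on \<open>{t0..\<theta>}\<close>, and the quality index cannot
  tell these apart.
\<close>

lemma payoff_ae:
  assumes ps: "pos w0 ts \<phi> rs" and h: "0 < h" and p: "p \<in> controls ts \<theta> U" "p' \<in> controls ts \<theta> U"
    and q: "q \<in> controls ts \<theta> V" "q' \<in> controls ts \<theta> V" and pp: "ae_eq ts \<theta> p p'" and qq: "ae_eq ts \<theta> q q'"
  shows "game_payoff h w0 ts rs p q = game_payoff h w0 ts rs p' q'"
proof (rule ccontr)
  assume ne: "game_payoff h w0 ts rs p q \<noteq> game_payoff h w0 ts rs p' q'"
  then have "0 < \<bar>\<sigma> (st h w0 ts rs p q) - \<sigma> (st h w0 ts rs p' q')\<bar>" by (simp add: payoff_eq)
  from functional_uniform_on_equi_class[OF \<sigma> \<omega>_small this, of B]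
  obtain \<delta> where \<delta>: "0 < \<delta>" and u: "\<And>x y. x \<in> equi_class t0 \<theta> B \<omega> \<Longrightarrow> y \<in> equi_class t0 \<theta> B \<omega> \<Longrightarrow> (\<forall>t\<in>{t0..\<theta>}. norm (x t - y t) < \<delta>) \<Longrightarrow>
      \<bar>\<sigma> x - \<sigma> y\<bar> < \<bar>\<sigma> (st h w0 ts rs p q) - \<sigma> (st h w0 ts rs p' q')\<bar>" by blast
  have "st h w0 ts rs p q t = st h w0 ts rs p' q' t" if "t \<in> {t0..\<theta>}" for t
    by (rule motion_causal(1)[OF ps h p q _ pp qq that]) (use t0\<theta> in auto)
  then show False
    using u[OF motion_facts(3)[OF ps h p(1) q(1)] motion_facts(3)[OF ps h p(2) q(2)]] \<delta> by simp
qed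

lemma payoff_bounded:
  obtains D where "\<And>h w0 ts \<phi> rs p q. pos w0 ts \<phi> rs \<Longrightarrow> 0 < h \<Longrightarrow> p \<in> controls ts \<theta> U \<Longrightarrow> q \<in> controls ts \<theta> V \<Longrightarrow>
    \<bar>game_payoff h w0 ts rs p q\<bar> \<le> D"
proof -
  obtain D where "\<forall>x\<in>equi_class t0 \<theta> B \<omega>. \<bar>\<sigma> x\<bar> \<le> D"
    using functional_bounded_on_equi_class[OF \<sigma> \<omega>_small] by blast
  then show thesis using that motion_facts(3) unfolding payoff_eq by blast
qed

text \<open>
  The comparison of games is made without distinguishing lower and upper values; that they coincide is
  one of its consequences.
\<close>

definition "either_value h w0 ts rs X \<longleftrightarrow>
  X = lower_value t0 \<theta> \<alpha> U V f \<sigma> w0 h ts rs \<or> X = upper_value t0 \<theta> \<alpha> U V f \<sigma> w0 h ts rs"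

lemma extremal_pair:
  assumes t: "t \<in> {t0..\<theta>}" and z: "0 < \<zeta>"
  shows "\<exists>w. w \<in> U \<times> V \<and> (\<forall>u\<in>U. \<forall>v\<in>V. l \<bullet> f t x (fst w) v \<le> l \<bullet> f t x u (snd w) + \<zeta>)"
proof -
  have "\<exists>u\<in>U. \<exists>v\<in>V. \<forall>u'\<in>U. \<forall>v'\<in>V. l \<bullet> f t x u v' \<le> l \<bullet> f t x u' v + \<zeta>"
  proof (rule approx_saddle_point[OF U(2) V(2), of _ "norm l * ((1 + norm x) * c)"])
    show "\<bar>l \<bullet> f t x u v\<bar> \<le> norm l * ((1 + norm x) * c)" if "u \<in> U" "v \<in> V" for u v
      using Cauchy_Schwarz_ineq2[of l "f t x u v"] f_growth t that by (meson mult_left_mono norm_ge_zero order_trans)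
    show "(INF u\<in>U. SUP v\<in>V. l \<bullet> f t x u v) = (SUP v\<in>V. INF u\<in>U. l \<bullet> f t x u v)" using saddle t by blast
  qed (rule z)
  then obtain u v where "u \<in> U" "v \<in> V" "\<forall>u'\<in>U. \<forall>v'\<in>V. l \<bullet> f t x u v' \<le> l \<bullet> f t x u' v + \<zeta>" by blast
  then show ?thesis by (intro exI[of _ "(u, v)"]) auto
qed

text \<open>
  The aiming function needs the two games only up to the current grid point, because motions depend
  causally on the controls. If the mesh of the grid is below the \<open>\<delta>\<close> of the aiming estimate, the states of
  the two games are close, and so are the payoffs.
\<close>

lemma values_compare:
  assumes ps: "pos w0 ts \<phi> rs" and h1: "0 < h1" and h2: "0 < h2" and \<beta>: "0 < \<beta>" "\<beta> \<le> 1" and r: "0 < r"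
    and aiming: "aiming_bound M B \<omega> \<beta> A r e"
    and H: "\<And>p1 q1 p2 q2 t m. p1 \<in> controls ts \<theta> U \<Longrightarrow> q1 \<in> controls ts \<theta> V \<Longrightarrow> p2 \<in> controls ts \<theta> U \<Longrightarrow> q2 \<in> controls ts \<theta> V \<Longrightarrow>
      t \<in> {t0..\<theta>} \<Longrightarrow>
      (\<forall>\<xi>\<in>{t0..t}. norm (volterra t0 \<theta> (rl_kernel \<beta>) (\<lambda>\<tau>. ve h1 w0 ts \<phi> rs p1 q1 \<tau> - ve h2 w0 ts \<phi> rs p2 q2 \<tau>) \<xi>) \<le> m) \<Longrightarrow>
      norm (st h1 w0 ts rs p1 q1 t - st h2 w0 ts rs p2 q2 t) \<le> A * m + r"
    and small: "\<And>x y. x \<in> equi_class t0 \<theta> B \<omega> \<Longrightarrow> y \<in> equi_class t0 \<theta> B \<omega> \<Longrightarrow>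
      (\<forall>t\<in>{t0..\<theta>}. norm (x t - y t) \<le> A * e + r) \<Longrightarrow> \<bar>\<sigma> x - \<sigma> y\<bar> < \<epsilon>"
    and X: "either_value h1 w0 ts rs X" and Y: "either_value h2 w0 ts rs Y"
  shows "X \<le> Y + \<epsilon>"
proof -
  have ts: "ts \<in> {t0..\<theta>}" using ps by (simp add: pos_def)
  have kr: "vkernel (rl_kernel \<beta>)" by (rule vkernel_rl[OF \<beta>(1)])
  let ?P = "controls ts \<theta> U" and ?Q = "controls ts \<theta> V"
  define J1 where "J1 = game_payoff h1 w0 ts rs"
  define J2 where "J2 = game_payoff h2 w0 ts rs"
  obtain D where D: "\<And>h w0 ts \<phi> rs p q. pos w0 ts \<phi> rs \<Longrightarrow> 0 < h \<Longrightarrow> p \<in> controls ts \<theta> U \<Longrightarrow> q \<in> controls ts \<theta> V \<Longrightarrow>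
    \<bar>game_payoff h w0 ts rs p q\<bar> \<le> D" by (rule payoff_bounded, rule that)
  obtain \<delta> where \<delta>: "0 < \<delta>" and aim: "\<And>ts x1 x2 \<phi>1 \<phi>2 p1 q1 p2 q2. aimed M B \<omega> \<beta> A r \<delta> ts x1 x2 \<phi>1 \<phi>2 p1 q1 p2 q2 \<Longrightarrow>
      (\<forall>t\<in>{t0..\<theta>}. norm (volterra t0 \<theta> (rl_kernel \<beta>) (\<lambda>\<tau>. \<phi>1 \<tau> - \<phi>2 \<tau>) t) \<le> e)"
    using aiming unfolding aiming_bound_def by blast
  obtain n :: nat where n: "(\<theta> - t0) / \<delta> < real n" using reals_Archimedean2 by blast
  define N where "N = Suc n"
  have N: "0 < N" by (simp add: N_def)
  have "\<theta> - t0 < real n * \<delta>" using n \<delta> by (simp add: field_simps)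
  also have "\<dots> \<le> real N * \<delta>" using \<delta> by (simp add: N_def)
  finally have "\<theta> - ts < real N * \<delta>" using ts by simp
  then have mesh: "(\<theta> - ts) / real N < \<delta>" using N by (simp add: field_simps)
  define \<tau> where "\<tau> = grid ts \<theta> N"
  have \<tau>in: "\<tau> j \<in> {ts..\<theta>}" if "j \<le> N" for j
    using grid_mono[of ts \<theta> 0 j N] grid_mono[of ts \<theta> j N N] that N ts by (auto simp: \<tau>_def)
  define sv where "sv p1 q1 p2 q2 = volterra t0 \<theta> (rl_kernel \<beta>) (\<lambda>\<tau>. ve h1 w0 ts \<phi> rs p1 q1 \<tau> - ve h2 w0 ts \<phi> rs p2 q2 \<tau>)" for p1 q1 p2 q2
  define ext where "ext t x l = (SOME w. w \<in> U \<times> V \<and> (\<forall>u\<in>U. \<forall>v\<in>V. l \<bullet> f t x (fst w) v \<le> l \<bullet> f t x u (snd w) + r))" for t x l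
  have ext: "ext t x l \<in> U \<times> V" "u \<in> U \<Longrightarrow> v \<in> V \<Longrightarrow> l \<bullet> f t x (fst (ext t x l)) v \<le> l \<bullet> f t x u (snd (ext t x l)) + r"
    if "t \<in> {t0..\<theta>}" for t x l u v
    using someI_ex[OF extremal_pair[OF that r, of l x]] by (auto simp: ext_def)
  define am where "am j p1 q1 p2 q2 = ext (\<tau> j) (st h1 w0 ts rs p1 q1 (\<tau> j)) (sv p1 q1 p2 q2 (\<tau> j))" for j p1 q1 p2 q2
  have alt: "(\<exists>N>0. \<exists>b. delayed ts \<theta> N U V b \<and> (\<forall>p\<in>?P. K \<le> J2 p (b p))) \<or>
      (\<exists>N>0. \<exists>a. delayed ts \<theta> N V U a \<and> (\<forall>q\<in>?Q. J1 (a q) q \<le> K + \<epsilon>))" for K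
  proof (rule finite_game_alternative[of N ts \<theta> U V J2 am J1 \<epsilon> K])
    show "J2 p q = J2 p' q'" if "p \<in> ?P" "p' \<in> ?P" "q \<in> ?Q" "q' \<in> ?Q" "ae_eq ts \<theta> p p'" "ae_eq ts \<theta> q q'" for p p' q q'
      unfolding J2_def by (rule payoff_ae[OF ps h2 that])
    show "am j p1 q1 p2 q2 \<in> U \<times> V" if "j < N" for j p1 q1 p2 q2
      unfolding am_def by (rule ext(1)) (use \<tau>in[of j] that ts in auto)
    show "am j p1 q1 p2 q2 = am j p1' q1' p2' q2'"
      if j: "j < N" and P: "p1 \<in> ?P" "q1 \<in> ?Q" "p2 \<in> ?P" "q2 \<in> ?Q" "p1' \<in> ?P" "q1' \<in> ?Q" "p2' \<in> ?P" "q2' \<in> ?Q"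
        and eq: "ae_eq ts (grid ts \<theta> N j) p1 p1'" "ae_eq ts (grid ts \<theta> N j) q1 q1'" "ae_eq ts (grid ts \<theta> N j) p2 p2'" "ae_eq ts (grid ts \<theta> N j) q2 q2'"
      for j p1 q1 p2 q2 p1' q1' p2' q2'
    proof -
      have tj: "\<tau> j \<in> {t0..\<theta>}" using \<tau>in[of j] j ts by auto
      note c1 = motion_causal[OF ps h1 P(1,5,2,6) tj eq(1,2)[folded \<tau>_def]]
      note c2 = motion_causal[OF ps h2 P(3,7,4,8) tj eq(3,4)[folded \<tau>_def]]
      have "sv p1 q1 p2 q2 (\<tau> j) = sv p1' q1' p2' q2' (\<tau> j)"
      proof -
        obtain N1 where N1: "negligible N1" "\<And>t. t \<in> {t0..\<tau> j} - N1 \<Longrightarrow> ve h1 w0 ts \<phi> rs p1 q1 t = ve h1 w0 ts \<phi> rs p1' q1' t"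
          using c1(2) unfolding ae_eq_def AE_lebesgue_on_interval_iff by blast
        obtain N2 where N2: "negligible N2" "\<And>t. t \<in> {t0..\<tau> j} - N2 \<Longrightarrow> ve h2 w0 ts \<phi> rs p2 q2 t = ve h2 w0 ts \<phi> rs p2' q2' t"
          using c2(2) unfolding ae_eq_def AE_lebesgue_on_interval_iff by blast
        show ?thesis
          unfolding sv_def volterra_def
        proof (rule integral_spike[of "N1 \<union> N2"])
          fix t assume t: "t \<in> {t0..\<theta>} - (N1 \<union> N2)"
          show "rl_kernel \<beta> (\<tau> j - t) *\<^sub>R (ve h1 w0 ts \<phi> rs p1' q1' t - ve h2 w0 ts \<phi> rs p2' q2' t)
              = rl_kernel \<beta> (\<tau> j - t) *\<^sub>R (ve h1 w0 ts \<phi> rs p1 q1 t - ve h2 w0 ts \<phi> rs p2 q2 t)"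
            using N1(2)[of t] N2(2)[of t] t kernel_zero[OF kr, of "\<tau> j - t"] by (cases "t \<le> \<tau> j") auto
        qed (use N1 N2 in auto)
      qed
      moreover have "st h1 w0 ts rs p1 q1 (\<tau> j) = st h1 w0 ts rs p1' q1' (\<tau> j)" by (rule c1(1)) (use tj in auto)
      ultimately show ?thesis by (simp add: am_def)
    qed
    show "J1 p1 q1 \<le> J2 p2 q2 + \<epsilon>"
      if P: "p1 \<in> ?P" "q1 \<in> ?Q" "p2 \<in> ?P" "q2 \<in> ?Q"
        and play: "\<And>j t. j < N \<Longrightarrow> grid ts \<theta> N j \<le> t \<Longrightarrow> t < grid ts \<theta> N (Suc j) \<Longrightarrow>
          p1 t = fst (am j p1 q1 p2 q2) \<and> q2 t = snd (am j p1 q1 p2 q2)" for p1 q1 p2 q2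
    proof -
      let ?x1 = "st h1 w0 ts rs p1 q1" and ?x2 = "st h2 w0 ts rs p2 q2"
      let ?v1 = "ve h1 w0 ts \<phi> rs p1 q1" and ?v2 = "ve h2 w0 ts \<phi> rs p2 q2"
      have near: "\<exists>\<tau>'\<in>{ts..t}. t - \<tau>' < \<delta> \<and> sv p1 q1 p2 q2 \<tau>' \<bullet> f \<tau>' (?x1 \<tau>') (p1 t) (q1 t) \<le> sv p1 q1 p2 q2 \<tau>' \<bullet> f \<tau>' (?x1 \<tau>') (p2 t) (q2 t) + r"
        if t: "ts < t" "t < \<theta>" for t
      proof -
        obtain j where j: "j < N" "grid ts \<theta> N j \<le> t" "t < grid ts \<theta> N (Suc j)"
          using grid_find_strict[OF N, of ts t \<theta>] t by auto
        have pq: "p1 t = fst (am j p1 q1 p2 q2)" "q2 t = snd (am j p1 q1 p2 q2)" using play[OF j] by auto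
        have tj: "\<tau> j \<in> {ts..t}" using \<tau>in[of j] j by (auto simp: \<tau>_def)
        have "t - \<tau> j < \<delta>" using j(3) grid_step[of ts \<theta> N j] mesh by (simp add: \<tau>_def)
        moreover have "sv p1 q1 p2 q2 (\<tau> j) \<bullet> f (\<tau> j) (?x1 (\<tau> j)) (p1 t) (q1 t) \<le> sv p1 q1 p2 q2 (\<tau> j) \<bullet> f (\<tau> j) (?x1 (\<tau> j)) (p2 t) (q2 t) + r"
          unfolding pq am_def by (rule ext(2)) (use tj t ts P in \<open>auto simp: controls_def\<close>)
        ultimately show ?thesis using tj by blast
      qed
      have "aimed M B \<omega> \<beta> A r \<delta> ts ?x1 ?x2 ?v1 ?v2 p1 q1 p2 q2"
        unfolding aimed_def
      proof (intro conjI)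
        show "\<forall>t. t \<le> ts \<or> \<theta> \<le> t \<longrightarrow> ?v1 t = ?v2 t" using ts by (auto simp: velocity_def)
        show "\<forall>t. ts < t \<and> t < \<theta> \<longrightarrow> p1 t \<in> U \<and> q1 t \<in> V \<and> p2 t \<in> U \<and> q2 t \<in> V \<and>
            ?v1 t = f t (?x1 t) (p1 t) (q1 t) \<and> ?v2 t = f t (?x2 t) (p2 t) (q2 t)"
          using P by (auto simp: velocity_def controls_def)
        show "\<forall>t\<in>{t0..\<theta>}. \<forall>m. (\<forall>\<xi>\<in>{t0..t}. norm (volterra t0 \<theta> (rl_kernel \<beta>) (\<lambda>\<tau>. ?v1 \<tau> - ?v2 \<tau>) \<xi>) \<le> m) \<longrightarrow>
            norm (?x1 t - ?x2 t) \<le> A * m + r"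
          using H[OF P] by blast
        show "\<forall>t. ts < t \<and> t < \<theta> \<longrightarrow> (\<exists>\<tau>\<in>{ts..t}. t - \<tau> < \<delta> \<and>
            volterra t0 \<theta> (rl_kernel \<beta>) (\<lambda>\<tau>. ?v1 \<tau> - ?v2 \<tau>) \<tau> \<bullet> f \<tau> (?x1 \<tau>) (p1 t) (q1 t) \<le>
            volterra t0 \<theta> (rl_kernel \<beta>) (\<lambda>\<tau>. ?v1 \<tau> - ?v2 \<tau>) \<tau> \<bullet> f \<tau> (?x1 \<tau>) (p2 t) (q2 t) + r)"
          using near unfolding sv_def by blast
      qed (use motion_facts[OF ps h1 P(1,2)] motion_facts[OF ps h2 P(3,4)] ts in auto)
      note close = aim[OF this]
      have "norm (?x1 t - ?x2 t) \<le> A * e + r" if t: "t \<in> {t0..\<theta>}" for t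
        by (rule H[OF P t]) (use close t in auto)
      then have "\<bar>\<sigma> ?x1 - \<sigma> ?x2\<bar> < \<epsilon>"
        by (intro small motion_facts(3)[OF ps h1 P(1,2)] motion_facts(3)[OF ps h2 P(3,4)]) auto
      then show ?thesis by (simp add: J1_def J2_def payoff_eq)
    qed
  qed ((use N in blast) | (use ts U(2) V(2) in force))+
  show ?thesis
  proof (rule game_values_compare[of ts \<theta> U V J1 J2 D \<epsilon>])
    show "J p q = J p' q'" if "J \<in> {J1, J2}" "p \<in> ?P" "p' \<in> ?P" "q \<in> ?Q" "q' \<in> ?Q" "ae_eq ts \<theta> p p'" "ae_eq ts \<theta> q q'" for J p p' q q'
      using that payoff_ae[OF ps h1 that(2-7)] payoff_ae[OF ps h2 that(2-7)] by (auto simp: J1_def J2_def)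
    show "\<bar>J p q\<bar> \<le> D" if "J \<in> {J1, J2}" "p \<in> ?P" "q \<in> ?Q" for J p q
      using that D[OF ps h1 that(2,3)] D[OF ps h2 that(2,3)] by (auto simp: J1_def J2_def)
    show "X = (INF a\<in>nonanticipative_strategies ts \<theta> V U. SUP q\<in>?Q. J1 (a q) q) \<or>
      X = (SUP b\<in>nonanticipative_strategies ts \<theta> U V. INF p\<in>?P. J1 p (b p))"
      using X by (simp add: either_value_def lower_value_def upper_value_def J1_def game_payoff_def)
    show "Y = (INF a\<in>nonanticipative_strategies ts \<theta> V U. SUP q\<in>?Q. J2 (a q) q) \<or>
      Y = (SUP b\<in>nonanticipative_strategies ts \<theta> U V. INF p\<in>?P. J2 p (b p))"
      using Y by (simp add: either_value_def lower_value_def upper_value_def J2_def game_payoff_def)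
  qed (use alt ts U V in auto)
qed

text \<open>
  For equal steps take \<open>\<beta> = 1\<close>. Then \<open>s\<close> is the difference of the motions itself, and the Lipschitz constant
  of the states for this step can be used.
\<close>

lemma same_step:
  assumes ps: "pos w0 ts \<phi> rs" and h: "0 < h" and \<epsilon>: "0 < \<epsilon>"
    and X: "either_value h w0 ts rs X" and Y: "either_value h w0 ts rs Y"
  shows "X \<le> Y + \<epsilon>"
proof -
  obtain \<delta> where \<delta>: "0 < \<delta>" and un: "\<forall>x\<in>equi_class t0 \<theta> B \<omega>. \<forall>y\<in>equi_class t0 \<theta> B \<omega>.
      (\<forall>t\<in>{t0..\<theta>}. norm (x t - y t) < \<delta>) \<longrightarrow> \<bar>\<sigma> x - \<sigma> y\<bar> < \<epsilon>"
    using functional_uniform_on_equi_class[OF \<sigma> \<omega>_small \<epsilon>] by blast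
  define A where "A = gl_state_const \<alpha> h (\<theta> - t0)"
  have A: "0 \<le> A" unfolding A_def by (rule gl_state_const_nonneg)
  obtain r e where r: "0 < r" and re: "A * e + r < \<delta>" and ab: "aiming_bound M B \<omega> 1 A r e"
    by (rule aiming_estimate[OF zero_less_one order_refl A M0 B \<delta> \<omega>_small])
  show ?thesis
  proof (rule values_compare[OF ps h h zero_less_one order_refl r ab _ _ X Y])
    show "\<bar>\<sigma> x - \<sigma> y\<bar> < \<epsilon>" if "x \<in> equi_class t0 \<theta> B \<omega>" "y \<in> equi_class t0 \<theta> B \<omega>"
      "\<forall>t\<in>{t0..\<theta>}. norm (x t - y t) \<le> A * e + r" for x y
      using un that re by (meson le_less_trans)
    fix p1 q1 p2 q2 t m
    assume P: "p1 \<in> controls ts \<theta> U" "q1 \<in> controls ts \<theta> V" "p2 \<in> controls ts \<theta> U" "q2 \<in> controls ts \<theta> V"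
      and t: "t \<in> {t0..\<theta>}"
      and m: "\<forall>\<xi>\<in>{t0..t}. norm (volterra t0 \<theta> (rl_kernel 1) (\<lambda>\<tau>. ve h w0 ts \<phi> rs p1 q1 \<tau> - ve h w0 ts \<phi> rs p2 q2 \<tau>) \<xi>) \<le> m"
    have k1: "vkernel (rl_kernel 1)" by (rule vkernel_rl) simp
    have "norm (st h w0 ts rs p1 q1 t - st h w0 ts rs p2 q2 t) \<le> gl_state_const \<alpha> h (\<theta> - t0) * m"
    proof (rule approx_state_diff_le[OF h t])
      fix s assume s: "s \<in> {t0..t}"
      then have s\<theta>: "s \<in> {t0..\<theta>}" using t by auto
      have "mot h w0 ts rs p1 q1 s - mot h w0 ts rs p2 q2 s
          = volterra t0 \<theta> (rl_kernel 1) (ve h w0 ts \<phi> rs p1 q1) s - volterra t0 \<theta> (rl_kernel 1) (ve h w0 ts \<phi> rs p2 q2) s"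
        using motion_solution[OF ps h P(1,2)] motion_solution[OF ps h P(3,4)] s\<theta>
        by (simp add: volterra_rl_kernel_1 solution_def)
      also have "\<dots> = volterra t0 \<theta> (rl_kernel 1) (\<lambda>\<tau>. ve h w0 ts \<phi> rs p1 q1 \<tau> - ve h w0 ts \<phi> rs p2 q2 \<tau>) s"
        by (rule volterra_diff[OF k1 motion_facts(1)[OF ps h P(1,2)] motion_facts(1)[OF ps h P(3,4)], symmetric])
      finally show "norm (mot h w0 ts rs p1 q1 s - mot h w0 ts rs p2 q2 s) \<le> m" using m s by simp
    qed
    then show "norm (st h w0 ts rs p1 q1 t - st h w0 ts rs p2 q2 t) \<le> A * m + r" using r by (simp add: A_def)
  qed
qed

text \<open>
  For small steps take \<open>\<beta> = \<alpha>\<close>. The states differ by \<open>s\<close> up to the \<open>L\<^sup>1\<close> distances of the two kernels to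
  the kernel of order \<open>\<alpha>\<close>, multiplied by the bound \<open>M\<close> of the velocities. Here \<open>h0\<close> does not depend on the
  position.
\<close>

lemma cross_step:
  assumes \<epsilon>: "0 < \<epsilon>"
  shows "\<exists>h0>0. \<forall>h1 h2 w0 ts \<phi> rs X Y. 0 < h1 \<longrightarrow> h1 < h0 \<longrightarrow> 0 < h2 \<longrightarrow> h2 < h0 \<longrightarrow> pos w0 ts \<phi> rs \<longrightarrow>
    either_value h1 w0 ts rs X \<longrightarrow> either_value h2 w0 ts rs Y \<longrightarrow> X \<le> Y + \<epsilon>"
proof -
  obtain \<delta> where \<delta>: "0 < \<delta>" and un: "\<forall>x\<in>equi_class t0 \<theta> B \<omega>. \<forall>y\<in>equi_class t0 \<theta> B \<omega>.
      (\<forall>t\<in>{t0..\<theta>}. norm (x t - y t) < \<delta>) \<longrightarrow> \<bar>\<sigma> x - \<sigma> y\<bar> < \<epsilon>"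
    using functional_uniform_on_equi_class[OF \<sigma> \<omega>_small \<epsilon>] by blast
  obtain r e where r: "0 < r" and re: "1 * e + r < \<delta>" and ab: "aiming_bound M B \<omega> \<alpha> 1 r e"
    by (rule aiming_estimate[OF \<alpha>0 \<alpha>1' zero_le_one M0 B \<delta> \<omega>_small])
  have rM: "0 < r / (2 * M + 1)" using r M0 by simp
  obtain h0 where h0: "0 < h0" and L1: "\<And>h. 0 < h \<Longrightarrow> h < h0 \<Longrightarrow> integral {0..\<theta> - t0} (\<lambda>u. \<bar>gl_kernel \<alpha> h u - rl_kernel \<alpha> u\<bar>) < r / (2 * M + 1)"
    by (rule gl_kernel_L1_convergence[OF \<alpha>0 \<alpha>1' rM], rule that)
  have kr: "vkernel (rl_kernel \<alpha>)" by (rule vkernel_rl[OF \<alpha>0])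
  show ?thesis
  proof (intro exI[of _ h0] conjI allI impI)
    fix h1 h2 w0 ts \<phi> rs X Y
    assume h: "0 < h1" "h1 < h0" "0 < h2" "h2 < h0" and ps: "pos w0 ts \<phi> rs"
      and X: "either_value h1 w0 ts rs X" and Y: "either_value h2 w0 ts rs Y"
    show "X \<le> Y + \<epsilon>"
    proof (rule values_compare[OF ps h(1,3) \<alpha>0 \<alpha>1' r ab _ _ X Y])
      show "\<bar>\<sigma> x - \<sigma> y\<bar> < \<epsilon>" if "x \<in> equi_class t0 \<theta> B \<omega>" "y \<in> equi_class t0 \<theta> B \<omega>"
        "\<forall>t\<in>{t0..\<theta>}. norm (x t - y t) \<le> 1 * e + r" for x y
        using un that re by (meson le_less_trans)
      fix p1 q1 p2 q2 t m
      assume P: "p1 \<in> controls ts \<theta> U" "q1 \<in> controls ts \<theta> V" "p2 \<in> controls ts \<theta> U" "q2 \<in> controls ts \<theta> V"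
        and t: "t \<in> {t0..\<theta>}"
        and m: "\<forall>\<xi>\<in>{t0..t}. norm (volterra t0 \<theta> (rl_kernel \<alpha>) (\<lambda>\<tau>. ve h1 w0 ts \<phi> rs p1 q1 \<tau> - ve h2 w0 ts \<phi> rs p2 q2 \<tau>) \<xi>) \<le> m"
      let ?v1 = "ve h1 w0 ts \<phi> rs p1 q1" and ?v2 = "ve h2 w0 ts \<phi> rs p2 q2"
      note f1 = motion_facts[OF ps h(1) P(1,2)] and f2 = motion_facts[OF ps h(3) P(3,4)]
      have d: "norm (volterra t0 \<theta> (gl_kernel \<alpha> h) v t - volterra t0 \<theta> (rl_kernel \<alpha>) v t) \<le> r / 2" if "0 < h" "h < h0" "bmeas t0 \<theta> M v" for h and v :: "real \<Rightarrow> real ^ 'n"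
      proof -
        have "norm (volterra t0 \<theta> (gl_kernel \<alpha> h) v t - volterra t0 \<theta> (rl_kernel \<alpha>) v t) \<le> M * integral {0..\<theta> - t0} (\<lambda>u. \<bar>gl_kernel \<alpha> h u - rl_kernel \<alpha> u\<bar>)"
          by (rule volterra_gl_kernel_diff_rl_kernel[OF \<alpha>0 \<alpha>1' that(3) t that(1)])
        also have "\<dots> \<le> M * (r / (2 * M + 1))" using L1[OF that(1,2)] M0 by (intro mult_left_mono) auto
        also have "\<dots> \<le> r / 2" using M0 r by (simp add: field_simps)
        finally show ?thesis .
      qed
      have "st h1 w0 ts rs p1 q1 t - st h2 w0 ts rs p2 q2 t
          = (volterra t0 \<theta> (gl_kernel \<alpha> h1) ?v1 t - volterra t0 \<theta> (rl_kernel \<alpha>) ?v1 t) - (volterra t0 \<theta> (gl_kernel \<alpha> h2) ?v2 t - volterra t0 \<theta> (rl_kernel \<alpha>) ?v2 t)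
            + volterra t0 \<theta> (rl_kernel \<alpha>) (\<lambda>\<tau>. ?v1 \<tau> - ?v2 \<tau>) t"
        unfolding f1(2)[OF t] f2(2)[OF t] volterra_diff[OF kr f1(1) f2(1)] by simp
      also have "norm \<dots> \<le> (r / 2 + r / 2) + m"
      proof (intro norm_triangle_mono)
        show "norm (volterra t0 \<theta> (rl_kernel \<alpha>) (\<lambda>\<tau>. ?v1 \<tau> - ?v2 \<tau>) t) \<le> m" using m t by auto
        show "norm ((volterra t0 \<theta> (gl_kernel \<alpha> h1) ?v1 t - volterra t0 \<theta> (rl_kernel \<alpha>) ?v1 t) - (volterra t0 \<theta> (gl_kernel \<alpha> h2) ?v2 t - volterra t0 \<theta> (rl_kernel \<alpha>) ?v2 t)) \<le> r / 2 + r / 2"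
          using order_trans[OF norm_triangle_ineq4 add_mono[OF d[OF h(1,2) f1(1)] d[OF h(3,4) f2(1)]]] .
      qed
      finally show "norm (st h1 w0 ts rs p1 q1 t - st h2 w0 ts rs p2 q2 t) \<le> 1 * m + r" by simp
    qed
  qed (rule h0)
qed

text \<open>
  By \<open>same_step\<close> each of the two values is at most the other, so the value of the game is well defined.
\<close>

lemma game_value_either:
  assumes ps: "pos w0 ts \<phi> rs" and h: "0 < h"
  shows "either_value h w0 ts rs (game_value t0 \<theta> \<alpha> U V f \<sigma> w0 h ts rs)"
proof -
  let ?l = "lower_value t0 \<theta> \<alpha> U V f \<sigma> w0 h ts rs" and ?u = "upper_value t0 \<theta> \<alpha> U V f \<sigma> w0 h ts rs"
  have "?l \<le> ?u" by (rule field_le_epsilon, rule same_step[OF ps h]) (auto simp: either_value_def)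
  moreover have "?u \<le> ?l" by (rule field_le_epsilon, rule same_step[OF ps h]) (auto simp: either_value_def)
  ultimately have "?u = ?l" by simp
  then have "game_value t0 \<theta> \<alpha> U V f \<sigma> w0 h ts rs = ?l" unfolding game_value_def by simp
  then show ?thesis by (simp add: either_value_def)
qed

end

text \<open>
  The limit is taken along one sequence of parameters; the Cauchy condition extends it to all of them.
\<close>

lemma uniform_limit_at_right_of_Cauchy:
  fixes F :: "real \<Rightarrow> 'g \<Rightarrow> real"
  assumes cauchy: "\<And>\<epsilon>. 0 < \<epsilon> \<Longrightarrow> \<exists>h0>0. \<forall>h1 h2. 0 < h1 \<longrightarrow> h1 < h0 \<longrightarrow> 0 < h2 \<longrightarrow> h2 < h0 \<longrightarrow> (\<forall>g\<in>S. \<bar>F h1 g - F h2 g\<bar> \<le> \<epsilon>)"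
  shows "\<exists>\<rho>. uniform_limit S F \<rho> (at_right 0)"
proof -
  define h where "h n = inverse (real (Suc n))" for n
  have h: "0 < h n" for n by (simp add: h_def)
  have h0: "h \<longlonglongrightarrow> 0" unfolding h_def by (rule LIMSEQ_inverse_real_of_nat)
  have ev: "\<exists>N. \<forall>n\<ge>N. h n < d" if "0 < d" for d
    using order_tendstoD(2)[OF h0 that] by (simp add: eventually_sequentially)
  have conv: "convergent (\<lambda>n. F (h n) g)" if g: "g \<in> S" for g
  proof (rule Cauchy_convergent, rule metric_CauchyI)
    fix e :: real assume e: "0 < e"
    obtain d where d: "0 < d" "\<And>h1 h2. 0 < h1 \<Longrightarrow> h1 < d \<Longrightarrow> 0 < h2 \<Longrightarrow> h2 < d \<Longrightarrow> \<bar>F h1 g - F h2 g\<bar> \<le> e / 2"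
      using cauchy[OF half_gt_zero[OF e]] g by blast
    obtain N where N: "\<And>n. n \<ge> N \<Longrightarrow> h n < d" using ev[OF d(1)] by blast
    have "dist (F (h m) g) (F (h n) g) < e" if "m \<ge> N" "n \<ge> N" for m n
      using d(2)[OF h N[OF that(1)] h N[OF that(2)]] e by (simp add: dist_real_def)
    then show "\<exists>M. \<forall>m\<ge>M. \<forall>n\<ge>M. dist (F (h m) g) (F (h n) g) < e" by blast
  qed
  define \<rho> where "\<rho> g = lim (\<lambda>n. F (h n) g)" for g
  have lim: "(\<lambda>n. F (h n) g) \<longlonglongrightarrow> \<rho> g" if "g \<in> S" for g
    using conv[OF that] by (simp add: \<rho>_def convergent_LIMSEQ_iff)
  have "uniform_limit S F \<rho> (at_right 0)"
    unfolding uniform_limit_iff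
  proof (intro allI impI)
    fix e :: real assume e: "0 < e"
    obtain d where d: "0 < d" "\<And>h1 h2 g. 0 < h1 \<Longrightarrow> h1 < d \<Longrightarrow> 0 < h2 \<Longrightarrow> h2 < d \<Longrightarrow> g \<in> S \<Longrightarrow> \<bar>F h1 g - F h2 g\<bar> \<le> e / 2"
      using cauchy[OF half_gt_zero[OF e]] by blast
    obtain N where N: "\<And>n. n \<ge> N \<Longrightarrow> h n < d" using ev[OF d(1)] by blast
    have "dist (F k g) (\<rho> g) < e" if k: "0 < k" "k < d" and g: "g \<in> S" for k g
    proof -
      have "(\<lambda>n. \<bar>F k g - F (h n) g\<bar>) \<longlonglongrightarrow> \<bar>F k g - \<rho> g\<bar>" by (intro tendsto_intros lim[OF g])
      then have "\<bar>F k g - \<rho> g\<bar> \<le> e / 2"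
        by (rule LIMSEQ_le_const2) (use d(2)[OF k h N g] in blast)
      then show ?thesis using e by (simp add: dist_real_def)
    qed
    then show "\<forall>\<^sub>F k in at_right 0. \<forall>g\<in>S. dist (F k g) (\<rho> g) < e"
      unfolding eventually_at_right_field using d(1) by blast
  qed
  then show ?thesis by blast
qed

theorem lemma6:
  fixes t0 \<theta> \<alpha> R0 c :: real
    and U :: "(real ^ 'r) set" and V :: "(real ^ 's) set"
    and f :: "real \<Rightarrow> real ^ 'n \<Rightarrow> real ^ 'r \<Rightarrow> real ^ 's \<Rightarrow> real ^ 'n"
    and \<sigma> :: "(real \<Rightarrow> real ^ 'n) \<Rightarrow> real"
  assumes "t0 < \<theta>" and "0 < \<alpha>" and "\<alpha> < 1" and "R0 > 0"
    and "compact U" and "U \<noteq> {}" and "compact V" and "V \<noteq> {}"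
    and f_continuous:
      "continuous_on ({t0..\<theta>} \<times> UNIV \<times> U \<times> V) (\<lambda>(t, x, u, v). f t x u v)"
    and f_lipschitz:
      "\<forall>R\<ge>0. \<exists>L>0. \<forall>t\<in>{t0..\<theta>}. \<forall>x\<in>cball 0 R. \<forall>x'\<in>cball 0 R. \<forall>u\<in>U. \<forall>v\<in>V.
         norm (f t x u v - f t x' u v) \<le> L * norm (x - x')"
    and "c > 0"
    and f_growth: "\<forall>t\<in>{t0..\<theta>}. \<forall>x. \<forall>u\<in>U. \<forall>v\<in>V. norm (f t x u v) \<le> (1 + norm x) * c"
    and f_saddle: "\<forall>t\<in>{t0..\<theta>}. \<forall>x l.
         (INF u\<in>U. SUP v\<in>V. inner l (f t x u v)) = (SUP v\<in>V. INF u\<in>U. inner l (f t x u v))"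
    and "continuous_functional t0 \<theta> \<sigma>"
  shows "\<exists>\<rho>.
    (\<forall>g\<in>admissible_positions t0 \<theta> \<alpha> c R0.
       ((\<lambda>h. approx_value t0 \<theta> \<alpha> U V f \<sigma> h g) \<longlongrightarrow> \<rho> g) (at_right 0)) \<and>
    uniform_limit (admissible_positions t0 \<theta> \<alpha> c R0) (approx_value t0 \<theta> \<alpha> U V f \<sigma>) \<rho> (at_right 0)"
proof -
  interpret S: approx_system t0 \<theta> \<alpha> c U V f
    by unfold_locales (use assms in auto)
  let ?G = "admissible_positions t0 \<theta> \<alpha> c R0 :: (real \<times> (real \<Rightarrow> real ^ 'n)) set"
  obtain M1 where M1: "0 \<le> M1" and nf: "\<And>ts ws. (ts, ws) \<in> ?G \<Longrightarrow>
    ts \<in> {t0..\<theta>} \<and> ws t0 \<in> cball 0 R0 \<and> (\<exists>\<phi>. bmeas t0 ts M1 \<phi> \<and>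
      (\<forall>t\<in>{t0..ts}. rl_integral t0 (1 - \<alpha>) (\<lambda>t. ws t - ws t0) t = integral {t0..t} \<phi>))"
    by (rule admissible_position_normal_form[OF assms(2,3) \<open>c > 0\<close> \<open>R0 > 0\<close>], rule that)
  obtain C where C: "1 \<le> C" "\<And>h \<tau>. 0 < h \<Longrightarrow> gl_kernel \<alpha> h \<tau> \<le> C * power_kernel \<alpha> \<tau>"
    using gl_kernel_le_power_kernel[OF S.\<alpha>0 S.\<alpha>1'] by blast
  have R0: "0 \<le> R0" using \<open>R0 > 0\<close> by simp
  obtain B where B: "S.state_bound M1 R0 B" by (rule S.state_apriori_bound[OF M1 R0])
  interpret B: bounded_game t0 \<theta> \<alpha> c U V f M1 R0 B C \<sigma>
    by unfold_locales (use M1 B C f_saddle assms in auto)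
  have "\<exists>\<rho>. uniform_limit ?G (approx_value t0 \<theta> \<alpha> U V f \<sigma>) \<rho> (at_right 0)"
  proof (rule uniform_limit_at_right_of_Cauchy)
    fix \<epsilon> :: real assume \<epsilon>: "0 < \<epsilon>"
    obtain h0 where h0: "0 < h0" and X: "\<And>h1 h2 w0 ts \<phi> rs X Y. 0 < h1 \<Longrightarrow> h1 < h0 \<Longrightarrow> 0 < h2 \<Longrightarrow> h2 < h0 \<Longrightarrow> B.pos w0 ts \<phi> rs \<Longrightarrow>
      B.either_value h1 w0 ts rs X \<Longrightarrow> B.either_value h2 w0 ts rs Y \<Longrightarrow> X \<le> Y + \<epsilon>"
      using B.cross_step[OF \<epsilon>] by blast
    have "\<bar>approx_value t0 \<theta> \<alpha> U V f \<sigma> h1 g - approx_value t0 \<theta> \<alpha> U V f \<sigma> h2 g\<bar> \<le> \<epsilon>"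
      if h: "0 < h1" "h1 < h0" "0 < h2" "h2 < h0" and g: "g \<in> ?G" for h1 h2 g
    proof -
      obtain ts ws where gw: "g = (ts, ws)" by (cases g)
      define rs where "rs = rl_integral t0 (1 - \<alpha>) (\<lambda>t. ws t - ws t0)"
      obtain \<phi> where ps: "B.pos (ws t0) ts \<phi> rs"
        using nf[of ts ws] g unfolding gw B.pos_def rs_def by auto
      note e1 = B.game_value_either[OF ps h(1)] and e2 = B.game_value_either[OF ps h(3)]
      show ?thesis
        using X[OF h(1,2,3,4) ps e1 e2] X[OF h(3,4,1,2) ps e2 e1]
        by (simp add: approx_value_def gw rs_def abs_le_iff)
    qed
    then show "\<exists>h0>0. \<forall>h1 h2. 0 < h1 \<longrightarrow> h1 < h0 \<longrightarrow> 0 < h2 \<longrightarrow> h2 < h0 \<longrightarrow>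
        (\<forall>g\<in>?G. \<bar>approx_value t0 \<theta> \<alpha> U V f \<sigma> h1 g - approx_value t0 \<theta> \<alpha> U V f \<sigma> h2 g\<bar> \<le> \<epsilon>)"
      using h0 by blast
  qed
  then obtain \<rho> where \<rho>: "uniform_limit ?G (approx_value t0 \<theta> \<alpha> U V f \<sigma>) \<rho> (at_right 0)" by blast
  then show ?thesis by (intro exI[of _ \<rho>]) (auto intro: tendsto_uniform_limitI)
qed

end
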